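(* Let $K$ be a field of characteristic zero, $R=K[x,y,z]$, and let $A=R/I$ be artinian, where $I=(L_1^{a_1},\dots,L_s^{a_s})$ is generated by powers of general linear forms $L_1,\dots,L_s$ ($a_i$ positive integers). Let $\ell,L\in R$ be two general linear forms. Then the following are equivalent: (a) $A/\ell^3A$ has the Strong Lefschetz Property; (b) for every integer $b$ with $3\le b\le p(A)$, multiplication by $\ell^3$ on $A/L^bA$ has maximal rank in each degree; (c) for every integer $b$ with $3\le b\le p(A)$, the map $\times\ell^3:[A/L^bA]_{j-1}\to[A/L^bA]_{j+2}$ has maximal rank, where $j=p(A/L^bA)$.
   Context: For an algebra $B=R/(M_1^{c_1},\dots,M_r^{c_r})$ with $M_i$ linear forms, $p(B)=\max\{j\mid \sum_{c_i\le j}(j+1-c_i)\le j\}$ (sum over empty set is zero); thus $p(A)$ is computed from $a_1,\dots,a_s$ and $p(A/L^bA)$ from $a_1,\dots,a_s,b$. A map has maximal rank if it is injective or surjective; "maximal rank in each degree" for multiplication by a form of degree $e$ means this for $[B]_{j-e}\to[B]_j$ for all $j$. $B$ has the Strong Lefschetz Property if for a general linear form $M$, multiplication by $M^d$ has maximal rank in each degree for every $d\ge1$. "General" means in a suitable nonempty Zariski open set. *)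

theory Defs
  imports Main "HOL-Library.Poly_Mapping" "HOL-Library.Product_Plus"
begin

text \<open>The polynomial ring R = K[x,y,z]: finitely supported functions from exponent
  triples (a,b,c) (the monomial x^a y^b z^c) to K, with convolution product.\<close>

type_synonym 'k poly3 = "(nat \<times> nat \<times> nat) \<Rightarrow>\<^sub>0 'k"

definition mdeg :: "nat \<times> nat \<times> nat \<Rightarrow> nat" where
  "mdeg m = fst m + fst (snd m) + snd (snd m)"

text \<open>f is homogeneous of degree d (d may be negative; then f = 0).\<close>
definition homog :: "'k::zero poly3 \<Rightarrow> int \<Rightarrow> bool" where
  "homog f d \<longleftrightarrow> (\<forall>m\<in>Poly_Mapping.keys f. int (mdeg m) = d)"

definition linform :: "'k::comm_monoid_add \<Rightarrow> 'k \<Rightarrow> 'k \<Rightarrow> 'k poly3" where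
  "linform c0 c1 c2 = Poly_Mapping.single ((1::nat),(0::nat),(0::nat)) c0 + Poly_Mapping.single ((0::nat),(1::nat),(0::nat)) c1
                      + Poly_Mapping.single ((0::nat),(0::nat),(1::nat)) c2"

definition ideal_gen :: "'k::comm_ring_1 poly3 list \<Rightarrow> 'k poly3 set" where
  "ideal_gen gs = {\<Sum>i<length gs. c i * gs ! i | c. True}"

definition artinian :: "'k::comm_ring_1 poly3 list \<Rightarrow> bool" where
  "artinian gs \<longleftrightarrow> (\<exists>N. \<forall>d\<ge>N. \<forall>f. homog f (int d) \<longrightarrow> f \<in> ideal_gen gs)"

text \<open>Multiplication by the form F of degree e, [B]_{j-e} \<rightarrow> [B]_j, B = R/J,
  is injective / surjective (as a map of quotient spaces R_{j-e}/J_{j-e} \<rightarrow> R_j/J_j).\<close>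
definition mult_inj :: "'k::comm_ring_1 poly3 list \<Rightarrow> 'k poly3 \<Rightarrow> nat \<Rightarrow> int \<Rightarrow> bool" where
  "mult_inj gs F e j \<longleftrightarrow>
     (\<forall>f. homog f (j - int e) \<and> F * f \<in> ideal_gen gs \<longrightarrow> f \<in> ideal_gen gs)"

definition mult_surj :: "'k::comm_ring_1 poly3 list \<Rightarrow> 'k poly3 \<Rightarrow> nat \<Rightarrow> int \<Rightarrow> bool" where
  "mult_surj gs F e j \<longleftrightarrow>
     (\<forall>g. homog g j \<longrightarrow> (\<exists>f. homog f (j - int e) \<and> g - F * f \<in> ideal_gen gs))"

definition max_rank :: "'k::comm_ring_1 poly3 list \<Rightarrow> 'k poly3 \<Rightarrow> nat \<Rightarrow> int \<Rightarrow> bool" where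
  "max_rank gs F e j \<longleftrightarrow> mult_inj gs F e j \<or> mult_surj gs F e j"

definition max_rank_each_degree :: "'k::comm_ring_1 poly3 list \<Rightarrow> 'k poly3 \<Rightarrow> nat \<Rightarrow> bool" where
  "max_rank_each_degree gs F e \<longleftrightarrow> (\<forall>j. max_rank gs F e j)"

type_synonym 'k mpoly = "(nat \<Rightarrow>\<^sub>0 nat) \<Rightarrow>\<^sub>0 'k"

definition mpoly_eval :: "'k::comm_semiring_1 mpoly \<Rightarrow> (nat \<Rightarrow> 'k) \<Rightarrow> 'k" where
  "mpoly_eval P v = (\<Sum>m\<in>Poly_Mapping.keys P. Poly_Mapping.lookup P m * (\<Prod>i\<in>Poly_Mapping.keys m. v i ^ Poly_Mapping.lookup m i))"

text \<open>Property Q holds for a general point of K^n: it holds on a nonempty Zariski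
  open set, i.e. (K infinite) on the non-vanishing locus of a nonzero polynomial
  in the coordinates v 0, ..., v (n-1).\<close>
definition general :: "nat \<Rightarrow> ((nat \<Rightarrow> 'k::comm_semiring_1) \<Rightarrow> bool) \<Rightarrow> bool" where
  "general n Q \<longleftrightarrow> (\<exists>P::'k mpoly. P \<noteq> 0 \<and> (\<forall>m\<in>Poly_Mapping.keys P. Poly_Mapping.keys m \<subseteq> {..<n}) \<and>
      (\<forall>v. mpoly_eval P v \<noteq> 0 \<longrightarrow> Q v))"

definition SLP :: "'k::comm_ring_1 poly3 list \<Rightarrow> bool" where
  "SLP gs \<longleftrightarrow> general 3 (\<lambda>v. \<forall>d\<ge>1.
      max_rank_each_degree gs (linform (v 0) (v 1) (v 2) ^ d) d)"

text \<open>p(B) for B = R/(M_1^{c_1},...,M_r^{c_r}).\<close>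
definition pnum :: "nat list \<Rightarrow> nat" where
  "pnum cs = (GREATEST j. (\<Sum>i | i < length cs \<and> cs ! i \<le> j. j + 1 - cs ! i) \<le> j)"

end

theory Submission
  imports Defs "HOL-Computational_Algebra.Polynomial"
begin

text \<open>
  Write \<open>\<phi>(j) = j + 1 - (\<Sum>c\<^sub>i\<le>j. j + 1 - c\<^sub>i)\<close>. If \<open>F\<close> is a form of degree \<open>e\<close>, then multiplication by \<open>F\<close>
  into \<open>[B]\<^sub>j\<close> is injective as soon as the obvious generators of \<open>(M\<^sub>1^c\<^sub>1, \<dots>, M\<^sub>r^c\<^sub>r, F)\<close> in degree \<open>j\<close>
  are linearly independent, and surjective as soon as they span; both are open conditions, so one
  good configuration suffices. For \<open>F = l\<^sup>e\<close> with \<open>e \<le> 3\<close>, Macaulay duality turns this into a question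
  on polynomials of degree \<open>< e\<close> in the second variable with prescribed multiplicities. For \<open>e = 1\<close>
  this is one-variable Hermite interpolation and gives injectivity for \<open>j \<le> p(B)\<close> and surjectivity for
  \<open>j > p(B)\<close>, hence for \<open>e = 3\<close> only the degrees \<open>p(B) + 1\<close> and \<open>p(B) + 2\<close> can fail. In degree
  \<open>p(B) + 1\<close> the multiplicities reduce to fewer than \<open>D\<close> double points and some simple points on curves of
  degree \<open>D\<close> with a point of multiplicity \<open>D - 2\<close>; Cremona transformations show that they always impose
  independent conditions. In degree \<open>p(A) + 2\<close> they show that \<open>[A/l\<^sup>3A]\<close> has dimension at most one.
  The remaining comparison of (a) and (b) is elementary: if \<open>l\<^sup>3\<close> and \<open>L\<^sup>d\<close> are both injective on \<open>A\<close> into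
  degree \<open>j\<close>, then \<open>L\<^sup>d\<close> on \<open>A/l\<^sup>3A\<close> has maximal rank in degree \<open>j\<close> iff \<open>l\<^sup>3\<close> on \<open>A/L\<^sup>dA\<close> has.
\<close>

subsection \<open>Polynomial functions and general points\<close>

text \<open>Degree \<open>p(B) + 2\<close> cannot be settled numerically for the following reason.
  After common factors are removed, the inequality defining \<open>p\<close> leaves fewer than
  \<open>D\<close> double points in degree \<open>p(B) + 1\<close>, but at least \<open>D\<close> of
  them in degree \<open>p(B) + 2\<close>. With exactly \<open>D\<close> double points,
  \<open>D > 0\<close> even, and no simple ones, the expected dimension is 0, yet there is a curve
  of degree \<open>D / 2\<close> with multiplicity \<open>D / 2 - 1\<close> at infinity through the
  points, and its square survives. This is the failure that (c) has to exclude. A second obstacle is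
  logical: \<open>SLP\<close> chooses its general form after the algebra, while (b) and (c) use the
  form \<open>L\<close> of the given tuple. Passing between the two requires the condition on
  \<open>L\<close> to be either generically true or generically false. That condition involves all
  exponents, so it is first replaced by the generically equivalent (c), a finite conjunction for
  which the dichotomy can be shown. All special configurations have \<open>l = z\<close> and the
  other forms equal to \<open>x + x_k y + y_k z\<close>. A functional killing \<open>z ^ e\<close>
  is then a polynomial of degree below \<open>e\<close> in the second affine coordinate, and for
  \<open>e \<le> 3\<close> such families can be handled explicitly.\<close>

abbreviation lookup :: "('a \<Rightarrow>\<^sub>0 'b::zero) \<Rightarrow> 'a \<Rightarrow> 'b" where "lookup \<equiv> Poly_Mapping.lookup"
abbreviation keys :: "('a \<Rightarrow>\<^sub>0 'b::zero) \<Rightarrow> 'a set" where "keys \<equiv> Poly_Mapping.keys"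
abbreviation single :: "'a \<Rightarrow> 'b \<Rightarrow> 'a \<Rightarrow>\<^sub>0 'b::zero" where "single \<equiv> Poly_Mapping.single"

lemma sum_single_lookup: "(\<Sum>m\<in>keys f. single m (lookup f m)) = f"
proof (rule poly_mapping_eqI)
  fix k
  have "lookup (\<Sum>m\<in>keys f. single m (lookup f m)) k = (\<Sum>m\<in>keys f. if m = k then lookup f m else 0)"
    by (simp add: lookup_sum lookup_single when_def)
  then show "lookup (\<Sum>m\<in>keys f. single m (lookup f m)) k = lookup f k"
    by (simp add: in_keys_iff)
qed

definition monom_eval :: "(nat \<Rightarrow>\<^sub>0 nat) \<Rightarrow> (nat \<Rightarrow> 'k::comm_semiring_1) \<Rightarrow> 'k" where
  "monom_eval m v = (\<Prod>i\<in>keys m. v i ^ lookup m i)"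

lemma monom_eval_superset:
  "finite S \<Longrightarrow> keys m \<subseteq> S \<Longrightarrow> monom_eval m v = (\<Prod>i\<in>S. v i ^ lookup m i)"
  unfolding monom_eval_def
  by (rule prod.mono_neutral_left) (auto simp: in_keys_iff)

lemma monom_eval_add: "monom_eval (a + b) v = monom_eval a v * monom_eval b v"
proof -
  let ?S = "keys a \<union> keys b"
  have "keys (a + b) \<subseteq> ?S" by (rule keys_add)
  then show ?thesis
    by (simp add: monom_eval_superset[of ?S] lookup_add power_add prod.distrib)
qed

lemma mpoly_eval_superset:
  "finite S \<Longrightarrow> keys P \<subseteq> S \<Longrightarrow> mpoly_eval P v = (\<Sum>m\<in>S. lookup P m * monom_eval m v)"
  unfolding mpoly_eval_def monom_eval_def
  by (rule sum.mono_neutral_left) (auto simp: in_keys_iff)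

lemma mpoly_eval_add: "mpoly_eval (P + Q) v = mpoly_eval P v + mpoly_eval Q v"
proof -
  let ?S = "keys P \<union> keys Q"
  have "keys (P + Q) \<subseteq> ?S" by (rule keys_add)
  then show ?thesis
    by (simp add: mpoly_eval_superset[of ?S] lookup_add algebra_simps sum.distrib)
qed

lemma mpoly_eval_0 [simp]: "mpoly_eval 0 v = 0" by (simp add: mpoly_eval_def)

lemma mpoly_eval_sum: "mpoly_eval (\<Sum>i\<in>A. P i) v = (\<Sum>i\<in>A. mpoly_eval (P i) v)"
  by (induction A rule: infinite_finite_induct) (auto simp: mpoly_eval_add)

lemma mpoly_eval_single: "mpoly_eval (single m c) v = c * monom_eval m v"
  by (subst mpoly_eval_superset[of "{m}"]) auto

lemma mpoly_eval_mult: "mpoly_eval (P * Q) v = mpoly_eval P v * mpoly_eval Q v"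
proof -
  have "P * Q = (\<Sum>a\<in>keys P. \<Sum>b\<in>keys Q. single (a + b) (lookup P a * lookup Q b))"
    by (subst sum_single_lookup[of P, symmetric], subst sum_single_lookup[of Q, symmetric])
       (simp add: sum_product mult_single)
  then have "mpoly_eval (P * Q) v =
      (\<Sum>a\<in>keys P. \<Sum>b\<in>keys Q. (lookup P a * monom_eval a v) * (lookup Q b * monom_eval b v))"
    by (simp add: mpoly_eval_sum mpoly_eval_single monom_eval_add mult_ac)
  then show ?thesis
    by (simp add: sum_product mpoly_eval_superset[of "keys P" P] mpoly_eval_superset[of "keys Q" Q])
qed

definition in_vars :: "nat \<Rightarrow> 'k::zero mpoly \<Rightarrow> bool" where
  "in_vars n P \<longleftrightarrow> (\<forall>m\<in>keys P. keys m \<subseteq> {..<n})"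

lemma in_vars_add: "in_vars n P \<Longrightarrow> in_vars n Q \<Longrightarrow> in_vars n (P + Q)"
  unfolding in_vars_def using keys_add[of P Q] by blast

lemma in_vars_mult: "in_vars n P \<Longrightarrow> in_vars n Q \<Longrightarrow> in_vars n (P * Q)"
proof -
  assume P: "in_vars n P" and Q: "in_vars n Q"
  have "keys m \<subseteq> {..<n}" if "m \<in> keys (P * Q)" for m
  proof -
    from that keys_mult[of P Q] obtain a b where ab: "a \<in> keys P" "b \<in> keys Q" "m = a + b" by blast
    then have "keys a \<subseteq> {..<n}" "keys b \<subseteq> {..<n}" using P Q unfolding in_vars_def by blast+
    then show ?thesis using keys_add[of a b] ab(3) by blast
  qed
  then show ?thesis unfolding in_vars_def by blast
qed

text \<open>Uniqueness of base \<open>B\<close> digits, by reduction modulo \<open>B\<close>. It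
  keeps the exponents of distinct monomials distinct under the Kronecker substitution.\<close>

lemma base_expansion_inj:
  fixes a b :: "nat \<Rightarrow> nat"
  assumes "\<And>i. i < n \<Longrightarrow> a i < B" "\<And>i. i < n \<Longrightarrow> b i < B"
    and "(\<Sum>i<n. a i * B ^ i) = (\<Sum>i<n. b i * B ^ i)" and "i < n"
  shows "a i = b i"
  using assms
proof (induction n arbitrary: a b i)
  case (Suc n)
  have ex: "(\<Sum>i<Suc n. c i * B ^ i) = c 0 + B * (\<Sum>i<n. c (Suc i) * B ^ i)" for c :: "nat \<Rightarrow> nat"
    by (simp add: sum.lessThan_Suc_shift sum_distrib_left mult_ac del: sum.lessThan_Suc)
  have B: "B > 0" using Suc.prems(1)[of 0] by simp
  have eq: "a 0 + B * (\<Sum>i<n. a (Suc i) * B ^ i) = b 0 + B * (\<Sum>i<n. b (Suc i) * B ^ i)"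
    using Suc.prems(3) by (simp only: ex)
  have 0: "a 0 = b 0"
    using arg_cong[OF eq, of "\<lambda>x. x mod B"] Suc.prems(1,2)[of 0] by simp
  with eq B have "(\<Sum>i<n. a (Suc i) * B ^ i) = (\<Sum>i<n. b (Suc i) * B ^ i)" by simp
  then have "a (Suc j) = b (Suc j)" if "j < n" for j
    using Suc.prems(1,2) that by (intro Suc.IH[of "\<lambda>j. a (Suc j)" "\<lambda>j. b (Suc j)"]) simp_all
  then show ?case using 0 Suc.prems(4) by (cases i) simp_all
qed simp

text \<open>Kronecker substitution: \<open>v i = t ^ (B ^ i)\<close> turns a nonzero polynomial with
  exponents below \<open>B\<close> into a nonzero univariate one.\<close>
lemma mpoly_nonvanishing_point:
  fixes P :: "'k::field_char_0 mpoly"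
  assumes "P \<noteq> 0" "in_vars n P"
  shows "\<exists>v. mpoly_eval P v \<noteq> 0"
proof -
  define B where "B = Suc (\<Sum>m\<in>keys P. \<Sum>i\<in>keys m. lookup m i)"
  define \<kappa> where "\<kappa> m = (\<Sum>i<n. lookup m i * B ^ i)" for m :: "nat \<Rightarrow>\<^sub>0 nat"
  have small: "lookup m i < B" if "m \<in> keys P" for m i
  proof (cases "i \<in> keys m")
    case True
    have "lookup m i \<le> (\<Sum>i\<in>keys m. lookup m i)" using True by (intro member_le_sum) auto
    also have "\<dots> \<le> (\<Sum>m\<in>keys P. \<Sum>i\<in>keys m. lookup m i)"
      using that by (intro member_le_sum[where f="\<lambda>m. \<Sum>i\<in>keys m. lookup m i"]) auto
    finally show ?thesis by (simp add: B_def)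
  qed (simp add: in_keys_iff B_def)
  have inj: "a = b" if "a \<in> keys P" "b \<in> keys P" "\<kappa> a = \<kappa> b" for a b
  proof (rule poly_mapping_eqI)
    fix i show "lookup a i = lookup b i"
    proof (cases "i < n")
      case True
      then show ?thesis
        using base_expansion_inj[of n "lookup a" B "lookup b"] small that by (simp add: \<kappa>_def)
    next
      case False
      then have "i \<notin> keys a" "i \<notin> keys b" using assms(2) that by (auto simp: in_vars_def)
      then show ?thesis by (simp add: in_keys_iff)
    qed
  qed
  define U where "U = (\<Sum>m\<in>keys P. monom (lookup P m) (\<kappa> m))"
  obtain m0 where m0: "m0 \<in> keys P" using assms(1) by (metis all_not_in_conv keys_eq_empty)
  have "coeff U (\<kappa> m0) = (\<Sum>m\<in>keys P. if m = m0 then lookup P m else 0)"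
    unfolding U_def coeff_sum by (intro sum.cong) (auto dest: inj[OF _ m0])
  also have "\<dots> \<noteq> 0" using m0 by (simp add: in_keys_iff)
  finally have "U \<noteq> 0" by auto
  then have "finite {t. poly U t = 0}" by (simp add: poly_roots_finite)
  then obtain t where t: "poly U t \<noteq> 0"
    using infinite_UNIV_char_0 by (metis (mono_tags, lifting) UNIV_I ex_new_if_finite mem_Collect_eq)
  have "monom_eval m (\<lambda>i. t ^ (B ^ i)) = t ^ \<kappa> m" if "m \<in> keys P" for m
    using assms(2) that
    by (subst monom_eval_superset[of "{..<n}"])
       (auto simp: in_vars_def \<kappa>_def power_sum power_mult[symmetric] mult_ac)
  then have "mpoly_eval P (\<lambda>i. t ^ (B ^ i)) = poly U t"
    by (simp add: mpoly_eval_superset[of "keys P"] U_def poly_sum poly_monom)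
  then show ?thesis using t by metis
qed

text \<open>Functions rather than formal polynomials are the working notion: closure under sums,
  products and substitution is pointwise, and \<open>general_polyfun\<close> translates
  back.\<close>

definition polyfun :: "nat \<Rightarrow> ((nat \<Rightarrow> 'k::comm_ring_1) \<Rightarrow> 'k) set" where
  "polyfun n = {mpoly_eval P | P. in_vars n P}"

lemma polyfun_const: "(\<lambda>v. c) \<in> polyfun n"
proof -
  have "(\<lambda>v. c) = mpoly_eval (single 0 c)"
    by (rule ext) (simp add: mpoly_eval_single monom_eval_def)
  then show ?thesis unfolding polyfun_def by (auto simp: in_vars_def intro!: exI[of _ "single 0 c"] split: if_splits)
qed

lemma polyfun_var: "i < n \<Longrightarrow> (\<lambda>v. v i) \<in> polyfun n"
proof -
  assume "i < n"
  moreover have "(\<lambda>v::nat \<Rightarrow> 'a. v i) = mpoly_eval (single (single i 1) 1)"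
    by (rule ext) (simp add: mpoly_eval_single monom_eval_def)
  ultimately show ?thesis
    unfolding polyfun_def by (auto simp: in_vars_def intro!: exI[of _ "single (single i 1) 1"])
qed

lemma polyfun_add: "f \<in> polyfun n \<Longrightarrow> g \<in> polyfun n \<Longrightarrow> (\<lambda>v. f v + g v) \<in> polyfun n"
proof -
  assume "f \<in> polyfun n" "g \<in> polyfun n"
  then obtain P Q where "f = mpoly_eval P" "g = mpoly_eval Q" "in_vars n P" "in_vars n Q"
    by (auto simp: polyfun_def)
  then show ?thesis
    unfolding polyfun_def by (auto intro!: exI[of _ "P + Q"] in_vars_add simp: mpoly_eval_add)
qed

lemma polyfun_mult: "f \<in> polyfun n \<Longrightarrow> g \<in> polyfun n \<Longrightarrow> (\<lambda>v. f v * g v) \<in> polyfun n"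
proof -
  assume "f \<in> polyfun n" "g \<in> polyfun n"
  then obtain P Q where "f = mpoly_eval P" "g = mpoly_eval Q" "in_vars n P" "in_vars n Q"
    by (auto simp: polyfun_def)
  then show ?thesis
    unfolding polyfun_def by (auto intro!: exI[of _ "P * Q"] in_vars_mult simp: mpoly_eval_mult)
qed

lemma polyfun_diff:
  "f \<in> polyfun n \<Longrightarrow> g \<in> polyfun n \<Longrightarrow> (\<lambda>v. f v - g v) \<in> polyfun n"
proof -
  assume f: "f \<in> polyfun n" and g: "g \<in> polyfun n"
  have "(\<lambda>v. f v + (- 1) * g v) \<in> polyfun n"
    using f polyfun_mult[OF polyfun_const g] by (rule polyfun_add)
  then show ?thesis by simp
qed

lemma polyfun_sum:
  "(\<And>i. i \<in> A \<Longrightarrow> f i \<in> polyfun n) \<Longrightarrow> (\<lambda>v. \<Sum>i\<in>A. f i v) \<in> polyfun n"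
  by (induction A rule: infinite_finite_induct) (simp_all add: polyfun_const polyfun_add)

lemma polyfun_prod:
  "(\<And>i. i \<in> A \<Longrightarrow> f i \<in> polyfun n) \<Longrightarrow> (\<lambda>v. \<Prod>i\<in>A. f i v) \<in> polyfun n"
  by (induction A rule: infinite_finite_induct) (simp_all add: polyfun_const polyfun_mult)

lemma polyfun_power: "f \<in> polyfun n \<Longrightarrow> (\<lambda>v. f v ^ k) \<in> polyfun n"
  by (induction k) (simp_all add: polyfun_const polyfun_mult)

text \<open>Serves to freeze the coordinates of the algebra while the last linear form
  moves.\<close>

lemma polyfun_subst:
  assumes "f \<in> polyfun n" and "\<And>i. i < n \<Longrightarrow> (\<lambda>v. g v i) \<in> polyfun k"
  shows "(\<lambda>v. f (g v)) \<in> polyfun k"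
proof -
  obtain P where P: "f = mpoly_eval P" "in_vars n P" using assms(1) by (auto simp: polyfun_def)
  have "(\<lambda>v. \<Sum>m\<in>keys P. lookup P m * (\<Prod>i\<in>keys m. g v i ^ lookup m i)) \<in> polyfun k"
    using assms(2) P(2)
    by (intro polyfun_sum polyfun_mult polyfun_prod polyfun_power polyfun_const)
       (auto simp: in_vars_def)
  then show ?thesis by (simp add: P(1) mpoly_eval_def)
qed

section \<open>Properties of a general point, and properties that are generically decided\<close>

lemma general_def':
  "general n Q \<longleftrightarrow> (\<exists>P. P \<noteq> 0 \<and> in_vars n P \<and> (\<forall>v. mpoly_eval P v \<noteq> 0 \<longrightarrow> Q v))"
  by (simp add: general_def in_vars_def)

text \<open>In characteristic zero a nonzero polynomial has a point where it does not vanish, so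
  genericity can be proved by exhibiting one good point of an open condition.\<close>

lemma general_polyfun:
  fixes Q :: "(nat \<Rightarrow> 'k::field_char_0) \<Rightarrow> bool"
  shows "general n Q \<longleftrightarrow> (\<exists>f\<in>polyfun n. (\<exists>v. f v \<noteq> 0) \<and> (\<forall>v. f v \<noteq> 0 \<longrightarrow> Q v))"
proof
  assume "general n Q"
  then obtain P where P: "P \<noteq> 0" "in_vars n P" "\<forall>v. mpoly_eval P v \<noteq> 0 \<longrightarrow> Q v"
    unfolding general_def' by auto
  then have "mpoly_eval P \<in> polyfun n" by (auto simp: polyfun_def)
  then show "\<exists>f\<in>polyfun n. (\<exists>v. f v \<noteq> 0) \<and> (\<forall>v. f v \<noteq> 0 \<longrightarrow> Q v)"
    using mpoly_nonvanishing_point[OF P(1,2)] P(3) by (rule_tac bexI) auto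
next
  assume "\<exists>f\<in>polyfun n. (\<exists>v. f v \<noteq> 0) \<and> (\<forall>v. f v \<noteq> 0 \<longrightarrow> Q v)"
  then obtain P v where "in_vars n P" "mpoly_eval P v \<noteq> 0" "\<forall>v. mpoly_eval P v \<noteq> 0 \<longrightarrow> Q v"
    unfolding polyfun_def by auto
  then show "general n Q" unfolding general_def' by (intro exI[of _ P]) auto
qed

lemma generalI:
  fixes Q :: "(nat \<Rightarrow> 'k::field_char_0) \<Rightarrow> bool"
  assumes "f \<in> polyfun n" "f v0 \<noteq> 0" "\<And>v. f v \<noteq> 0 \<Longrightarrow> Q v"
  shows "general n Q"
  using assms general_polyfun by blast

lemma general_mono: "general n Q \<Longrightarrow> (\<And>v. Q v \<Longrightarrow> Q' v) \<Longrightarrow> general n Q'"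
  unfolding general_def by blast

lemma general_conj:
  fixes Q Q' :: "(nat \<Rightarrow> 'k::field_char_0) \<Rightarrow> bool"
  assumes "general n Q" "general n Q'"
  shows "general n (\<lambda>v. Q v \<and> Q' v)"
proof -
  obtain P P' where "P \<noteq> 0" "in_vars n P" "\<forall>v. mpoly_eval P v \<noteq> 0 \<longrightarrow> Q v"
    and "P' \<noteq> 0" "in_vars n P'" "\<forall>v. mpoly_eval P' v \<noteq> 0 \<longrightarrow> Q' v"
    using assms unfolding general_def' by auto
  then show ?thesis
    unfolding general_def' by (intro exI[of _ "P * P'"]) (auto simp: in_vars_mult mpoly_eval_mult)
qed

lemma general_True: "(\<And>v::nat \<Rightarrow> 'k::field_char_0. Q v) \<Longrightarrow> general n Q"
  by (rule generalI[of "\<lambda>v. 1"]) (auto simp: polyfun_const)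

lemma general_ball:
  fixes Q :: "'a \<Rightarrow> (nat \<Rightarrow> 'k::field_char_0) \<Rightarrow> bool"
  assumes "finite A" "\<And>a. a \<in> A \<Longrightarrow> general n (Q a)"
  shows "general n (\<lambda>v. \<forall>a\<in>A. Q a v)"
  using assms
proof (induction A rule: finite_induct)
  case (insert a A)
  then have "general n (\<lambda>v. Q a v \<and> (\<forall>a\<in>A. Q a v))" by (intro general_conj) auto
  then show ?case by (rule general_mono) simp
qed (simp add: general_True)

lemma general_ex: "general n (Q :: (nat \<Rightarrow> 'k::field_char_0) \<Rightarrow> bool) \<Longrightarrow> \<exists>v. Q v"
  unfolding general_polyfun by blast

text \<open>Not automatic for arbitrary properties: over the rationals, being a square is neither
  generic nor generically false.\<close>

definition decided :: "nat \<Rightarrow> ((nat \<Rightarrow> 'k::comm_ring_1) \<Rightarrow> bool) \<Rightarrow> bool" where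
  "decided n Q \<longleftrightarrow> general n Q \<or> general n (\<lambda>v. \<not> Q v)"

lemma decided_cong:
  fixes Q Q' :: "(nat \<Rightarrow> 'k::field_char_0) \<Rightarrow> bool"
  assumes "general n (\<lambda>v. Q v \<longleftrightarrow> Q' v)" "decided n Q"
  shows "decided n Q'"
proof -
  have "general n Q'" if "general n Q"
    by (rule general_mono[OF general_conj[OF assms(1) that]]) blast
  moreover have "general n (\<lambda>v. \<not> Q' v)" if "general n (\<lambda>v. \<not> Q v)"
    by (rule general_mono[OF general_conj[OF assms(1) that]]) blast
  ultimately show ?thesis using assms(2) unfolding decided_def by blast
qed

lemma decided_disj:
  fixes Q Q' :: "(nat \<Rightarrow> 'k::field_char_0) \<Rightarrow> bool"
  assumes "decided n Q" "decided n Q'"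
  shows "decided n (\<lambda>v. Q v \<or> Q' v)"
proof -
  have 1: "general n (\<lambda>v. \<not> (Q v \<or> Q' v))" if "general n (\<lambda>v. \<not> Q v)" "general n (\<lambda>v. \<not> Q' v)"
    by (rule general_mono[OF general_conj[OF that]]) blast
  have 2: "general n (\<lambda>v. Q v \<or> Q' v)" if "general n Q"
    by (rule general_mono[OF that]) simp
  have 3: "general n (\<lambda>v. Q v \<or> Q' v)" if "general n Q'"
    by (rule general_mono[OF that]) simp
  from 1 2 3 show ?thesis using assms unfolding decided_def by blast
qed

lemma decided_ball:
  fixes Q :: "'a \<Rightarrow> (nat \<Rightarrow> 'k::field_char_0) \<Rightarrow> bool"
  assumes "finite A" "\<And>a. a \<in> A \<Longrightarrow> decided n (Q a)"
  shows "decided n (\<lambda>v. \<forall>a\<in>A. Q a v)"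
proof (cases "\<forall>a\<in>A. general n (Q a)")
  case True
  then show ?thesis using general_ball[of A n Q] assms(1) by (simp add: decided_def)
next
  case False
  then obtain a where a: "a \<in> A" "general n (\<lambda>v. \<not> Q a v)"
    using assms(2) unfolding decided_def by blast
  from a(2) have "general n (\<lambda>v. \<not> (\<forall>a\<in>A. Q a v))"
    by (rule general_mono) (use a(1) in blast)
  then show ?thesis unfolding decided_def by blast
qed

subsection \<open>Linear algebra in the polynomial ring\<close>

definition sc :: "'k::comm_ring_1 \<Rightarrow> 'k poly3 \<Rightarrow> 'k poly3" where
  "sc c f = single 0 c * f"

lemma lookup_sc [simp]: "lookup (sc c f) m = c * lookup f m"
  unfolding sc_def mult_map_scale_conv_mult[symmetric]
  by (simp add: Poly_Mapping.map.rep_eq when_def)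

interpretation P3: vector_space "sc :: 'k::field \<Rightarrow> 'k poly3 \<Rightarrow> 'k poly3"
  by unfold_locales (auto simp: poly_mapping_eq_iff fun_eq_iff lookup_add algebra_simps)

lemma sc_mult_left: "sc c f * g = sc c (f * g)"
  and sc_mult_right: "f * sc c g = sc c (f * g)"
  by (simp_all add: sc_def mult_ac)

lemma sc_sum_left: "sc (\<Sum>i\<in>A. c i) f = (\<Sum>i\<in>A. sc (c i) f)"
  by (induction A rule: infinite_finite_induct) (auto simp: sc_def single_add distrib_right)

text \<open>A family instead of a set: when the point moves, members may coincide, while the index
  set has to stay fixed.\<close>

definition lin_indep :: "'i set \<Rightarrow> ('i \<Rightarrow> 'k::field poly3) \<Rightarrow> bool" where
  "lin_indep I w \<longleftrightarrow> (\<forall>c. (\<Sum>i\<in>I. sc (c i) (w i)) = 0 \<longrightarrow> (\<forall>i\<in>I. c i = 0))"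

lemma lin_indepD: "lin_indep I w \<Longrightarrow> (\<Sum>i\<in>I. sc (c i) (w i)) = 0 \<Longrightarrow> i \<in> I \<Longrightarrow> c i = 0"
  by (simp add: lin_indep_def)

lemma span_family:
  assumes "finite I" "x \<in> P3.span (w ` I)"
  shows "\<exists>c. x = (\<Sum>i\<in>I. sc (c i) (w i))"
proof -
  obtain J where J: "J \<subseteq> I" "inj_on w J" "w ` I = w ` J" by (metis subset_image_inj subset_refl)
  have fJ: "finite J" using J(1) assms(1) finite_subset by blast
  obtain u where u: "x = (\<Sum>y\<in>w ` J. sc (u y) y)"
    using assms(2) fJ J(3) by (auto simp: P3.span_finite)
  have "x = (\<Sum>i\<in>J. sc (u (w i)) (w i))" by (simp add: u sum.reindex[OF J(2)])
  also have "\<dots> = (\<Sum>i\<in>I. sc (if i \<in> J then u (w i) else 0) (w i))"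
    by (rule sum.mono_neutral_cong_left) (use assms(1) J(1) in auto)
  finally show ?thesis by (intro exI)
qed

lemma family_span: "(\<Sum>i\<in>I. sc (c i) (w i)) \<in> P3.span (w ` I)"
  by (intro P3.span_sum P3.span_scale P3.span_base) auto

lemma lin_indep_iff:
  assumes "finite I"
  shows "lin_indep I w \<longleftrightarrow> inj_on w I \<and> P3.independent (w ` I)"
proof
  assume L: "lin_indep I w"
  have inj: "inj_on w I"
  proof (rule inj_onI, rule ccontr)
    fix i j assume ij: "i \<in> I" "j \<in> I" "w i = w j" "i \<noteq> j"
    have "(\<Sum>k\<in>I. sc (if k = i then 1 else if k = j then -1 else 0) (w k)) =
       (\<Sum>k\<in>I. (if k = i then w k else 0) - (if k = j then w k else 0))"
      by (intro sum.cong) (use ij in auto)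
    also have "\<dots> = 0" using ij assms by (simp add: sum_subtractf)
    finally show False
      using lin_indepD[OF L, of "\<lambda>k. if k = i then 1 else if k = j then -1 else 0" i] ij(1) by simp
  qed
  have "P3.independent (w ` I)"
  proof -
    have "\<forall>v\<in>w ` I. u v = 0" if "(\<Sum>v\<in>w ` I. sc (u v) v) = 0" for u
      using that lin_indepD[OF L, of "\<lambda>i. u (w i)"] by (simp add: sum.reindex[OF inj])
    then show ?thesis using assms by (auto simp: P3.dependent_finite)
  qed
  with inj show "inj_on w I \<and> P3.independent (w ` I)" ..
next
  assume A: "inj_on w I \<and> P3.independent (w ` I)"
  show "lin_indep I w"
    unfolding lin_indep_def
  proof (intro allI impI ballI)
    fix c i assume s: "(\<Sum>i\<in>I. sc (c i) (w i)) = 0" and i: "i \<in> I"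
    define u where "u v = c (the_inv_into I w v)" for v
    have u: "u (w i) = c i" if "i \<in> I" for i using A that by (simp add: u_def the_inv_into_f_f)
    have "(\<Sum>v\<in>w ` I. sc (u v) v) = (\<Sum>i\<in>I. sc (u (w i)) (w i))"
      using A by (simp add: sum.reindex)
    also have "\<dots> = 0" using s by (simp add: u)
    finally have "u (w i) = 0"
      using A i P3.dependent_finite[of "w ` I"] finite_imageI[OF assms] by blast
    then show "c i = 0" using u i by simp
  qed
qed

lemma lin_indep_card_le:
  assumes "finite I" "finite T" "lin_indep I w" "w ` I \<subseteq> P3.span T"
  shows "card I \<le> card T"
proof -
  have "inj_on w I" "P3.independent (w ` I)" using assms lin_indep_iff by auto
  then show ?thesis
    using P3.independent_span_bound[OF assms(2) _ assms(4)] by (simp add: card_image)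
qed

lemma lin_indep_insert:
  assumes "finite I" "a \<notin> I" "lin_indep I w" "w a \<notin> P3.span (w ` I)"
  shows "lin_indep (insert a I) w"
proof -
  have "inj_on w I" "P3.independent (w ` I)" using assms lin_indep_iff by auto
  moreover have "w a \<notin> w ` I" using assms(4) P3.span_base by blast
  ultimately show ?thesis
    using assms by (subst lin_indep_iff) (auto simp: P3.independent_insert)
qed

lemma not_lin_indepD:
  assumes "finite I" "\<not> lin_indep I w"
  shows "\<exists>i\<in>I. w i \<in> P3.span (w ` (I - {i}))"
proof -
  obtain c i where c: "(\<Sum>i\<in>I. sc (c i) (w i)) = 0" "i \<in> I" "c i \<noteq> 0"
    using assms(2) by (auto simp: lin_indep_def)
  have "sc (c i) (w i) + (\<Sum>j\<in>I - {i}. sc (c j) (w j)) = 0"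
    using c(1,2) assms(1) by (simp add: sum.remove)
  then have "sc (c i) (w i) = - (\<Sum>j\<in>I - {i}. sc (c j) (w j))" by (simp add: eq_neg_iff_add_eq_0)
  then have "sc (c i) (w i) \<in> P3.span (w ` (I - {i}))" by (simp add: P3.span_neg family_span)
  then have "sc (inverse (c i)) (sc (c i) (w i)) \<in> P3.span (w ` (I - {i}))" by (rule P3.span_scale)
  then have "w i \<in> P3.span (w ` (I - {i}))" using c(3) by simp
  with c(2) show ?thesis by blast
qed

subsection \<open>Homogeneous parts\<close>

definition expos :: "nat \<Rightarrow> (nat \<times> nat \<times> nat) set" where "expos d = {m. mdeg m = d}"
definition mon :: "nat \<times> nat \<times> nat \<Rightarrow> 'k::comm_ring_1 poly3" where "mon m = single m 1"
definition hom :: "nat \<Rightarrow> 'k::comm_ring_1 poly3 set" where "hom d = {f. homog f (int d)}"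

lemma mdeg_simp [simp]: "mdeg (a, b, c) = a + b + c"
  and mdeg_add: "mdeg (m + m') = mdeg m + mdeg m'"
  and mdeg_zero [simp]: "mdeg 0 = 0"
  by (simp_all add: mdeg_def)

lemma finite_expos [simp]: "finite (expos d)"
proof (rule finite_subset)
  show "expos d \<subseteq> {..d} \<times> {..d} \<times> {..d}" by (auto simp: expos_def)
qed auto

lemma mon_mult: "mon m * mon m' = mon (m + m')" by (simp add: mon_def mult_single)
lemma mon_zero [simp]: "mon 0 = 1" by (simp add: mon_def)
lemma sc_mon: "sc c (mon m) = single m c" by (simp add: sc_def mon_def mult_single)
lemma lookup_mon: "lookup (mon m) k = (if m = k then 1 else 0)"
  by (simp add: mon_def lookup_single when_def)

lemma homog_add: "homog f d \<Longrightarrow> homog g d \<Longrightarrow> homog (f + g) d"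
  unfolding homog_def using keys_add[of f g] by blast
lemma homog_0 [simp]: "homog 0 d" by (simp add: homog_def)
lemma homog_neg: "homog f d \<Longrightarrow> homog (- f) d"
  unfolding homog_def by (simp add: in_keys_iff)
lemma homog_diff: "homog f d \<Longrightarrow> homog g d \<Longrightarrow> homog (f - g) d"
  for f g :: "'k::ab_group_add poly3"
  using homog_add[of f d "- g"] homog_neg by fastforce
lemma homog_sc: "homog f d \<Longrightarrow> homog (sc c f) d"
  unfolding homog_def by (auto simp: in_keys_iff)
lemma homog_sum: "(\<And>i. i \<in> A \<Longrightarrow> homog (f i) d) \<Longrightarrow> homog (\<Sum>i\<in>A. f i) d"
  by (induction A rule: infinite_finite_induct) (auto simp: homog_add)
lemma homog_mult:
  assumes "homog f d" "homog g e" shows "homog (f * g) (d + e)"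
  unfolding homog_def
proof
  fix m assume "m \<in> keys (f * g)"
  then obtain a b where "a \<in> keys f" "b \<in> keys g" "m = a + b" using keys_mult[of f g] by blast
  then show "int (mdeg m) = d + e" using assms by (auto simp: homog_def mdeg_add)
qed
lemma homog_1: "homog 1 0" by (simp add: homog_def)
lemma homog_power: "homog f d \<Longrightarrow> homog (f ^ k) (int k * d)"
  by (induction k) (auto simp: homog_1 algebra_simps dest: homog_mult)
lemma homog_linform: "homog (linform a b c) 1"
  unfolding linform_def by (intro homog_add) (auto simp: homog_def)
lemma homog_neg_degree: "homog f d \<Longrightarrow> d < 0 \<Longrightarrow> f = 0"
  unfolding homog_def by (metis keys_eq_empty ex_in_conv of_nat_0_le_iff not_le)
lemma homog_mon: "homog (mon m) (int (mdeg m))" by (simp add: mon_def homog_def)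

lemma hom_eq_span: "(hom d :: 'k::field poly3 set) = P3.span (mon ` expos d)"
proof
  show "(hom d :: 'k poly3 set) \<subseteq> P3.span (mon ` expos d)"
  proof
    fix f :: "'k poly3" assume f: "f \<in> hom d"
    have "f = (\<Sum>m\<in>keys f. sc (lookup f m) (mon m))"
      using sum_single_lookup[of f] by (simp add: sc_mon)
    also have "\<dots> \<in> P3.span (mon ` expos d)"
      using f by (intro P3.span_sum P3.span_scale P3.span_base) (auto simp: hom_def homog_def expos_def)
    finally show "f \<in> P3.span (mon ` expos d)" .
  qed
  show "P3.span (mon ` expos d) \<subseteq> (hom d :: 'k poly3 set)"
    by (rule P3.span_minimal)
       (auto simp: hom_def expos_def P3.subspace_def homog_add homog_sc intro: homog_mon)
qed

lemma lin_indep_mon: "finite I \<Longrightarrow> lin_indep I mon"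
proof -
  assume I: "finite I"
  have "c i = 0" if "(\<Sum>i\<in>I. sc (c i) (mon i)) = 0" "i \<in> I" for i and c :: "_ \<Rightarrow> 'a"
  proof -
    have "lookup (\<Sum>i\<in>I. sc (c i) (mon i)) i = (\<Sum>j\<in>I. if j = i then c j else 0)"
      by (simp add: lookup_sum lookup_mon if_distrib cong: if_cong)
    then show ?thesis using that I by simp
  qed
  then show ?thesis unfolding lin_indep_def by blast
qed

lemma hom_span_card:
  assumes "finite S" "(hom d :: 'k::field poly3 set) \<subseteq> P3.span S"
  shows "card (expos d) \<le> card S"
proof (rule lin_indep_card_le[OF _ assms(1) lin_indep_mon])
  show "mon ` expos d \<subseteq> P3.span S"
    using assms(2) P3.span_superset[of "mon ` expos d :: 'k poly3 set"]
    unfolding hom_eq_span by (rule order_trans[rotated])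
qed simp_all

text \<open>A dependent \<open>w i\<close> could be dropped from the spanning system, leaving fewer
  vectors than the dimension. \<open>E\<close> makes up for what \<open>w\<close> alone fails to
  span.\<close>

lemma spanning_lin_indep:
  assumes "finite I" "finite E" "card I + card E \<le> card (expos d)"
    and "(hom d :: 'k::field poly3 set) \<subseteq> P3.span (w ` I \<union> E)"
  shows "lin_indep I w"
proof (rule ccontr)
  assume "\<not> lin_indep I w"
  then obtain i where i: "i \<in> I" "w i \<in> P3.span (w ` (I - {i}))"
    using not_lin_indepD assms(1) by blast
  let ?S = "w ` (I - {i}) \<union> E"
  have "w i \<in> P3.span ?S" using i(2) P3.span_mono[of "w ` (I - {i})" ?S] by blast
  then have "w ` I \<union> E \<subseteq> P3.span ?S" by (auto intro: P3.span_base)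
  then have "P3.span (w ` I \<union> E) \<subseteq> P3.span ?S" by (intro P3.span_minimal P3.subspace_span)
  then have "hom d \<subseteq> P3.span ?S" using assms(4) by (rule order_trans[rotated])
  then have "card (expos d) \<le> card ?S" by (rule hom_span_card[rotated]) (use assms in auto)
  also have "\<dots> \<le> card (I - {i}) + card E"
    using card_Un_le[of "w ` (I - {i})" E] card_image_le[of "I - {i}" w] assms(1) by simp
  also have "\<dots> < card I + card E" using i(1) assms(1) 
    by (intro add_strict_right_mono card_Diff1_less)
  finally show False using assms(3) by simp
qed

lemma lin_indep_spanning:
  fixes w :: "'i \<Rightarrow> 'k::field poly3"
  assumes "finite I" "lin_indep I w" "w ` I \<subseteq> hom d" "card I = card (expos d)"
  shows "hom d \<subseteq> P3.span (w ` I)"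
proof
  fix g :: "'k poly3" assume g: "g \<in> hom d"
  show "g \<in> P3.span (w ` I)"
  proof (rule ccontr)
    assume n: "g \<notin> P3.span (w ` I)"
    have ind: "inj_on w I" "P3.independent (w ` I)"
      using assms(2) lin_indep_iff[OF assms(1)] by blast+
    have "P3.independent (insert g (w ` I))" 
      by (rule P3.independent_insertI[OF n ind(2)])
    moreover have "insert g (w ` I) \<subseteq> P3.span (mon ` expos d)"
      using g assms(3) by (simp add: hom_eq_span)
    ultimately have "card (insert g (w ` I)) \<le> card (mon ` expos d :: 'k poly3 set)"
      by (intro conjunct2[OF P3.independent_span_bound]) simp_all
    moreover have "g \<notin> w ` I" using n P3.span_base by blast
    ultimately show False
      using assms(1,4) ind(1) card_image_le[of "expos d" "mon :: _ \<Rightarrow> 'k poly3"]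
      by (simp add: card_image)
  qed
qed

subsection \<open>Families of polynomials depending polynomially on a point\<close>

definition polyvec :: "nat \<Rightarrow> ((nat \<Rightarrow> 'k::comm_ring_1) \<Rightarrow> 'k poly3) set" where
  "polyvec n = {w. \<forall>m. (\<lambda>v. lookup (w v) m) \<in> polyfun n}"

lemma polyvec_const: "(\<lambda>v. f) \<in> polyvec n"
  by (simp add: polyvec_def polyfun_const)

lemma polyvec_diff: "f \<in> polyvec n \<Longrightarrow> g \<in> polyvec n \<Longrightarrow> (\<lambda>v. f v - g v) \<in> polyvec n"
  by (simp add: polyvec_def lookup_minus polyfun_diff)

lemma polyvec_sc: "f \<in> polyfun n \<Longrightarrow> g \<in> polyvec n \<Longrightarrow> (\<lambda>v. sc (f v) (g v)) \<in> polyvec n"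
  by (simp add: polyvec_def polyfun_mult)

definition splits :: "nat \<times> nat \<times> nat \<Rightarrow> ((nat \<times> nat \<times> nat) \<times> (nat \<times> nat \<times> nat)) set" where
  "splits m = {(a, b). a + b = m}"

lemma finite_splits [simp]: "finite (splits m)"
proof (rule finite_subset)
  show "splits m \<subseteq> (\<Union>d\<in>{..mdeg m}. expos d) \<times> (\<Union>d\<in>{..mdeg m}. expos d)"
    by (auto simp: splits_def expos_def mdeg_add)
qed auto

text \<open>The index set depends on \<open>m\<close> alone and not on the supports of the factors,
  so the coefficients of a product are visibly polynomial in those of the factors.\<close>

lemma lookup_mult_splits: "lookup (f * g) m = (\<Sum>(a, b)\<in>splits m. lookup f a * lookup g b)"
  for f :: "'k::comm_ring_1 poly3"
proof -
  have "f * g = (\<Sum>a\<in>keys f. \<Sum>b\<in>keys g. single (a + b) (lookup f a * lookup g b))"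
    by (subst sum_single_lookup[of f, symmetric], subst sum_single_lookup[of g, symmetric])
       (simp add: sum_product mult_single)
  then have "lookup (f * g) m = (\<Sum>(a, b)\<in>keys f \<times> keys g. if a + b = m then lookup f a * lookup g b else 0)"
    by (simp add: lookup_sum lookup_single when_def sum.cartesian_product case_prod_unfold)
  also have "\<dots> = (\<Sum>(a, b)\<in>(keys f \<times> keys g) \<inter> splits m. lookup f a * lookup g b)"
    by (rule sum.mono_neutral_cong_right) (auto simp: splits_def split: if_splits simp del: add_Pair)
  also have "\<dots> = (\<Sum>(a, b)\<in>splits m. lookup f a * lookup g b)"
    by (rule sum.mono_neutral_left) (auto simp: in_keys_iff)
  finally show ?thesis .
qed

lemma polyvec_mult: "f \<in> polyvec n \<Longrightarrow> g \<in> polyvec n \<Longrightarrow> (\<lambda>v. f v * g v) \<in> polyvec n"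
  unfolding polyvec_def mem_Collect_eq lookup_mult_splits case_prod_unfold
  by (intro allI polyfun_sum polyfun_mult) (simp_all del: split_paired_All)

lemma polyvec_power: "f \<in> polyvec n \<Longrightarrow> (\<lambda>v. f v ^ k) \<in> polyvec n"
  by (induction k) (simp_all add: polyvec_const polyvec_mult)

lemma polyfun_if_const: "f \<in> polyfun n \<Longrightarrow> (\<lambda>v. f v when P) \<in> polyfun n"
  by (cases P) (simp_all add: polyfun_const)

lemma polyvec_linform:
  "i < n \<Longrightarrow> j < n \<Longrightarrow> k < n \<Longrightarrow> (\<lambda>v. linform (v i) (v j) (v k)) \<in> polyvec n"
  by (simp add: polyvec_def linform_def lookup_add lookup_single polyfun_add polyfun_if_const
      polyfun_var)

text \<open>Fraction-free elimination in place of minors: a coefficient of \<open>w a\<close> that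
  is nonzero at \<open>v0\<close> is the pivot, the other vectors are cleared at its position, and
  the induction applies to them. The witness is the product of all pivots.\<close>

lemma lin_indep_open:
  fixes w :: "'i \<Rightarrow> (nat \<Rightarrow> 'k::field) \<Rightarrow> 'k poly3"
  assumes "finite I" "\<And>i. i \<in> I \<Longrightarrow> w i \<in> polyvec n" "lin_indep I (\<lambda>i. w i v0)"
  shows "\<exists>f\<in>polyfun n. f v0 \<noteq> 0 \<and> (\<forall>v. f v \<noteq> 0 \<longrightarrow> lin_indep I (\<lambda>i. w i v))"
  using assms
proof (induction I arbitrary: w rule: finite_induct)
  case empty
  then show ?case by (intro bexI[of _ "\<lambda>v. 1"]) (auto simp: lin_indep_def polyfun_const)
next
  case (insert a I)
  have "w a v0 \<noteq> 0"
  proof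
    assume 0: "w a v0 = 0"
    have "(\<Sum>i\<in>insert a I. sc (if i = a then 1 else 0) (w i v0)) = 0"
      by (rule sum.neutral) (use 0 in auto)
    from lin_indepD[OF insert.prems(2) this, of a] show False by simp
  qed
  then obtain m where m: "lookup (w a v0) m \<noteq> 0" by (metis poly_mapping_eqI lookup_zero)
  define p where "p = (\<lambda>v. lookup (w a v) m)"
  define w' where "w' i v = sc (p v) (w i v) - sc (lookup (w i v) m) (w a v)" for i v
  have p: "p \<in> polyfun n" using insert.prems(1)[of a] by (simp add: p_def polyvec_def del: split_paired_All)
  have w': "w' i \<in> polyvec n" if "i \<in> I" for i
  proof -
    have "w i \<in> polyvec n" "w a \<in> polyvec n" using insert.prems(1) that by auto
    moreover from this have "(\<lambda>v. lookup (w i v) m) \<in> polyfun n"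
      unfolding polyvec_def by blast
    ultimately show ?thesis unfolding w'_def using p by (intro polyvec_diff polyvec_sc)
  qed
  have sum_w': "(\<Sum>i\<in>I. sc (c i) (w' i v)) =
      sc (p v) (\<Sum>i\<in>I. sc (c i) (w i v)) - sc (\<Sum>i\<in>I. c i * lookup (w i v) m) (w a v)" for c v
    by (simp add: w'_def P3.scale_right_diff_distrib sum_subtractf P3.scale_sum_right sc_sum_left
        mult.commute)
  have "lin_indep I (\<lambda>i. w' i v0)"
    unfolding lin_indep_def
  proof (intro allI impI ballI)
    fix c i assume s: "(\<Sum>i\<in>I. sc (c i) (w' i v0)) = 0" and i: "i \<in> I"
    \<comment> \<open>The coefficient of \<open>w a\<close> is what turns a relation among the
      cleared vectors into one among the original vectors.\<close>
    define c' where "c' j = (if j = a then - (\<Sum>i\<in>I. c i * lookup (w i v0) m) else p v0 * c j)" for j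
    have "(\<Sum>j\<in>insert a I. sc (c' j) (w j v0)) =
       sc (c' a) (w a v0) + (\<Sum>j\<in>I. sc (p v0 * c j) (w j v0))"
      using insert.hyps by (simp add: c'_def) (rule sum.cong, auto)
    also have "\<dots> = (\<Sum>i\<in>I. sc (c i) (w' i v0))"
      by (simp add: sum_w' c'_def P3.scale_sum_right P3.scale_minus_left)
    finally have "c' i = 0" using s lin_indepD[OF insert.prems(2), of c' i] i by simp
    then show "c i = 0" using m i insert.hyps by (auto simp: c'_def p_def split: if_splits)
  qed
  then obtain f where f: "f \<in> polyfun n" "f v0 \<noteq> 0"
    "\<And>v. f v \<noteq> 0 \<Longrightarrow> lin_indep I (\<lambda>i. w' i v)"
    using insert.IH[of w'] w' by blast
  show ?case
  proof (intro bexI conjI allI impI)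
    show "(\<lambda>v. f v * p v) \<in> polyfun n" using f(1) p by (rule polyfun_mult)
    show "f v0 * p v0 \<noteq> 0" using f(2) m by (simp add: p_def)
    fix v assume v: "f v * p v \<noteq> 0"
    show "lin_indep (insert a I) (\<lambda>i. w i v)"
      unfolding lin_indep_def
    proof (intro allI impI)
      fix c assume "(\<Sum>i\<in>insert a I. sc (c i) (w i v)) = 0"
      then have s: "sc (c a) (w a v) + (\<Sum>i\<in>I. sc (c i) (w i v)) = 0"
        using insert.hyps by simp
      have "lookup (sc (c a) (w a v) + (\<Sum>i\<in>I. sc (c i) (w i v))) m = 0" by (simp only: s lookup_zero)
      then have l: "(\<Sum>i\<in>I. c i * lookup (w i v) m) = - (c a * p v)"
        by (simp add: lookup_add lookup_sum p_def eq_neg_iff_add_eq_0 add.commute)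
      have "(\<Sum>i\<in>I. sc (c i) (w i v)) = - sc (c a) (w a v)"
        using s by (simp add: eq_neg_iff_add_eq_0 add.commute)
      then have "(\<Sum>i\<in>I. sc (c i) (w' i v)) = 0"
        by (simp add: sum_w' l P3.scale_minus_left P3.scale_minus_right mult.commute)
      then have I: "\<And>i. i \<in> I \<Longrightarrow> c i = 0" using lin_indepD[OF f(3)] v by force
      then have "(\<Sum>i\<in>I. c i * lookup (w i v) m) = 0" by simp
      then have "c a = 0" using l v by simp
      then show "\<forall>i\<in>insert a I. c i = 0" using I by blast
    qed
  qed
qed

lemma general_lin_indep:
  fixes w :: "'i \<Rightarrow> (nat \<Rightarrow> 'k::field_char_0) \<Rightarrow> 'k poly3"
  assumes "finite I" "\<And>i. i \<in> I \<Longrightarrow> w i \<in> polyvec n" "lin_indep I (\<lambda>i. w i v0)"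
  shows "general n (\<lambda>v. lin_indep I (\<lambda>i. w i v))"
proof -
  obtain f where "f \<in> polyfun n" "f v0 \<noteq> 0" "\<And>v. f v \<noteq> 0 \<Longrightarrow> lin_indep I (\<lambda>i. w i v)"
    using lin_indep_open[of I w n v0] assms by auto
  then show ?thesis by (rule generalI)
qed

text \<open>Choose \<open>I1\<close> of maximal size among the index sets above \<open>I0\<close>
  that are independent at some point. Its independence is generic, and wherever it is independent it
  spans, since a vector outside the span would yield a larger such set. So one index set gives a
  basis generically.\<close>

lemma general_basis:
  fixes w :: "'i \<Rightarrow> (nat \<Rightarrow> 'k::field_char_0) \<Rightarrow> 'k poly3"
  assumes I: "finite I" and w: "\<And>i. i \<in> I \<Longrightarrow> w i \<in> polyvec n"
    and I0: "I0 \<subseteq> I" "lin_indep I0 (\<lambda>i. w i v0)"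
  shows "\<exists>I1. I0 \<subseteq> I1 \<and> I1 \<subseteq> I \<and> general n (\<lambda>v. lin_indep I1 (\<lambda>i. w i v) \<and>
    (\<forall>i\<in>I. w i v \<in> P3.span ((\<lambda>i. w i v) ` I1)))"
proof -
  define T where "T = {J. I0 \<subseteq> J \<and> J \<subseteq> I \<and> (\<exists>v. lin_indep J (\<lambda>i. w i v))}"
  have "finite T" unfolding T_def using I by (auto intro: finite_subset[of _ "Pow I"])
  moreover have "I0 \<in> T" using I0 by (auto simp: T_def)
  ultimately have "Max (card ` T) \<in> card ` T" "\<And>J. J \<in> T \<Longrightarrow> card J \<le> Max (card ` T)"
    by (auto intro!: Max_in)
  then obtain I1 where I1: "I1 \<in> T" "\<And>J. J \<in> T \<Longrightarrow> card J \<le> card I1"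
    by fastforce
  have fin: "finite I1" using I1(1) I by (auto simp: T_def intro: finite_subset)
  obtain v1 where "lin_indep I1 (\<lambda>i. w i v1)" using I1(1) by (auto simp: T_def)
  moreover have "\<And>i. i \<in> I1 \<Longrightarrow> w i \<in> polyvec n" using I1(1) w by (auto simp: T_def)
  ultimately have "general n (\<lambda>v. lin_indep I1 (\<lambda>i. w i v))"
    by (intro general_lin_indep[where ?v0.0 = v1] fin) auto
  then have "general n (\<lambda>v. lin_indep I1 (\<lambda>i. w i v) \<and>
    (\<forall>i\<in>I. w i v \<in> P3.span ((\<lambda>i. w i v) ` I1)))"
  proof (rule general_mono)
    fix v assume v: "lin_indep I1 (\<lambda>i. w i v)"
    have "w i v \<in> P3.span ((\<lambda>i. w i v) ` I1)" if i: "i \<in> I" for i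
    proof (rule ccontr)
      assume n: "w i v \<notin> P3.span ((\<lambda>i. w i v) ` I1)"
      then have "i \<notin> I1" by (auto intro: P3.span_base)
      with n have "lin_indep (insert i I1) (\<lambda>i. w i v)" by (intro lin_indep_insert fin v)
      then have "insert i I1 \<in> T" using I1(1) i by (auto simp: T_def)
      then show False using I1(2) \<open>i \<notin> I1\<close> fin by fastforce
    qed
    with v show "lin_indep I1 (\<lambda>i. w i v) \<and> (\<forall>i\<in>I. w i v \<in> P3.span ((\<lambda>i. w i v) ` I1))" by blast
  qed
  with I1(1) show ?thesis by (auto simp: T_def)
qed

text \<open>A basis selected at \<open>v0\<close> stays independent generically, and it has as many
  members as the dimension of the graded piece.\<close>

lemma general_spanning:
  fixes w :: "'i \<Rightarrow> (nat \<Rightarrow> 'k::field_char_0) \<Rightarrow> 'k poly3"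
  assumes I: "finite I" and w: "\<And>i. i \<in> I \<Longrightarrow> w i \<in> polyvec n"
    and h: "\<And>i v. i \<in> I \<Longrightarrow> w i v \<in> hom d"
    and v0: "hom d \<subseteq> P3.span ((\<lambda>i. w i v0) ` I)"
  shows "general n (\<lambda>v. hom d \<subseteq> P3.span ((\<lambda>i. w i v) ` I))"
proof -
  let ?w0 = "\<lambda>i. w i v0"
  obtain B where B: "B \<subseteq> ?w0 ` I" "P3.independent B" "?w0 ` I \<subseteq> P3.span B"
    by (rule P3.maximal_independent_subset)
  obtain J where J: "J \<subseteq> I" "inj_on ?w0 J" "B = ?w0 ` J" using B(1) by (auto simp: subset_image_inj)
  have fJ: "finite J" using J(1) I finite_subset by blast
  have ind: "lin_indep J ?w0" using J B(2) fJ by (simp add: lin_indep_iff)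
  have sp: "hom d \<subseteq> P3.span (?w0 ` J)"
    using v0 P3.span_minimal[OF B(3) P3.subspace_span] unfolding J(3) by (rule order_trans)
  have "card (expos d) \<le> card J"
    using hom_span_card[OF _ sp] card_image_le[OF fJ, of ?w0] fJ by simp
  moreover have "card J \<le> card (expos d)"
  proof -
    have "?w0 ` J \<subseteq> P3.span (mon ` expos d)" using h J(1) by (auto simp: hom_eq_span[symmetric])
    then have "card J \<le> card (mon ` expos d :: 'k poly3 set)"
      using lin_indep_card_le[OF fJ _ ind] by simp
    then show ?thesis using card_image_le[of "expos d" "mon :: _ \<Rightarrow> 'k poly3"] by simp
  qed
  ultimately have cJ: "card J = card (expos d)" by simp
  have "general n (\<lambda>v. lin_indep J (\<lambda>i. w i v))"
    by (rule general_lin_indep[where ?v0.0 = v0]) (use fJ w J(1) ind in auto)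
  then show ?thesis
  proof (rule general_mono)
    fix v assume "lin_indep J (\<lambda>i. w i v)"
    moreover have "(\<lambda>i. w i v) ` J \<subseteq> hom d" using h J(1) by blast
    ultimately have "hom d \<subseteq> P3.span ((\<lambda>i. w i v) ` J)" by (intro lin_indep_spanning fJ cJ)
    also have "\<dots> \<subseteq> P3.span ((\<lambda>i. w i v) ` I)" by (intro P3.span_mono image_mono J(1))
    finally show "hom d \<subseteq> P3.span ((\<lambda>i. w i v) ` I)" .
  qed
qed

subsection \<open>Homogeneous ideals\<close>

lemma ideal_gen_iff: "f \<in> ideal_gen gs \<longleftrightarrow> (\<exists>c. f = (\<Sum>i<length gs. c i * gs ! i))"
  by (auto simp: ideal_gen_def)

lemma ideal_gen_add: "f \<in> ideal_gen gs \<Longrightarrow> g \<in> ideal_gen gs \<Longrightarrow> f + g \<in> ideal_gen gs"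
proof -
  assume "f \<in> ideal_gen gs" "g \<in> ideal_gen gs"
  then obtain c c' where "f = (\<Sum>i<length gs. c i * gs ! i)" "g = (\<Sum>i<length gs. c' i * gs ! i)"
    by (auto simp: ideal_gen_iff)
  then have "f + g = (\<Sum>i<length gs. (c i + c' i) * gs ! i)" by (simp add: sum.distrib distrib_right)
  then show ?thesis unfolding ideal_gen_iff by (rule exI[where x = "\<lambda>i. c i + c' i"])
qed

lemma ideal_gen_mult: "f \<in> ideal_gen gs \<Longrightarrow> h * f \<in> ideal_gen gs"
proof -
  assume "f \<in> ideal_gen gs"
  then obtain c where "f = (\<Sum>i<length gs. c i * gs ! i)" by (auto simp: ideal_gen_iff)
  then have "h * f = (\<Sum>i<length gs. (h * c i) * gs ! i)" by (simp add: sum_distrib_left mult_ac)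
  then show ?thesis unfolding ideal_gen_iff by (rule exI[where x = "\<lambda>i. h * c i"])
qed

lemma ideal_gen_0 [simp]: "0 \<in> ideal_gen gs"
  unfolding ideal_gen_iff by (rule exI[where x = "\<lambda>i. 0"]) simp

lemma ideal_gen_neg: "f \<in> ideal_gen gs \<Longrightarrow> - f \<in> ideal_gen gs"
  using ideal_gen_mult[of f gs "- 1"] by simp

lemma ideal_gen_diff: "f \<in> ideal_gen gs \<Longrightarrow> g \<in> ideal_gen gs \<Longrightarrow> f - g \<in> ideal_gen gs"
  using ideal_gen_add[of f gs "- g"] ideal_gen_neg[of g gs] by simp

lemma ideal_gen_sum: "(\<And>i. i \<in> A \<Longrightarrow> f i \<in> ideal_gen gs) \<Longrightarrow> (\<Sum>i\<in>A. f i) \<in> ideal_gen gs"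
  by (induction A rule: infinite_finite_induct) (auto intro: ideal_gen_add)

lemma ideal_gen_nth: "i < length gs \<Longrightarrow> gs ! i \<in> ideal_gen gs"
  unfolding ideal_gen_iff
  by (rule exI[where x = "\<lambda>j. if j = i then 1 else 0"]) (simp add: if_distrib[of "\<lambda>x. x * _"] cong: if_cong)

lemma ideal_gen_snoc: "f \<in> ideal_gen (gs @ [g]) \<longleftrightarrow> (\<exists>h. f - g * h \<in> ideal_gen gs)"
proof
  assume "f \<in> ideal_gen (gs @ [g])"
  then obtain c where "f = (\<Sum>i<length gs. c i * gs ! i) + c (length gs) * g"
    by (auto simp: ideal_gen_iff nth_append cong: sum.cong_simp)
  then have "f - g * c (length gs) = (\<Sum>i<length gs. c i * gs ! i)" by (simp add: mult.commute)
  then have "f - g * c (length gs) \<in> ideal_gen gs" unfolding ideal_gen_iff by blast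
  then show "\<exists>h. f - g * h \<in> ideal_gen gs" by blast
next
  assume "\<exists>h. f - g * h \<in> ideal_gen gs"
  then obtain h c where "f - g * h = (\<Sum>i<length gs. c i * gs ! i)" by (auto simp: ideal_gen_iff)
  then have "f = (\<Sum>i<length gs. c i * gs ! i) + h * g" by (simp add: algebra_simps)
  also have "\<dots> = (\<Sum>i<length (gs @ [g]). (if i < length gs then c i else h) * (gs @ [g]) ! i)"
    by (simp add: nth_append cong: sum.cong_simp)
  finally show "f \<in> ideal_gen (gs @ [g])"
    unfolding ideal_gen_iff by (rule exI[where x = "\<lambda>i. if i < length gs then c i else h"])
qed

lemma ideal_gen_snocI: "f \<in> ideal_gen gs \<Longrightarrow> f \<in> ideal_gen (gs @ [g])"
  unfolding ideal_gen_snoc by (rule exI[where x = 0]) simp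

lemma ideal_gen_snoc_mult: "g * h \<in> ideal_gen (gs @ [g])"
  unfolding ideal_gen_snoc by (rule exI[where x = h]) simp

section \<open>Homogeneous components and homogeneous cofactors\<close>

definition hpart :: "int \<Rightarrow> 'k::comm_ring_1 poly3 \<Rightarrow> 'k poly3" where
  "hpart d f = (\<Sum>m\<in>{m\<in>keys f. int (mdeg m) = d}. single m (lookup f m))"

lemma lookup_hpart: "lookup (hpart d f) m = (if int (mdeg m) = d then lookup f m else 0)"
proof -
  have "lookup (hpart d f) m =
      (\<Sum>m'\<in>{m\<in>keys f. int (mdeg m) = d}. if m' = m then lookup f m' else 0)"
    by (simp add: hpart_def lookup_sum lookup_single when_def)
  then show ?thesis by (simp add: in_keys_iff)
qed

lemma homog_hpart: "homog (hpart d f) d"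
  by (auto simp: homog_def in_keys_iff lookup_hpart split: if_splits)

lemma hpart_homog: "homog f d \<Longrightarrow> hpart d f = f"
proof (rule poly_mapping_eqI)
  fix m assume "homog f d"
  then show "lookup (hpart d f) m = lookup f m"
    unfolding lookup_hpart homog_def by (cases "m \<in> keys f") (auto simp: in_keys_iff)
qed

lemma hpart_sum: "hpart d (\<Sum>i\<in>A. f i) = (\<Sum>i\<in>A. hpart d (f i))"
  by (rule poly_mapping_eqI) (simp add: lookup_hpart lookup_sum)

lemma hpart_diff: "hpart d (f - g) = hpart d f - hpart d g"
  by (rule poly_mapping_eqI) (simp add: lookup_hpart lookup_minus)

lemma hpart_mult:
  assumes "homog g e" shows "hpart d (c * g) = hpart (d - e) c * g"
proof (rule poly_mapping_eqI)
  fix m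
  have "lookup (hpart (d - e) c * g) m =
      (\<Sum>x\<in>splits m. if int (mdeg m) = d then lookup c (fst x) * lookup g (snd x) else 0)"
    unfolding lookup_mult_splits lookup_hpart case_prod_unfold
  proof (rule sum.cong[OF refl])
    fix x assume "x \<in> splits m"
    then have m: "m = fst x + snd x" by (auto simp: splits_def)
    show "(if int (mdeg (fst x)) = d - e then lookup c (fst x) else 0) * lookup g (snd x) =
      (if int (mdeg m) = d then lookup c (fst x) * lookup g (snd x) else 0)"
    proof (cases "snd x \<in> keys g")
      case True
      then have "int (mdeg (snd x)) = e" using assms unfolding homog_def by blast
      then show ?thesis by (auto simp: m mdeg_add)
    qed (simp add: in_keys_iff)
  qed
  then show "lookup (hpart d (c * g)) m = lookup (hpart (d - e) c * g) m"
    by (simp add: lookup_hpart lookup_mult_splits case_prod_unfold)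
qed

definition homog_list :: "'k::comm_ring_1 poly3 list \<Rightarrow> bool" where
  "homog_list gs \<longleftrightarrow> (\<forall>g\<in>set gs. \<exists>e. homog g e)"

lemma ideal_gen_homog:
  assumes "f \<in> ideal_gen gs" "homog f d" "\<And>i. i < length gs \<Longrightarrow> homog (gs ! i) (ds i)"
  shows "\<exists>c. f = (\<Sum>i<length gs. c i * gs ! i) \<and> (\<forall>i<length gs. homog (c i) (d - ds i))"
proof -
  obtain c where c: "f = (\<Sum>i<length gs. c i * gs ! i)" using assms(1) by (auto simp: ideal_gen_iff)
  have "f = hpart d f" using assms(2) by (simp add: hpart_homog)
  also have "\<dots> = (\<Sum>i<length gs. hpart (d - ds i) (c i) * gs ! i)"
    unfolding c hpart_sum using assms(3) by (intro sum.cong) (simp_all add: hpart_mult)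
  finally show ?thesis
    by (intro exI[where x = "\<lambda>i. hpart (d - ds i) (c i)"]) (simp add: homog_hpart)
qed

lemma ideal_gen_hpart:
  assumes "homog_list gs" "f \<in> ideal_gen gs" shows "hpart d f \<in> ideal_gen gs"
proof -
  obtain c where c: "f = (\<Sum>i<length gs. c i * gs ! i)" using assms(2) by (auto simp: ideal_gen_iff)
  have "hpart d (c i * gs ! i) \<in> ideal_gen gs" if i: "i < length gs" for i
  proof -
    obtain e where "homog (gs ! i) e"
      using assms(1) nth_mem[OF i] unfolding homog_list_def by blast
    then have "hpart d (c i * gs ! i) = hpart (d - e) (c i) * gs ! i" by (rule hpart_mult)
    then show ?thesis using i by (simp add: ideal_gen_mult ideal_gen_nth)
  qed
  then show ?thesis unfolding c hpart_sum by (intro ideal_gen_sum) auto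
qed

text \<open>Taking degree \<open>d\<close> components makes the cofactor of \<open>g\<close>
  homogeneous, as needed for maps between graded pieces.\<close>

lemma ideal_gen_snoc_homog:
  assumes "homog_list gs" "homog g e" "f \<in> ideal_gen (gs @ [g])" "homog f d"
  shows "\<exists>h. homog h (d - e) \<and> f - g * h \<in> ideal_gen gs"
proof -
  obtain h where h: "f - g * h \<in> ideal_gen gs" using assms(3) by (auto simp: ideal_gen_snoc)
  have "hpart d (f - g * h) = f - g * hpart (d - e) h"
    using hpart_mult[OF assms(2), of d h] hpart_homog[OF assms(4)]
    by (simp add: hpart_diff mult.commute)
  then have "f - g * hpart (d - e) h \<in> ideal_gen gs"
    using ideal_gen_hpart[OF assms(1) h, of d] by simp
  then show ?thesis using homog_hpart by blast
qed

subsection \<open>Multiplication maps\<close>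

lemma mult_injD:
  "mult_inj gs F e j \<Longrightarrow> homog f (j - int e) \<Longrightarrow> F * f \<in> ideal_gen gs \<Longrightarrow> f \<in> ideal_gen gs"
  by (simp add: mult_inj_def)

lemma mult_surjD:
  "mult_surj gs F e j \<Longrightarrow> homog g j \<Longrightarrow> \<exists>f. homog f (j - int e) \<and> g - F * f \<in> ideal_gen gs"
  by (simp add: mult_surj_def)

lemma mult_inj_mult:
  assumes "mult_inj gs F e1 (j - int e2)" "mult_inj gs G e2 j" "homog F (int e1)"
  shows "mult_inj gs (F * G) (e1 + e2) j"
  unfolding mult_inj_def
proof (intro allI impI, elim conjE)
  fix f assume f: "homog f (j - int (e1 + e2))" "F * G * f \<in> ideal_gen gs"
  have "homog (F * f) (int e1 + (j - int (e1 + e2)))" using assms(3) f(1) by (rule homog_mult)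
  then have "homog (F * f) (j - int e2)" by (simp add: algebra_simps)
  moreover have "G * (F * f) \<in> ideal_gen gs" using f(2) by (simp add: mult_ac)
  ultimately have "F * f \<in> ideal_gen gs" by (rule mult_injD[OF assms(2)])
  moreover have "homog f (j - int e2 - int e1)" using f(1) by (simp add: algebra_simps)
  ultimately show "f \<in> ideal_gen gs" by (rule mult_injD[OF assms(1), rotated])
qed

lemma mult_surj_mult:
  fixes gs :: "'k::comm_ring_1 poly3 list"
  assumes "mult_surj gs F e1 (j - int e2)" "mult_surj gs G e2 j"
  shows "mult_surj gs (F * G) (e1 + e2) j"
  unfolding mult_surj_def
proof (intro allI impI)
  fix g :: "'k poly3" assume "homog g j"
  then obtain f1 where f1: "homog f1 (j - int e2)" "g - G * f1 \<in> ideal_gen gs"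
    using mult_surjD[OF assms(2)] by blast
  obtain f2 where f2: "homog f2 (j - int e2 - int e1)" "f1 - F * f2 \<in> ideal_gen gs"
    using mult_surjD[OF assms(1) f1(1)] by blast
  have "(g - G * f1) + G * (f1 - F * f2) \<in> ideal_gen gs"
    using f1(2) f2(2) by (intro ideal_gen_add ideal_gen_mult)
  then have "g - F * G * f2 \<in> ideal_gen gs" by (simp add: algebra_simps)
  moreover have "homog f2 (j - int (e1 + e2))" using f2(1) by (simp add: algebra_simps)
  ultimately show "\<exists>f. homog f (j - int (e1 + e2)) \<and> g - F * G * f \<in> ideal_gen gs" by blast
qed

lemma mult_inj_neg: "j < int e \<Longrightarrow> mult_inj gs F e j"
  unfolding mult_inj_def using homog_neg_degree by fastforce

lemma mult_surj_neg: "j < 0 \<Longrightarrow> mult_surj gs F e j"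
  unfolding mult_surj_def using homog_neg_degree[of _ j]
  by (metis diff_self homog_0 ideal_gen_0 mult_zero_right)

lemma homog_Suc_decomp:
  fixes g :: "'k::comm_ring_1 poly3"
  assumes "homog g (j + 1)" "j \<ge> 0"
  shows "\<exists>x y z. homog x j \<and> homog y j \<and> homog z j \<and>
    g = mon (1, 0, 0) * x + mon (0, 1, 0) * y + mon (0, 0, 1) * z"
proof -
  define Q where "Q h \<longleftrightarrow> (\<exists>x y z. homog x j \<and> homog y j \<and> homog z j \<and>
    h = mon (1, 0, 0) * x + mon (0, 1, 0) * y + mon (0, 0, 1) * z)" for h :: "'k poly3"
  have add: "Q (h + h')" if "Q h" "Q h'" for h h'
  proof -
    from that obtain x y z x' y' z' where
      "homog x j" "homog y j" "homog z j" "h = mon (1, 0, 0) * x + mon (0, 1, 0) * y + mon (0, 0, 1) * z"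
      "homog x' j" "homog y' j" "homog z' j"
      "h' = mon (1, 0, 0) * x' + mon (0, 1, 0) * y' + mon (0, 0, 1) * z'"
      unfolding Q_def by auto
    then show ?thesis unfolding Q_def
      by (intro exI[of _ "x + x'"] exI[of _ "y + y'"] exI[of _ "z + z'"])
         (simp add: homog_add algebra_simps)
  qed
  have Q0: "Q 0" unfolding Q_def by (intro exI[of _ 0]) simp
  have single: "Q (single m c)" if m: "int (mdeg m) = j + 1" for m c
  proof -
    obtain a b k where abk: "m = (a, b, k)" by (cases m)
    have ax: "single m c = mon m' * single m'' c" if "m = m' + m''" for m' m''
      by (simp add: mon_def mult_single that)
    have hs: "homog (single m'' c) j" if "int (mdeg m'') = j" for m''
      using that by (simp add: homog_def)
    consider "a > 0" | "b > 0" | "k > 0" using m abk assms(2) by fastforce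
    then show ?thesis
    proof cases
      case 1
      then have "single m c = mon (1, 0, 0) * single (a - 1, b, k) c" using abk by (intro ax) simp
      moreover have "homog (single (a - 1, b, k) c) j" using 1 m abk by (intro hs) simp
      ultimately show ?thesis unfolding Q_def
        by (intro exI[of _ "single (a - 1, b, k) c"] exI[of _ 0]) simp
    next
      case 2
      then have "single m c = mon (0, 1, 0) * single (a, b - 1, k) c" using abk by (intro ax) simp
      moreover have "homog (single (a, b - 1, k) c) j" using 2 m abk by (intro hs) simp
      ultimately show ?thesis unfolding Q_def
        by (intro exI[of _ 0] exI[of _ "single (a, b - 1, k) c"]) simp
    next
      case 3
      then have "single m c = mon (0, 0, 1) * single (a, b, k - 1) c" using abk by (intro ax) simp
      moreover have "homog (single (a, b, k - 1) c) j" using 3 m abk by (intro hs) simp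
      ultimately show ?thesis unfolding Q_def
        by (intro exI[of _ 0] exI[of _ "single (a, b, k - 1) c"]) simp
    qed
  qed
  have "Q (\<Sum>m\<in>A. single m (lookup g m))" if "A \<subseteq> keys g" for A
    using finite_subset[OF that finite_keys] that assms(1)
    by (induction A rule: finite_induct) (auto simp: Q0 homog_def intro!: add single)
  from this[of "keys g"] have "Q g" by (simp add: sum_single_lookup)
  then show ?thesis by (simp add: Q_def)
qed

text \<open>The cokernel is generated in degree 0, so it stays zero once it is zero in some degree
  \<open>j \<ge> 0\<close>: forms of degree \<open>j + 1\<close> are combinations of
  \<open>x\<close>, \<open>y\<close>, \<open>z\<close> with coefficients of degree
  \<open>j\<close>.\<close>

lemma mult_surj_Suc:
  fixes gs :: "'k::comm_ring_1 poly3 list"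
  assumes "mult_surj gs F e j" "j \<ge> 0"
  shows "mult_surj gs F e (j + 1)"
  unfolding mult_surj_def
proof (intro allI impI)
  fix g :: "'k poly3" assume "homog g (j + 1)"
  then obtain x y z where xyz: "homog x j" "homog y j" "homog z j"
    and g: "g = mon (1, 0, 0) * x + mon (0, 1, 0) * y + mon (0, 0, 1) * z"
    using homog_Suc_decomp assms(2) by blast
  obtain x' where x': "homog x' (j - int e)" "x - F * x' \<in> ideal_gen gs"
    using mult_surjD[OF assms(1) xyz(1)] by blast
  obtain y' where y': "homog y' (j - int e)" "y - F * y' \<in> ideal_gen gs"
    using mult_surjD[OF assms(1) xyz(2)] by blast
  obtain z' where z': "homog z' (j - int e)" "z - F * z' \<in> ideal_gen gs"
    using mult_surjD[OF assms(1) xyz(3)] by blast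
  let ?f = "mon (1, 0, 0) * x' + mon (0, 1, 0) * y' + mon (0, 0, 1) * z'"
  have hm: "homog (mon m * h) (1 + (j - int e))" if "mdeg m = 1" "homog h (j - int e)"
    for m and h :: "'k poly3"
    using homog_mult[OF homog_mon[of m] that(2)] that(1) by simp
  have "homog ?f (1 + (j - int e))" using x'(1) y'(1) z'(1) by (intro homog_add hm) simp_all
  then have "homog ?f (j + 1 - int e)" by (simp add: algebra_simps)
  moreover have "g - F * ?f = mon (1, 0, 0) * (x - F * x') + mon (0, 1, 0) * (y - F * y') +
      mon (0, 0, 1) * (z - F * z')"
    by (simp add: g algebra_simps)
  then have "g - F * ?f \<in> ideal_gen gs"
    using x'(2) y'(2) z'(2) by (simp add: ideal_gen_add ideal_gen_mult)
  ultimately show "\<exists>f. homog f (j + 1 - int e) \<and> g - F * f \<in> ideal_gen gs" by blast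
qed

lemma mult_surj_mono:
  assumes "mult_surj gs F e (int j)" "j \<le> k"
  shows "mult_surj gs F e (int k)"
  using assms(2)
proof (induction k rule: dec_induct)
  case (step k)
  then show ?case using mult_surj_Suc[of gs F e "int k"] by (simp add: add.commute)
qed (rule assms(1))

text \<open>The single factors of \<open>M ^ e\<close> map into degrees at most \<open>d\<close>,
  where each of them is injective.\<close>

lemma mult_inj_power:
  assumes "homog M 1" "\<And>d. d \<le> p \<Longrightarrow> mult_inj gs M 1 (int d)" "d \<le> p"
  shows "mult_inj gs (M ^ e) e (int d)"
  using assms(3)
proof (induction e arbitrary: d)
  case 0
  then show ?case by (simp add: mult_inj_def)
next
  case (Suc e)
  show ?case
  proof (cases d)
    case 0
    then show ?thesis by (intro mult_inj_neg) simp
  next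
    case (Suc d')
    have "mult_inj gs (M ^ e) e (int d')" using Suc Suc.prems by (intro Suc.IH) simp
    then have "mult_inj gs (M ^ e * M) (e + 1) (int d)"
      using assms(2)[OF Suc.prems] homog_power[OF assms(1), of e] Suc
      by (intro mult_inj_mult) simp_all
    then show ?thesis by (simp add: mult.commute)
  qed
qed

text \<open>The single factors map into the degrees \<open>d - e + 1, ..., d\<close>, all beyond
  \<open>p\<close>, where each of them is surjective.\<close>

lemma mult_surj_power:
  assumes "mult_surj gs M 1 (int (Suc p))" "e > 0" "p + e \<le> d"
  shows "mult_surj gs (M ^ e) e (int d)"
  using assms(2,3)
proof (induction e arbitrary: d)
  case (Suc e)
  have last: "mult_surj gs M 1 (int d)"
    using Suc.prems by (intro mult_surj_mono[OF assms(1)]) simp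
  show ?case
  proof (cases "e = 0")
    case False
    obtain d' where d: "d = Suc d'" using Suc.prems by (cases d) auto
    have "mult_surj gs (M ^ e) e (int d')" using False Suc.prems d by (intro Suc.IH) auto
    then have "mult_surj gs (M ^ e * M) (e + 1) (int d)"
      using last d by (intro mult_surj_mult) simp_all
    then show ?thesis by (simp add: mult.commute)
  qed (use last in simp)
qed simp

text \<open>Both surjectivities say that the quotient by \<open>gs\<close>, \<open>F\<close> and
  \<open>G\<close> is zero in degree \<open>j\<close>, which is symmetric in \<open>F\<close> and
  \<open>G\<close>.\<close>

lemma mult_surj_swap:
  fixes gs :: "'k::comm_ring_1 poly3 list"
  assumes "homog_list gs" "homog F (int e)" "homog G (int d)" "mult_surj (gs @ [F]) G d j"
  shows "mult_surj (gs @ [G]) F e j"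
  unfolding mult_surj_def
proof (intro allI impI)
  fix g :: "'k poly3" assume g: "homog g j"
  obtain f where f: "homog f (j - int d)" "g - G * f \<in> ideal_gen (gs @ [F])"
    using mult_surjD[OF assms(4) g] by blast
  have "homog (G * f) j" using homog_mult[OF assms(3) f(1)] by simp
  then obtain h where h: "homog h (j - int e)" "g - G * f - F * h \<in> ideal_gen gs"
    using ideal_gen_snoc_homog[OF assms(1,2) f(2)] g homog_diff by blast
  have "(g - G * f - F * h) + G * f \<in> ideal_gen (gs @ [G])"
    using h(2) by (intro ideal_gen_add ideal_gen_snocI ideal_gen_snoc_mult)
  then have "g - F * h \<in> ideal_gen (gs @ [G])" by simp
  with h(1) show "\<exists>f. homog f (j - int e) \<and> g - F * f \<in> ideal_gen (gs @ [G])" by blast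
qed

text \<open>A relation \<open>G f = F h\<close> modulo the ideal is read both ways: injectivity of
  \<open>F\<close> modulo \<open>G\<close> gives \<open>h = G h'\<close> modulo the ideal, and
  cancelling \<open>G\<close> shows that \<open>f - F h'\<close> lies in the ideal.\<close>

lemma mult_inj_swap:
  fixes gs :: "'k::comm_ring_1 poly3 list"
  assumes "homog_list gs" "homog F (int e)" "homog G (int d)"
    and "mult_inj (gs @ [G]) F e j" "mult_inj gs G d j"
  shows "mult_inj (gs @ [F]) G d j"
  unfolding mult_inj_def
proof (intro allI impI, elim conjE)
  fix f :: "'k poly3" assume f: "homog f (j - int d)" "G * f \<in> ideal_gen (gs @ [F])"
  have Gf: "homog (G * f) j" using homog_mult[OF assms(3) f(1)] by simp
  obtain h where h: "homog h (j - int e)" "G * f - F * h \<in> ideal_gen gs"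
    using ideal_gen_snoc_homog[OF assms(1,2) f(2) Gf] by blast
  have "G * f - (G * f - F * h) \<in> ideal_gen (gs @ [G])"
    by (rule ideal_gen_diff[OF ideal_gen_snoc_mult ideal_gen_snocI[OF h(2)]])
  then have "F * h \<in> ideal_gen (gs @ [G])" by simp
  then have h_in: "h \<in> ideal_gen (gs @ [G])" by (rule mult_injD[OF assms(4) h(1)])
  obtain h' where h': "homog h' (j - int e - int d)" "h - G * h' \<in> ideal_gen gs"
    using ideal_gen_snoc_homog[OF assms(1,3) h_in h(1)] by blast
  have "(G * f - F * h) + F * (h - G * h') \<in> ideal_gen gs"
    using h(2) h'(2) by (intro ideal_gen_add ideal_gen_mult)
  then have "G * (f - F * h') \<in> ideal_gen gs" by (simp add: algebra_simps)
  moreover have "homog (F * h') (j - int d)"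
    using homog_mult[OF assms(2) h'(1)] by (simp add: algebra_simps)
  then have "homog (f - F * h') (j - int d)" using f(1) by (intro homog_diff)
  ultimately have "f - F * h' \<in> ideal_gen gs" by (rule mult_injD[OF assms(5), rotated])
  then show "f \<in> ideal_gen (gs @ [F])" unfolding ideal_gen_snoc by blast
qed

lemma max_rank_swap:
  assumes "homog_list gs" "homog F (int e)" "homog G (int d)"
    and "mult_inj gs F e j" "mult_inj gs G d j"
  shows "max_rank (gs @ [F]) G d j \<longleftrightarrow> max_rank (gs @ [G]) F e j"
  unfolding max_rank_def
  using mult_inj_swap[OF assms(1,2,3) _ assms(5)] mult_inj_swap[OF assms(1,3,2) _ assms(4)]
    mult_surj_swap[OF assms(1,2,3)] mult_surj_swap[OF assms(1,3,2)] by blast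

lemma mult_surj_snoc: "mult_surj gs F e j \<Longrightarrow> mult_surj (gs @ [G]) F e j"
  unfolding mult_surj_def using ideal_gen_snocI by blast

text \<open>The quotient by \<open>F\<close> is zero in degree \<open>j\<close>, so every map into
  it is onto.\<close>

lemma mult_surj_quotient: "homog_list gs \<Longrightarrow> homog F (int e) \<Longrightarrow> homog G (int d) \<Longrightarrow>
    mult_surj gs F e j \<Longrightarrow> mult_surj (gs @ [F]) G d j"
  by (rule mult_surj_swap[OF _ _ _ mult_surj_snoc])

text \<open>Outside the \<open>e - 1\<close> degrees between \<open>p\<close> and
  \<open>p + e\<close>, all \<open>e\<close> single steps lie on the same side of the threshold
  \<open>p\<close>.\<close>

lemma max_rank_power_each_degree:
  assumes hom: "homog M 1" and e: "e > 0"
    and inj: "\<And>d. d \<le> p \<Longrightarrow> mult_inj gs M 1 (int d)"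
    and surj: "mult_surj gs M 1 (int (Suc p))"
    and mid: "\<And>d. p < d \<Longrightarrow> d < p + e \<Longrightarrow> max_rank gs (M ^ e) e (int d)"
  shows "max_rank_each_degree gs (M ^ e) e"
  unfolding max_rank_each_degree_def
proof
  fix j :: int
  show "max_rank gs (M ^ e) e j"
  proof (cases "j < 0")
    case True
    then show ?thesis unfolding max_rank_def by (intro disjI2 mult_surj_neg)
  next
    case False
    then obtain d where d: "j = int d" by (metis nonneg_int_cases not_less)
    consider "d \<le> p" | "p < d" "d < p + e" | "p + e \<le> d" by linarith
    then show ?thesis
    proof cases
      case 1
      then show ?thesis unfolding max_rank_def d using mult_inj_power[OF hom inj] by blast
    next
      case 2
      then show ?thesis unfolding d by (rule mid)
    next
      case 3
      then show ?thesis unfolding max_rank_def d using mult_surj_power[OF surj e] by blast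
    qed
  qed
qed

lemma ideal_gen_snoc_power_mono:
  assumes "d \<le> d'" "f \<in> ideal_gen (gs @ [M ^ d'])" shows "f \<in> ideal_gen (gs @ [M ^ d])"
proof -
  obtain h where "f - M ^ d' * h \<in> ideal_gen gs" using assms(2) by (auto simp: ideal_gen_snoc)
  moreover have "M ^ d' * h = M ^ d * (M ^ (d' - d) * h)"
    using assms(1) by (simp add: mult.assoc[symmetric] power_add[symmetric])
  ultimately show ?thesis unfolding ideal_gen_snoc by metis
qed

text \<open>The algebraic core, with genericity replaced by explicit hypotheses. \<open>N\<close>
  stands for the form that is cubed and \<open>M\<close> for \<open>L\<close>; the numbers
  \<open>p\<close>, \<open>pb b\<close> and \<open>q\<close> are the thresholds of \<open>A\<close>,
  \<open>A/M^bA\<close> and \<open>A/N^3A\<close>.\<close>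

lemma lefschetz_cube_equivalence:
  fixes gs :: "'k::comm_ring_1 poly3 list" and M N :: "'k poly3" and p q :: nat and pb :: "nat \<Rightarrow> nat"
  assumes gs: "homog_list gs" and M: "homog M 1" and N: "homog N 1"
    and N_inj: "\<And>d. d \<le> p \<Longrightarrow> mult_inj gs N 1 (int d)"
    and N_surj: "mult_surj gs N 1 (int (Suc p))"
    and M_inj: "\<And>d. d \<le> p \<Longrightarrow> mult_inj gs M 1 (int d)"
    and Nb_inj: "\<And>b d. 3 \<le> b \<Longrightarrow> b \<le> p \<Longrightarrow> d \<le> pb b \<Longrightarrow> mult_inj (gs @ [M ^ b]) N 1 (int d)"
    and Nb_surj: "\<And>b. 3 \<le> b \<Longrightarrow> b \<le> p \<Longrightarrow> mult_surj (gs @ [M ^ b]) N 1 (int (Suc (pb b)))"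
    and Mq_inj: "\<And>d. d \<le> q \<Longrightarrow> mult_inj (gs @ [N ^ 3]) M 1 (int d)"
    and Mq_surj: "mult_surj (gs @ [N ^ 3]) M 1 (int (Suc q))"
    and Mq_sq: "max_rank (gs @ [N ^ 3]) (M ^ 2) 2 (int (Suc q))"
    and cubes: "(mult_inj gs (N ^ 3) 3 (int (Suc p)) \<and> mult_inj gs (M ^ 3) 3 (int (Suc p))) \<or>
      mult_surj gs (N ^ 3) 3 (int (Suc p))"
    and Nb_cube: "\<And>b. 3 \<le> b \<Longrightarrow> b \<le> Suc p \<Longrightarrow>
      max_rank (gs @ [M ^ b]) (N ^ 3) 3 (int (Suc (pb b)))"
    and pb: "pb (Suc p) = p"
    and top: "mult_surj (gs @ [M ^ (p + 2)]) (N ^ 3) 3 (int (p + 2))"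
  shows "(\<forall>d\<ge>1. max_rank_each_degree (gs @ [N ^ 3]) (M ^ d) d) \<longleftrightarrow>
      (\<forall>b. 3 \<le> b \<and> b \<le> p \<longrightarrow> max_rank_each_degree (gs @ [M ^ b]) (N ^ 3) 3)"
    and "(\<forall>b. 3 \<le> b \<and> b \<le> p \<longrightarrow> max_rank_each_degree (gs @ [M ^ b]) (N ^ 3) 3) \<longleftrightarrow>
      (\<forall>b. 3 \<le> b \<and> b \<le> p \<longrightarrow> max_rank (gs @ [M ^ b]) (N ^ 3) 3 (int (pb b) + 2))"
proof -
  have hN: "homog (N ^ 3) (int 3)" using homog_power[OF N, of 3] by simp
  have hM: "homog (M ^ d) (int d)" for d using homog_power[OF M, of d] by simp
  note swap_surj = mult_surj_swap[OF gs hM hN]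
  \<comment> \<open>For \<open>d > p\<close> there is no counterpart in (b), so maximal rank has to
    be proved outright. Into degrees below \<open>d\<close> the source is zero; this leaves
    \<open>d = p + 1\<close> in degree \<open>p + 1\<close> and the degrees from
    \<open>p + 2\<close> on.\<close>
  have step: "(d \<le> p \<longrightarrow> (max_rank (gs @ [N ^ 3]) (M ^ d) d (int i) \<longleftrightarrow>
        max_rank (gs @ [M ^ d]) (N ^ 3) 3 (int i))) \<and>
      (p < d \<longrightarrow> max_rank (gs @ [N ^ 3]) (M ^ d) d (int i))" if d: "3 \<le> d" for d i
  proof -
    have trivial: "max_rank (gs @ [N ^ 3]) (M ^ d) d (int i)" if "i < d"
      unfolding max_rank_def using that by (intro disjI1 mult_inj_neg) simp
    have both: "max_rank (gs @ [N ^ 3]) (M ^ d) d (int i)" "max_rank (gs @ [M ^ d]) (N ^ 3) 3 (int i)"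
      if "mult_surj gs (N ^ 3) 3 (int i)"
      unfolding max_rank_def
      using mult_surj_snoc[OF that] mult_surj_quotient[OF gs hN hM that] by auto
    consider "i \<le> p" | "i = Suc p" | "i = p + 2" | "p + 3 \<le> i" by linarith
    then show ?thesis
    proof cases
      case 1
      have "mult_inj gs (N ^ 3) 3 (int i)" "mult_inj gs (M ^ d) d (int i)"
        using mult_inj_power[OF N N_inj 1] mult_inj_power[OF M M_inj 1] by blast+
      then show ?thesis using max_rank_swap[OF gs hN hM] trivial 1 by auto
    next
      case 2
      from cubes show ?thesis
      proof
        assume "mult_surj gs (N ^ 3) 3 (int (Suc p))"
        then show ?thesis using both 2 by simp
      next
        assume A: "mult_inj gs (N ^ 3) 3 (int (Suc p)) \<and> mult_inj gs (M ^ 3) 3 (int (Suc p))"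
        \<comment> \<open>Degree \<open>p + 1\<close> is beyond the injective range of
          \<open>M\<close>, so \<open>M ^ d\<close> is split: the last three factors are the given
          cube, and the others end in degree \<open>p - 2\<close>.\<close>
        have "mult_inj gs (M ^ (d - 3)) (d - 3) (int (Suc p) - int 3)"
        proof (cases "3 \<le> Suc p")
          case True
          then have "int (Suc p) - int 3 = int (p - 2)" by simp
          moreover have "mult_inj gs (M ^ (d - 3)) (d - 3) (int (p - 2))"
            by (rule mult_inj_power[where p = p, OF M M_inj]) simp_all
          ultimately show ?thesis by (simp only:)
        qed (intro mult_inj_neg, simp)
        then have "mult_inj gs (M ^ (d - 3) * M ^ 3) (d - 3 + 3) (int (Suc p))"
          by (rule mult_inj_mult[OF _ conjunct2[OF A] hM])
        then have "mult_inj gs (M ^ d) d (int (Suc p))" using d by (simp add: power_add[symmetric])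
        then have eq: "max_rank (gs @ [N ^ 3]) (M ^ d) d (int i) \<longleftrightarrow>
            max_rank (gs @ [M ^ d]) (N ^ 3) 3 (int i)"
          using A 2 max_rank_swap[OF gs hN hM] by blast
        have "max_rank (gs @ [N ^ 3]) (M ^ d) d (int i)" if "p < d"
        \<comment> \<open>The exponent \<open>p + 1\<close> lies just outside the range of (b).
          Because \<open>pb (Suc p) = p\<close>, the cube hypothesis \<open>Nb_cube\<close> for it
          concerns exactly degree \<open>p + 1\<close>.\<close>
        proof (cases "d = Suc p")
          case True
          then show ?thesis using eq Nb_cube[of d] d pb 2 by simp
        next
          case False
          then show ?thesis using that 2 trivial by simp
        qed
        with eq show ?thesis by blast
      qed
    next
      case 3
      \<comment> \<open>\<open>A/M^dA\<close> is a quotient of \<open>A/M^(p+2)A\<close>, so it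
        inherits surjectivity.\<close>
      have "mult_surj (gs @ [M ^ d]) (N ^ 3) 3 (int i)" if "d \<le> p + 2"
        using top that unfolding 3 mult_surj_def
        by (meson ideal_gen_snoc_power_mono)
      then have "max_rank (gs @ [N ^ 3]) (M ^ d) d (int i)"
        "max_rank (gs @ [M ^ d]) (N ^ 3) 3 (int i)" if "d \<le> p + 2"
        using swap_surj[of d "int i"] that unfolding max_rank_def by blast+
      then show ?thesis using trivial 3 by (cases "d \<le> p + 2") auto
    next
      case 4
      then show ?thesis using both mult_surj_power[OF N_surj, of 3 i] by simp
    qed
  qed
  have neg: "max_rank hs F e j" if "j < 0" for hs :: "'k poly3 list" and F e j
    unfolding max_rank_def using mult_surj_neg[OF that] by blast
  have each: "max_rank_each_degree hs F e \<longleftrightarrow> (\<forall>i. max_rank hs F e (int i))"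
    for hs :: "'k poly3 list" and F e
    unfolding max_rank_each_degree_def by (metis neg nonneg_int_cases not_less)
  have d1: "max_rank_each_degree (gs @ [N ^ 3]) (M ^ 1) 1"
    by (rule max_rank_power_each_degree[OF M _ Mq_inj Mq_surj]) auto
  have d2: "max_rank_each_degree (gs @ [N ^ 3]) (M ^ 2) 2"
  proof (rule max_rank_power_each_degree[OF M _ Mq_inj Mq_surj])
    fix d assume "q < d" "d < q + 2"
    then have "d = Suc q" by simp
    then show "max_rank (gs @ [N ^ 3]) (M ^ 2) 2 (int d)" using Mq_sq by simp
  qed auto
  show "(\<forall>d\<ge>1. max_rank_each_degree (gs @ [N ^ 3]) (M ^ d) d) \<longleftrightarrow>
      (\<forall>b. 3 \<le> b \<and> b \<le> p \<longrightarrow> max_rank_each_degree (gs @ [M ^ b]) (N ^ 3) 3)"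
  proof (intro iffI allI impI, elim conjE)
    fix b assume "\<forall>d\<ge>1. max_rank_each_degree (gs @ [N ^ 3]) (M ^ d) d" "3 \<le> b" "b \<le> p"
    then show "max_rank_each_degree (gs @ [M ^ b]) (N ^ 3) 3"
      unfolding each using step[of b] by simp
  next
    fix d :: nat assume B: "\<forall>b. 3 \<le> b \<and> b \<le> p \<longrightarrow> max_rank_each_degree (gs @ [M ^ b]) (N ^ 3) 3"
      and d: "1 \<le> d"
    consider "d = 1" | "d = 2" | "3 \<le> d" using d by linarith
    then show "max_rank_each_degree (gs @ [N ^ 3]) (M ^ d) d"
    proof cases
      case 3
      then show ?thesis using B step[OF 3] unfolding each by (cases "d \<le> p") auto
    qed (use d1 d2 in auto)
  qed
  show "(\<forall>b. 3 \<le> b \<and> b \<le> p \<longrightarrow> max_rank_each_degree (gs @ [M ^ b]) (N ^ 3) 3) \<longleftrightarrow>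
      (\<forall>b. 3 \<le> b \<and> b \<le> p \<longrightarrow> max_rank (gs @ [M ^ b]) (N ^ 3) 3 (int (pb b) + 2))"
  proof (intro iffI allI impI)
    fix b assume "\<forall>b. 3 \<le> b \<and> b \<le> p \<longrightarrow> max_rank_each_degree (gs @ [M ^ b]) (N ^ 3) 3"
      "3 \<le> b \<and> b \<le> p"
    then show "max_rank (gs @ [M ^ b]) (N ^ 3) 3 (int (pb b) + 2)"
      unfolding max_rank_each_degree_def by blast
  next
    fix b assume C: "\<forall>b. 3 \<le> b \<and> b \<le> p \<longrightarrow> max_rank (gs @ [M ^ b]) (N ^ 3) 3 (int (pb b) + 2)"
      and b: "3 \<le> b \<and> b \<le> p"
    show "max_rank_each_degree (gs @ [M ^ b]) (N ^ 3) 3"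
    proof (rule max_rank_power_each_degree[OF N])
      fix d assume "pb b < d" "d < pb b + 3"
      then consider "d = Suc (pb b)" | "d = pb b + 2" by linarith
      then show "max_rank (gs @ [M ^ b]) (N ^ 3) 3 (int d)"
        using C Nb_cube[of b] b by cases (auto simp: add.commute)
    qed (use b Nb_inj Nb_surj in auto)
  qed
qed

subsection \<open>Maximal rank for general forms from one special configuration\<close>

definition lf :: "(nat \<Rightarrow> 'k::comm_ring_1) \<Rightarrow> nat \<Rightarrow> 'k poly3" where
  "lf v k = linform (v (3 * k)) (v (3 * k + 1)) (v (3 * k + 2))"

text \<open>Each exponent carries the index of its form, so that lists may select any forms of the
  tuple and leave out the multiplier.\<close>

definition forms :: "(nat \<Rightarrow> 'k::comm_ring_1) \<Rightarrow> (nat \<times> nat) list \<Rightarrow> 'k poly3 list" where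
  "forms v ps = map (\<lambda>(k, c). lf v k ^ c) ps"

lemma length_forms [simp]: "length (forms v ps) = length ps"
  by (simp add: forms_def)

lemma forms_nth: "i < length ps \<Longrightarrow> forms v ps ! i = lf v (fst (ps ! i)) ^ snd (ps ! i)"
  by (simp add: forms_def case_prod_unfold)

lemma homog_lf: "homog (lf v k) 1" by (simp add: lf_def homog_linform)

lemma homog_lf_power: "homog (lf v k ^ c) (int c)"
  using homog_power[OF homog_lf, of v k c] by simp

lemma homog_forms: "i < length ps \<Longrightarrow> homog (forms v ps ! i) (int (snd (ps ! i)))"
  by (simp add: forms_nth homog_lf_power)

lemma homog_list_forms: "homog_list (forms v ps)"
  unfolding homog_list_def forms_def using homog_lf_power by fastforce

lemma polyvec_lf: "k < N \<Longrightarrow> (\<lambda>v. lf v k) \<in> polyvec (3 * N)"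
  unfolding lf_def by (rule polyvec_linform) auto

lemma polyvec_lf_power: "k < N \<Longrightarrow> (\<lambda>v. lf v k ^ c) \<in> polyvec (3 * N)"
  by (intro polyvec_power polyvec_lf)

definition bnd :: "nat \<Rightarrow> nat \<Rightarrow> (nat \<times> nat \<times> nat) set" where
  "bnd e d = {m \<in> expos d. snd (snd m) < e}"

lemma finite_bnd [simp]: "finite (bnd e d)"
  by (rule finite_subset[of _ "expos d"]) (auto simp: bnd_def)

definition tail :: "nat \<Rightarrow> nat \<Rightarrow> (nat \<times> nat \<times> nat) set" where
  "tail e d = (if e \<le> d then expos (d - e) else {})"

lemma finite_tail [simp]: "finite (tail e d)" by (simp add: tail_def)

lemma expos_split: "expos d = bnd e d \<union> (\<lambda>m. (0, 0, e) + m) ` tail e d"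
proof
  show "expos d \<subseteq> bnd e d \<union> (\<lambda>m. (0, 0, e) + m) ` tail e d"
  proof
    fix m assume m: "m \<in> expos d"
    obtain a b c where abc: "m = (a, b, c)" by (cases m)
    show "m \<in> bnd e d \<union> (\<lambda>m. (0, 0, e) + m) ` tail e d"
    proof (cases "c < e")
      case False
      then have "m = (0, 0, e) + (a, b, c - e)" "(a, b, c - e) \<in> tail e d"
        using m by (auto simp: abc tail_def expos_def)
      then show ?thesis by blast
    qed (use m abc in \<open>auto simp: bnd_def\<close>)
  qed
qed (auto simp: bnd_def tail_def expos_def split: if_splits)

lemma card_expos: "card (expos d) = card (bnd e d) + card (tail e d)"
proof -
  have "bnd e d \<inter> (\<lambda>m. (0, 0, e) + m) ` tail e d = {}" by (auto simp: bnd_def)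
  moreover have "inj_on (\<lambda>m. (0, 0, e) + m) (tail e d)" by (rule inj_onI) simp
  ultimately show ?thesis
    by (subst expos_split[of d e]) (simp add: card_Un_disjoint card_image)
qed

text \<open>The expected number of conditions that the powers in \<open>ps\<close> impose in degree
  \<open>d\<close> modulo \<open>z ^ e\<close>, that is, the number of their multiples in
  \<open>fvec\<close>.\<close>

definition cost :: "(nat \<times> nat) list \<Rightarrow> nat \<Rightarrow> nat \<Rightarrow> nat" where
  "cost ps e d = (\<Sum>k<length ps. if snd (ps ! k) \<le> d then card (bnd e (d - snd (ps ! k))) else 0)"

definition blk :: "(nat \<times> nat) list \<Rightarrow> nat \<Rightarrow> nat \<Rightarrow> nat \<Rightarrow> (nat \<times> nat \<times> nat) set" where
  "blk ps e d k = (if k < length ps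
     then (if snd (ps ! k) \<le> d then bnd e (d - snd (ps ! k)) else {}) else tail e d)"

definition fidx :: "(nat \<times> nat) list \<Rightarrow> nat \<Rightarrow> nat \<Rightarrow> (nat \<times> nat \<times> nat \<times> nat) set" where
  "fidx ps e d = Sigma {..length ps} (blk ps e d)"

text \<open>The obvious generators in degree \<open>d\<close> of the ideal of the forms \<open>ps\<close> and of the \<open>e\<close>-th power of the
  form \<open>t\<close>: multiples of the former are only taken modulo \<open>z ^ e\<close>, which loses nothing when
  the form \<open>t\<close> involves \<open>z\<close>.\<close>
definition fvec :: "(nat \<times> nat) list \<Rightarrow> nat \<Rightarrow> nat \<Rightarrow> (nat \<Rightarrow> 'k::comm_ring_1) \<Rightarrow>
    nat \<times> nat \<times> nat \<times> nat \<Rightarrow> 'k poly3" where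
  "fvec ps t e v = (\<lambda>(k, m). (if k < length ps then forms v ps ! k else lf v t ^ e) * mon m)"

lemma finite_blk [simp]: "finite (blk ps e d k)" by (simp add: blk_def)
lemma finite_fidx [simp]: "finite (fidx ps e d)" by (simp add: fidx_def)

lemma atMost_insert: "{..n} = insert n {..<n}" for n :: nat
  by auto

lemma card_fidx: "card (fidx ps e d) = cost ps e d + card (tail e d)"
proof -
  have "card (fidx ps e d) = (\<Sum>k\<le>length ps. card (blk ps e d k))"
    unfolding fidx_def by (rule card_SigmaI) auto
  also have "\<dots> = (\<Sum>k<length ps. card (blk ps e d k)) + card (blk ps e d (length ps))"
    by (simp add: atMost_insert)
  also have "(\<Sum>k<length ps. card (blk ps e d k)) = cost ps e d"
    unfolding cost_def by (rule sum.cong) (auto simp: blk_def)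
  finally show ?thesis by (simp add: blk_def)
qed

lemma fvec_sum: "(\<Sum>x\<in>fidx ps e d. sc (\<beta> x) (fvec ps t e v x)) =
    (\<Sum>k<length ps. forms v ps ! k * (\<Sum>m\<in>blk ps e d k. sc (\<beta> (k, m)) (mon m))) +
    lf v t ^ e * (\<Sum>m\<in>tail e d. sc (\<beta> (length ps, m)) (mon m))"
proof -
  have "(\<Sum>x\<in>fidx ps e d. sc (\<beta> x) (fvec ps t e v x)) =
      (\<Sum>k\<le>length ps. \<Sum>m\<in>blk ps e d k. sc (\<beta> (k, m)) (fvec ps t e v (k, m)))"
    unfolding fidx_def by (subst sum.Sigma) (simp_all add: case_prod_unfold)
  then show ?thesis
    by (simp add: atMost_insert add.commute fvec_def sum_distrib_left sc_mult_right blk_def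
        cong: sum.cong_simp)
qed

lemma homog_fvec:
  assumes "x \<in> fidx ps e d" shows "fvec ps t e v x \<in> hom d"
proof -
  obtain k m where x: "x = (k, m)" by (cases x) auto
  have "homog (fvec ps t e v x) (int d)"
  proof (cases "k < length ps")
    case True
    then have "snd (ps ! k) \<le> d" "mdeg m = d - snd (ps ! k)"
      using assms by (auto simp: x fidx_def blk_def bnd_def expos_def split: if_splits)
    then show ?thesis
      using homog_mult[OF homog_forms[OF True, of v] homog_mon[of m]] True
      by (simp add: x fvec_def of_nat_diff)
  next
    case False
    then have "e \<le> d" "mdeg m = d - e"
      using assms by (auto simp: x fidx_def blk_def tail_def expos_def split: if_splits)
    then show ?thesis
      using homog_mult[OF homog_lf_power[of v t e] homog_mon[of m]] False
      by (simp add: x fvec_def of_nat_diff)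
  qed
  then show ?thesis by (simp add: hom_def)
qed

lemma polyvec_fvec:
  assumes "\<And>k. k < length ps \<Longrightarrow> fst (ps ! k) < N" "t < N"
  shows "(\<lambda>v. fvec ps t e v x) \<in> polyvec (3 * N)"
proof -
  obtain k m where x: "x = (k, m)" by (cases x) auto
  show ?thesis
    using assms
    by (cases "k < length ps")
       (auto simp: x fvec_def forms_nth intro!: polyvec_mult polyvec_const polyvec_lf_power)
qed

text \<open>Division by the \<open>e\<close>-th power of the form \<open>t\<close> with remainders
  of \<open>z\<close>-exponent below \<open>e\<close>. It is evident when the form is
  \<open>z\<close> and amounts to an open spanning condition.\<close>

definition z_division :: "(nat \<Rightarrow> 'k::comm_ring_1) \<Rightarrow> nat \<Rightarrow> nat \<Rightarrow> nat \<Rightarrow> bool" where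
  "z_division v t e d \<longleftrightarrow> (\<forall>f. homog f (int d) \<longrightarrow> (\<exists>q \<gamma>. homog q (int d - int e) \<and>
     f = lf v t ^ e * q + (\<Sum>m\<in>bnd e d. sc (\<gamma> m) (mon m))))"

lemma homog_tail_sum: "homog (\<Sum>m\<in>tail e d. sc (c m) (mon m)) (int d - int e)"
proof (rule homog_sum)
  fix m assume "m \<in> tail e d"
  then have "int (mdeg m) = int d - int e"
    by (auto simp: tail_def expos_def split: if_splits)
  then show "homog (sc (c m) (mon m)) (int d - int e)" using homog_sc[OF homog_mon[of m]] by metis
qed

lemma lf_z_power:
  assumes "lf v t = linform 0 0 1" shows "lf v t ^ e = mon (0, 0, e)"
proof -
  have "lf v t = mon (0, 0, 1)" using assms by (simp add: linform_def mon_def)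
  then show ?thesis by (induction e) (auto simp: mon_mult zero_prod_def[symmetric])
qed

lemma general_z_division:
  fixes v0 :: "nat \<Rightarrow> 'k::field_char_0"
  assumes "t < N" "lf v0 t = linform 0 0 1"
  shows "general (3 * N) (\<lambda>v::nat \<Rightarrow> 'k. z_division v t e d)"
proof -
  define I where "I = Inl ` bnd e d \<union> Inr ` tail e d"
  define w where "w i v = (case i of Inl m \<Rightarrow> mon m | Inr m \<Rightarrow> lf v t ^ e * mon m)"
    for i :: "nat \<times> nat \<times> nat + nat \<times> nat \<times> nat" and v :: "nat \<Rightarrow> 'k"
  have fin: "finite I" by (simp add: I_def)
  have wp: "w i \<in> polyvec (3 * N)" for i
    using assms(1) by (cases i) (auto simp: w_def[abs_def] intro!: polyvec_mult polyvec_const polyvec_lf_power)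
  have wh: "w i v \<in> hom d" if "i \<in> I" for i v
  proof (cases i)
    case (Inl m)
    then have "mdeg m = d" using that by (auto simp: I_def bnd_def expos_def)
    then show ?thesis using homog_mon[of m] by (simp add: Inl w_def hom_def)
  next
    case (Inr m)
    then have "e \<le> d" "mdeg m = d - e"
      using that by (auto simp: I_def tail_def expos_def split: if_splits)
    then show ?thesis using homog_mult[OF homog_lf_power[of v t e] homog_mon[of m]]
      by (simp add: Inr w_def hom_def of_nat_diff)
  qed
  have "mon ` expos d \<subseteq> (\<lambda>i. w i v0) ` I"
  proof
    fix x :: "'k poly3" assume "x \<in> mon ` expos d"
    then obtain m where m: "m \<in> expos d" "x = mon m" by blast
    show "x \<in> (\<lambda>i. w i v0) ` I"
    proof (cases "m \<in> bnd e d")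
      case True
      then show ?thesis using m(2) by (intro image_eqI[of _ _ "Inl m"]) (auto simp: w_def I_def)
    next
      case False
      then obtain m' where "m' \<in> tail e d" "m = (0, 0, e) + m'"
        using m(1) expos_split[of d e] by blast
      then show ?thesis using m(2) lf_z_power[OF assms(2), of e]
        by (intro image_eqI[of _ _ "Inr m'"]) (auto simp: w_def I_def mon_mult)
    qed
  qed
  then have "hom d \<subseteq> P3.span ((\<lambda>i. w i v0) ` I)" unfolding hom_eq_span by (rule P3.span_mono)
  then have "general (3 * N) (\<lambda>v. hom d \<subseteq> P3.span ((\<lambda>i. w i v) ` I))"
    by (intro general_spanning[where ?v0.0 = v0] fin wp wh)
  then show ?thesis
  proof (rule general_mono)
    fix v :: "nat \<Rightarrow> 'k" assume sp: "hom d \<subseteq> P3.span ((\<lambda>i. w i v) ` I)"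
    show "z_division v t e d"
      unfolding z_division_def
    proof (intro allI impI)
      fix f :: "'k poly3" assume "homog f (int d)"
      then have "f \<in> P3.span ((\<lambda>i. w i v) ` I)" using sp by (auto simp: hom_def)
      then obtain c where "f = (\<Sum>i\<in>I. sc (c i) (w i v))" using span_family[OF fin] by blast
      then have "f = (\<Sum>m\<in>bnd e d. sc (c (Inl m)) (mon m)) +
          (\<Sum>m\<in>tail e d. sc (c (Inr m)) (lf v t ^ e * mon m))"
        unfolding I_def by (subst (asm) sum.union_disjoint) (auto simp: sum.reindex w_def)
      then have "f = lf v t ^ e * (\<Sum>m\<in>tail e d. sc (c (Inr m)) (mon m)) +
          (\<Sum>m\<in>bnd e d. sc (c (Inl m)) (mon m))"
        by (simp add: sum_distrib_left sc_mult_right add.commute)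
      then show "\<exists>q \<gamma>. homog q (int d - int e) \<and>
          f = lf v t ^ e * q + (\<Sum>m\<in>bnd e d. sc (\<gamma> m) (mon m))"
        by (intro exI[of _ "\<Sum>m\<in>tail e d. sc (c (Inr m)) (mon m)"] exI[of _ "\<lambda>m. c (Inl m)"] conjI
            homog_tail_sum)
    qed
  qed
qed

lemma homog_tail_expansion:
  fixes f :: "'k::field poly3"
  assumes "homog f (int d - int e)"
  shows "\<exists>c. f = (\<Sum>m\<in>tail e d. sc (c m) (mon m))"
proof (cases "e \<le> d")
  case True
  then have "f \<in> hom (d - e)" using assms by (simp add: hom_def of_nat_diff)
  then show ?thesis
    using span_family[of "expos (d - e)" f mon] True by (simp add: hom_eq_span tail_def)
next
  case False
  then have "f = 0" using homog_neg_degree[OF assms] by simp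
  then show ?thesis using False by (simp add: tail_def)
qed

text \<open>Express the product of \<open>f\<close> with the power as a combination of the forms and
  reduce the cofactors modulo that power. Moving the quotients \<open>q k\<close> over to
  \<open>f\<close> leaves a relation among the vectors \<open>fvec\<close>; it is trivial, so
  \<open>f\<close> is the combination with cofactors \<open>q k\<close>.\<close>

lemma mult_inj_of_lin_indep:
  fixes v :: "nat \<Rightarrow> 'k::field"
  assumes ind: "lin_indep (fidx ps e d) (fvec ps t e v)"
    and div: "\<And>k. k < length ps \<Longrightarrow> snd (ps ! k) \<le> d \<Longrightarrow> z_division v t e (d - snd (ps ! k))"
  shows "mult_inj (forms v ps) (lf v t ^ e) e (int d)"
  unfolding mult_inj_def
proof (intro allI impI, elim conjE)
  fix f :: "'k poly3" assume f: "homog f (int d - int e)" and I: "lf v t ^ e * f \<in> ideal_gen (forms v ps)"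
  have h: "homog (lf v t ^ e * f) (int d)" using homog_mult[OF homog_lf_power[of v t e] f] by simp
  obtain g where g: "lf v t ^ e * f = (\<Sum>k<length ps. g k * forms v ps ! k)"
    and gh: "\<And>k. k < length ps \<Longrightarrow> homog (g k) (int d - int (snd (ps ! k)))"
    using ideal_gen_homog[OF I h, of "\<lambda>k. int (snd (ps ! k))"] homog_forms by auto
  have "\<exists>q \<gamma>. homog q (int d - int (snd (ps ! k)) - int e) \<and>
      g k = lf v t ^ e * q + (\<Sum>m\<in>blk ps e d k. sc (\<gamma> m) (mon m))" if k: "k < length ps" for k
  proof (cases "snd (ps ! k) \<le> d")
    case True
    then have "homog (g k) (int (d - snd (ps ! k)))" using gh[OF k] by (simp add: of_nat_diff)
    then show ?thesis using div[OF k True] k True by (simp add: z_division_def blk_def of_nat_diff)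
  next
    case False
    then have "g k = 0" using homog_neg_degree[OF gh[OF k]] by simp
    then show ?thesis using k False by (intro exI[of _ 0]) (simp add: blk_def)
  qed
  then have "\<forall>k\<in>{..<length ps}. \<exists>x. homog (fst x) (int d - int (snd (ps ! k)) - int e) \<and>
      g k = lf v t ^ e * fst x + (\<Sum>m\<in>blk ps e d k. sc (snd x m) (mon m))"
    by simp
  then obtain x where x: "\<forall>k\<in>{..<length ps}.
      homog (fst (x k)) (int d - int (snd (ps ! k)) - int e) \<and>
      g k = lf v t ^ e * fst (x k) + (\<Sum>m\<in>blk ps e d k. sc (snd (x k) m) (mon m))"
    by (rule bchoice[THEN exE])
  define q \<gamma> where "q k = fst (x k)" and "\<gamma> k = snd (x k)" for k
  have q: "\<And>k. k < length ps \<Longrightarrow> homog (q k) (int d - int (snd (ps ! k)) - int e)"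
    and gq: "\<And>k. k < length ps \<Longrightarrow>
      g k = lf v t ^ e * q k + (\<Sum>m\<in>blk ps e d k. sc (\<gamma> k m) (mon m))"
    using x by (simp_all add: q_def \<gamma>_def)
  define f' where "f' = (\<Sum>k<length ps. q k * forms v ps ! k) - f"
  have "homog (q k * forms v ps ! k) (int d - int e)" if "k < length ps" for k
    using homog_mult[OF q[OF that] homog_forms[OF that, of v]] by (simp add: algebra_simps)
  then have "homog f' (int d - int e)" unfolding f'_def by (intro homog_diff homog_sum f) auto
  then obtain c where c: "f' = (\<Sum>m\<in>tail e d. sc (c m) (mon m))" using homog_tail_expansion by blast
  have "lf v t ^ e * f = (\<Sum>k<length ps. (lf v t ^ e * q k +
      (\<Sum>m\<in>blk ps e d k. sc (\<gamma> k m) (mon m))) * forms v ps ! k)"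
    unfolding g by (rule sum.cong) (simp_all add: gq)
  then have "(\<Sum>k<length ps. forms v ps ! k * (\<Sum>m\<in>blk ps e d k. sc (\<gamma> k m) (mon m))) + lf v t ^ e * f' = 0"
    by (simp add: f'_def algebra_simps sum.distrib sum_distrib_left)
  then have 0: "(\<Sum>x\<in>fidx ps e d. sc (case x of (k, m) \<Rightarrow> if k < length ps then \<gamma> k m else c m)
      (fvec ps t e v x)) = 0"
    unfolding fvec_sum c by (simp cong: sum.cong_simp)
  have "c m = 0" if "m \<in> tail e d" for m
    using lin_indepD[OF ind 0, of "(length ps, m)"] that by (simp add: fidx_def blk_def)
  then have "f' = 0" by (simp add: c)
  then have "f = (\<Sum>k<length ps. q k * forms v ps ! k)" by (simp add: f'_def)
  then show "f \<in> ideal_gen (forms v ps)" by (auto simp: ideal_gen_iff)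
qed

lemma mult_surj_of_spanning:
  fixes v :: "nat \<Rightarrow> 'k::field"
  assumes "hom d \<subseteq> P3.span (fvec ps t e v ` fidx ps e d)"
  shows "mult_surj (forms v ps) (lf v t ^ e) e (int d)"
  unfolding mult_surj_def
proof (intro allI impI)
  fix g :: "'k poly3" assume "homog g (int d)"
  then have "g \<in> P3.span (fvec ps t e v ` fidx ps e d)" using assms by (auto simp: hom_def)
  then obtain \<beta> where "g = (\<Sum>x\<in>fidx ps e d. sc (\<beta> x) (fvec ps t e v x))"
    using span_family[OF finite_fidx] by blast
  then have "g - lf v t ^ e * (\<Sum>m\<in>tail e d. sc (\<beta> (length ps, m)) (mon m)) =
      (\<Sum>k<length ps. (\<Sum>m\<in>blk ps e d k. sc (\<beta> (k, m)) (mon m)) * forms v ps ! k)"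
    unfolding fvec_sum by (simp add: mult.commute)
  then have "g - lf v t ^ e * (\<Sum>m\<in>tail e d. sc (\<beta> (length ps, m)) (mon m)) \<in> ideal_gen (forms v ps)"
    unfolding ideal_gen_iff length_forms by (intro exI)
  then show "\<exists>f. homog f (int d - int e) \<and> g - lf v t ^ e * f \<in> ideal_gen (forms v ps)"
    by (intro exI[of _ "\<Sum>m\<in>tail e d. sc (\<beta> (length ps, m)) (mon m)"] conjI homog_tail_sum)
qed

text \<open>One configuration settles both halves thanks to the truncated difference bounding
  \<open>card E\<close>: if it is not truncated, the count forces independence; if the cost is at
  least the dimension, \<open>E\<close> is empty and \<open>fvec\<close> spans.\<close>

lemma general_max_rank:
  fixes v0 :: "nat \<Rightarrow> 'k::field_char_0"
  assumes ps: "\<And>k. k < length ps \<Longrightarrow> fst (ps ! k) < N" and t: "t < N"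
    and z: "lf v0 t = linform 0 0 1"
    and E: "finite E" "card E \<le> card (bnd e d) - cost ps e d"
    and sp: "hom d \<subseteq> P3.span (fvec ps t e v0 ` fidx ps e d \<union> E)"
  shows "general (3 * N) (\<lambda>v::nat \<Rightarrow> 'k.
    (cost ps e d \<le> card (bnd e d) \<longrightarrow> mult_inj (forms v ps) (lf v t ^ e) e (int d)) \<and>
    (card (bnd e d) \<le> cost ps e d \<longrightarrow> mult_surj (forms v ps) (lf v t ^ e) e (int d)))"
proof (rule general_conj)
  have fp: "(\<lambda>v. fvec ps t e v x) \<in> polyvec (3 * N)" for x using ps t by (rule polyvec_fvec)
  show "general (3 * N) (\<lambda>v::nat \<Rightarrow> 'k.
      cost ps e d \<le> card (bnd e d) \<longrightarrow> mult_inj (forms v ps) (lf v t ^ e) e (int d))"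
  proof (cases "cost ps e d \<le> card (bnd e d)")
    case True
    have "card (fidx ps e d) + card E \<le> card (expos d)"
      using True E(2) by (simp add: card_fidx card_expos[of d e])
    then have "lin_indep (fidx ps e d) (fvec ps t e v0)"
      by (rule spanning_lin_indep[OF finite_fidx E(1) _ sp])
    then have 1: "general (3 * N) (\<lambda>v::nat \<Rightarrow> 'k. lin_indep (fidx ps e d) (\<lambda>x. fvec ps t e v x))"
      by (intro general_lin_indep[where ?v0.0 = v0] fp) simp_all
    have 2: "general (3 * N) (\<lambda>v::nat \<Rightarrow> 'k. \<forall>k\<in>{..<length ps}. z_division v t e (d - snd (ps ! k)))"
      by (intro general_ball general_z_division[OF t z]) simp
    from general_conj[OF 1 2] show ?thesis
      by (rule general_mono) (auto intro: mult_inj_of_lin_indep)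
  qed (auto intro: general_True)
  show "general (3 * N) (\<lambda>v::nat \<Rightarrow> 'k.
      card (bnd e d) \<le> cost ps e d \<longrightarrow> mult_surj (forms v ps) (lf v t ^ e) e (int d))"
  proof (cases "card (bnd e d) \<le> cost ps e d")
    case True
    then have "E = {}" using E by simp
    then have "hom d \<subseteq> P3.span ((\<lambda>x. fvec ps t e v0 x) ` fidx ps e d)" using sp by simp
    then have "general (3 * N) (\<lambda>v::nat \<Rightarrow> 'k. hom d \<subseteq> P3.span ((\<lambda>x. fvec ps t e v x) ` fidx ps e d))"
      by (intro general_spanning[where ?v0.0 = v0] fp homog_fvec) simp_all
    then show ?thesis by (rule general_mono) (auto intro: mult_surj_of_spanning)
  qed (auto intro: general_True)
qed

lemma card_bnd: "card (bnd e d) = (\<Sum>l<e. d + 1 - l)"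
proof -
  have "bnd e d = (\<Union>l\<in>{..<e}. (\<lambda>a. (a, d - l - a, l)) ` {a. a + l \<le> d})"
    by (auto simp: bnd_def expos_def image_iff)
  moreover have "card ((\<lambda>a. (a, d - l - a, l)) ` {a. a + l \<le> d}) = d + 1 - l" for l
  proof -
    have "{a. a + l \<le> d} = {..<d + 1 - l}" by auto
    then show ?thesis by (subst card_image) (auto simp: inj_on_def)
  qed
  moreover have "card (\<Union>l\<in>{..<e}. (\<lambda>a. (a, d - l - a, l)) ` {a. a + l \<le> d}) =
      (\<Sum>l<e. card ((\<lambda>a. (a, d - l - a, l)) ` {a. a + l \<le> d}))"
  proof (rule card_UN_disjoint)
    show "\<forall>l\<in>{..<e}. finite ((\<lambda>a. (a, d - l - a, l)) ` {a. a + l \<le> d})"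
      by (intro ballI finite_imageI) (rule finite_subset[of _ "{..d}"], auto)
  qed auto
  ultimately show ?thesis by simp
qed

subsection \<open>Inverse systems\<close>

definition lin_fun :: "((nat \<Rightarrow> 'k::comm_ring_1 poly) \<Rightarrow> 'k) \<Rightarrow> bool" where
  "lin_fun \<phi> \<longleftrightarrow> (\<forall>f g. \<phi> (\<lambda>k. f k + g k) = \<phi> f + \<phi> g) \<and> (\<forall>c f. \<phi> (\<lambda>k. smult c (f k)) = c * \<phi> f)"

text \<open>Dimension at most \<open>n\<close> in dual form: \<open>n\<close> linear functionals
  whose only common zero in \<open>V\<close> is zero. The functionals themselves matter later, since
  they produce the vectors of \<open>E\<close>.\<close>

definition dimle :: "nat \<Rightarrow> (nat \<Rightarrow> 'k::comm_ring_1 poly) set \<Rightarrow> bool" where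
  "dimle n V \<longleftrightarrow> (\<exists>\<phi>. (\<forall>j<n. lin_fun (\<phi> j)) \<and> (\<forall>f\<in>V. (\<forall>j<n. \<phi> j f = 0) \<longrightarrow> f = (\<lambda>k. 0)))"

text \<open>A family \<open>f\<close> stands for the bivariate polynomial \<open>F(s, y) = (\<Sum>k<e. f k (s) * y ^ k)\<close>;
  \<open>taylor e y l f\<close> is the \<open>l\<close>-th Taylor coefficient of \<open>F\<close> in its second argument at \<open>y\<close>.\<close>
definition taylor :: "nat \<Rightarrow> 'k::comm_ring_1 \<Rightarrow> nat \<Rightarrow> (nat \<Rightarrow> 'k poly) \<Rightarrow> 'k poly" where
  "taylor e y l f = (\<Sum>k<e. smult (of_nat (k choose l) * y ^ (k - l)) (f k))"

text \<open>Multiplicity at least \<open>m\<close> at the point \<open>(x, y)\<close>; truncation of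
  \<open>m - l\<close> leaves the orders \<open>l \<ge> m\<close> unconstrained.\<close>

definition vanish :: "nat \<Rightarrow> (nat \<Rightarrow> 'k::comm_ring_1 poly) \<Rightarrow> 'k \<Rightarrow> 'k \<Rightarrow> nat \<Rightarrow> bool" where
  "vanish e f x y m \<longleftrightarrow> (\<forall>l<e. [:- x, 1:] ^ (m - l) dvd taylor e y l f)"

text \<open>Geometrically, for \<open>e \<le> d + 1\<close>, plane curves of degree \<open>d\<close>
  with a point of multiplicity at least \<open>d + 1 - e\<close> at infinity on the second
  axis.\<close>

definition degb :: "nat \<Rightarrow> nat \<Rightarrow> (nat \<Rightarrow> 'k::comm_ring_1 poly) \<Rightarrow> bool" where
  "degb e d f \<longleftrightarrow> (\<forall>k\<ge>e. f k = 0) \<and> (\<forall>k j. d < j + k \<longrightarrow> coeff (f k) j = 0)"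

lemma lin_fun_add: "lin_fun \<phi> \<Longrightarrow> \<phi> (\<lambda>k. f k + g k) = \<phi> f + \<phi> g"
  and lin_fun_smult: "lin_fun \<phi> \<Longrightarrow> \<phi> (\<lambda>k. smult c (f k)) = c * \<phi> f"
  by (simp_all add: lin_fun_def)

lemma lin_fun_zero: "lin_fun \<phi> \<Longrightarrow> \<phi> (\<lambda>k. 0) = 0"
  using lin_fun_smult[of \<phi> 0 "\<lambda>k. 0"] by simp

lemma lin_fun_sum:
  assumes "lin_fun \<phi>" "finite A"
  shows "\<phi> (\<lambda>k. \<Sum>i\<in>A. smult (c i) (u i k)) = (\<Sum>i\<in>A. c i * \<phi> (u i))"
  using assms(2)
proof (induction A rule: finite_induct)
  case empty
  then show ?case using lin_fun_zero[OF assms(1)] by simp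
next
  case (insert a A)
  have "\<phi> (\<lambda>k. smult (c a) (u a k) + (\<Sum>i\<in>A. smult (c i) (u i k))) =
      \<phi> (\<lambda>k. smult (c a) (u a k)) + \<phi> (\<lambda>k. \<Sum>i\<in>A. smult (c i) (u i k))"
    by (rule lin_fun_add[OF assms(1)])
  also have "\<phi> (\<lambda>k. smult (c a) (u a k)) = c a * \<phi> (u a)"
    by (rule lin_fun_smult[OF assms(1)])
  finally show ?case using insert by simp
qed

section \<open>Linear functionals on the polynomial ring\<close>

definition functional :: "('k::field poly3 \<Rightarrow> 'k) \<Rightarrow> bool" where
  "functional L \<longleftrightarrow> (\<forall>f g. L (f + g) = L f + L g) \<and> (\<forall>c f. L (sc c f) = c * L f)"

lemma functional_add: "functional L \<Longrightarrow> L (f + g) = L f + L g"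
  and functional_sc: "functional L \<Longrightarrow> L (sc c f) = c * L f"
  by (simp_all add: functional_def)

lemma functional_0: "functional L \<Longrightarrow> L 0 = 0"
  using functional_sc[of L 0 0] by simp

lemma functional_sum: "functional L \<Longrightarrow> L (\<Sum>i\<in>A. f i) = (\<Sum>i\<in>A. L (f i))"
  by (induction A rule: infinite_finite_induct) (simp_all add: functional_0 functional_add)

lemma functional_span:
  assumes "functional L" "\<And>x. x \<in> S \<Longrightarrow> L x = 0" "x \<in> P3.span S" shows "L x = 0"
proof -
  have "P3.span S \<subseteq> {x. L x = 0}"
    using assms(1,2)
    by (intro P3.span_minimal) (auto simp: P3.subspace_def functional_0 functional_add functional_sc)
  then show ?thesis using assms(3) by blast
qed

lemma exists_functional:
  fixes g :: "'k::field poly3"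
  assumes "g \<notin> P3.span S"
  shows "\<exists>L. functional L \<and> (\<forall>x\<in>S. L x = 0) \<and> L g = 1"
proof -
  interpret V: vector_space_pair sc "(*) :: 'k \<Rightarrow> 'k \<Rightarrow> 'k"
    by unfold_locales (auto simp: algebra_simps)
  obtain B where B: "B \<subseteq> S" "P3.independent B" "S \<subseteq> P3.span B"
    by (rule P3.maximal_independent_subset)
  have gB: "g \<notin> P3.span B" using assms P3.span_mono[OF B(1)] by blast
  have "P3.independent (insert g B)" by (rule P3.independent_insertI[OF gB B(2)])
  from V.linear_independent_extend[OF this, of "\<lambda>x. if x = g then 1 else 0"]
  obtain L where L: "Vector_Spaces.linear sc (*) L" "\<forall>x\<in>insert g B. L x = (if x = g then 1 else 0)"
    by blast
  have f: "functional L"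
    unfolding functional_def using V.linear_add[OF L(1)] V.linear_scale[OF L(1)] by blast
  have "L x = 0" if "x \<in> B" for x using L(2) that gB P3.span_base[of x B] by auto
  then have "L x = 0" if "x \<in> S" for x
    using functional_span[OF f, of B x] that B(3) by blast
  then show ?thesis using f L(2) by auto
qed

section \<open>The dual form of a functional and its Taylor coefficients\<close>

definition mx :: "'k::comm_ring_1 poly3" where "mx = mon (1, 0, 0)"
definition my :: "'k::comm_ring_1 poly3" where "my = mon (0, 1, 0)"
definition mz :: "'k::comm_ring_1 poly3" where "mz = mon (0, 0, 1)"

lemma mon_powers: "mx ^ a = mon (a, 0, 0)" "my ^ a = mon (0, a, 0)" "mz ^ a = mon (0, 0, a)"
  by (induction a; simp add: mx_def my_def mz_def mon_mult zero_prod_def[symmetric])+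

lemma homog_mx: "homog mx 1" and homog_my: "homog my 1" and homog_mz: "homog mz 1"
  using homog_mon[of "(1, 0, 0)"] homog_mon[of "(0, 1, 0)"] homog_mon[of "(0, 0, 1)"]
  by (simp_all add: mx_def my_def mz_def)

lemma sc_power: "sc c f ^ n = sc (c ^ n) (f ^ n)" for c :: "'k::field"
  by (induction n) (simp_all add: sc_mult_left sc_mult_right mult.commute)

lemma of_nat_mult_poly3: "of_nat n * (f :: 'k::comm_ring_1 poly3) = sc (of_nat n) f"
  by (simp add: sc_def)

lemma linform_mon: "linform a b c = sc a mx + sc b my + sc c mz"
  by (simp add: linform_def sc_mon mx_def my_def mz_def)

lemma binomial_sc:
  fixes f g :: "'k::field poly3"
  shows "(f + sc c g) ^ n = (\<Sum>j\<le>n. sc (of_nat (n choose j) * c ^ j) (f ^ (n - j) * g ^ j))"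
proof -
  have "(f + sc c g) ^ n = (\<Sum>j\<le>n. of_nat (n choose j) * (sc c g) ^ j * f ^ (n - j))"
    by (subst add.commute) (rule binomial_ring)
  also have "\<dots> = (\<Sum>j\<le>n. sc (of_nat (n choose j) * c ^ j) (g ^ j * f ^ (n - j)))"
    by (simp add: sc_power of_nat_mult_poly3 sc_mult_left)
  finally show ?thesis by (simp add: mult.commute)
qed

text \<open>The multinomial term of the monomial \<open>m\<close> in the \<open>d\<close>-th power
  of a general linear form, at first coefficient 1.\<close>

definition dual_unit :: "nat \<Rightarrow> nat \<times> nat \<times> nat \<Rightarrow> nat \<Rightarrow> 'k::comm_ring_1 poly" where
  "dual_unit d m k = (if k = snd (snd m)
     then monom (of_nat (d choose k) * of_nat ((d - k) choose (fst (snd m)))) (fst (snd m)) else 0)"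

text \<open>The form \<open>(a, b, c) \<mapsto> L ((a x + b y + c z) ^ d)\<close> in the affine chart \<open>a = 1\<close>.\<close>
definition dual_family :: "nat \<Rightarrow> nat \<Rightarrow> ('k::field poly3 \<Rightarrow> 'k) \<Rightarrow> nat \<Rightarrow> 'k poly" where
  "dual_family e d L = (\<lambda>k. \<Sum>m\<in>bnd e d. smult (L (mon m)) (dual_unit d m k))"

lemma coeff_dual_family:
  "coeff (dual_family e d L k) j = (if k < e \<and> j + k \<le> d
     then of_nat (d choose k) * of_nat ((d - k) choose j) * L (mon (d - k - j, j, k)) else 0)"
proof -
  have mem: "(d - k - j, j, k) \<in> bnd e d \<longleftrightarrow> k < e \<and> j + k \<le> d"
    by (auto simp: bnd_def expos_def)
  have "coeff (dual_family e d L k) j = (\<Sum>m\<in>bnd e d. if m = (d - k - j, j, k) then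
      of_nat (d choose k) * of_nat ((d - k) choose j) * L (mon m) else 0)"
    unfolding dual_family_def coeff_sum
    by (rule sum.cong) (auto simp: dual_unit_def bnd_def expos_def)
  also have "\<dots> = (if k < e \<and> j + k \<le> d
     then of_nat (d choose k) * of_nat ((d - k) choose j) * L (mon (d - k - j, j, k)) else 0)"
    by (simp only: sum.delta[OF finite_bnd] mem)
  finally show ?thesis .
qed

lemma degb_dual_family: "degb e d (dual_family e d L)"
  by (auto simp: degb_def poly_eq_iff coeff_dual_family)

lemma poly_dual_family:
  assumes L: "functional L" and k: "k < e" "k \<le> d"
  shows "poly (dual_family e d L k) s = of_nat (d choose k) * L ((mx + sc s my) ^ (d - k) * mz ^ k)"
proof -
  let ?p = "\<Sum>j\<le>d - k. monom (of_nat (d choose k) * of_nat ((d - k) choose j) * L (mon (d - k - j, j, k))) j"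
  have "dual_family e d L k = ?p"
    using k by (auto simp: poly_eq_iff coeff_dual_family coeff_sum intro!: sum.neutral)
  then have "poly (dual_family e d L k) s = (\<Sum>j\<le>d - k. of_nat (d choose k) *
      (of_nat ((d - k) choose j) * s ^ j * L (mon (d - k - j, j, k))))"
    by (simp add: poly_sum poly_monom mult_ac)
  also have "\<dots> = of_nat (d choose k) * L ((mx + sc s my) ^ (d - k) * mz ^ k)"
    by (simp add: binomial_sc sum_distrib_right sc_mult_left functional_sum[OF L] functional_sc[OF L]
        mon_powers mon_mult sum_distrib_left)
  finally show ?thesis .
qed

lemma functional_high_z:
  assumes L: "functional L" and kill: "\<And>m. m \<in> tail e d \<Longrightarrow> L (mz ^ e * mon m) = 0"
    and h: "homog h (int d - int e)"
  shows "L (mz ^ e * h) = 0"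
proof -
  obtain c where "h = (\<Sum>m\<in>tail e d. sc (c m) (mon m))" using homog_tail_expansion[OF h] by blast
  then have "mz ^ e * h = (\<Sum>m\<in>tail e d. sc (c m) (mz ^ e * mon m))"
    by (simp add: sum_distrib_left sc_mult_right)
  then show ?thesis by (simp add: functional_sum[OF L] functional_sc[OF L] kill)
qed

text \<open>Taylor expansion in the second variable is the binomial theorem here, with
  \<open>choose_mult\<close> exchanging the coefficients. The terms containing \<open>mz ^ k\<close>
  with \<open>k \<ge> e\<close> are killed by \<open>L\<close>, so truncating the family at
  \<open>e\<close> loses nothing.\<close>

lemma poly_taylor_dual_family:
  fixes L :: "'k::field poly3 \<Rightarrow> 'k"
  assumes L: "functional L" and kill: "\<And>m. m \<in> tail e d \<Longrightarrow> L (mz ^ e * mon m) = 0"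
    and l: "l < e" "l \<le> d"
  shows "poly (taylor e y l (dual_family e d L)) s =
    of_nat (d choose l) * L ((mx + sc s my + sc y mz) ^ (d - l) * mz ^ l)"
proof -
  define N where "N = mx + sc s my"
  define T where "T k = of_nat (d choose k) * of_nat (k choose l) * y ^ (k - l) * L (N ^ (d - k) * mz ^ k)" for k
  have N1: "homog N 1"
    unfolding N_def by (intro homog_add homog_sc homog_mx homog_my)
  have high: "L (N ^ (d - k) * mz ^ k) = 0" if "e \<le> k" "k \<le> d" for k
  proof -
    have "homog (N ^ (d - k) * mz ^ (k - e)) (int (d - k) * 1 + int (k - e) * 1)"
      by (intro homog_mult homog_power N1 homog_mz)
    then have hN: "homog (N ^ (d - k) * mz ^ (k - e)) (int d - int e)" using that by simp
    have "L (mz ^ e * (N ^ (d - k) * mz ^ (k - e))) = 0"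
      by (rule functional_high_z[OF L _ hN]) (rule kill)
    moreover have "mz ^ k = (mz ^ e * mz ^ (k - e) :: 'k poly3)"
      using that by (simp flip: power_add)
    then have "N ^ (d - k) * mz ^ k = mz ^ e * (N ^ (d - k) * mz ^ (k - e))"
      by (simp only: mult.left_commute)
    ultimately show ?thesis by simp
  qed
  have "L ((N + sc y mz) ^ (d - l) * mz ^ l) =
      (\<Sum>i\<le>d - l. of_nat ((d - l) choose i) * y ^ i * L (N ^ (d - l - i) * mz ^ (i + l)))"
    by (simp add: binomial_sc sum_distrib_right sc_mult_left functional_sum[OF L] functional_sc[OF L]
        mult.assoc power_add)
  then have "of_nat (d choose l) * L ((N + sc y mz) ^ (d - l) * mz ^ l) =
      (\<Sum>i\<le>d - l. of_nat (d choose l) * of_nat ((d - l) choose i) * y ^ i *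
         L (N ^ (d - l - i) * mz ^ (i + l)))"
    by (simp add: sum_distrib_left mult_ac)
  also have "\<dots> = (\<Sum>i\<le>d - l. T (i + l))"
  proof (rule sum.cong[OF refl])
    fix i assume "i \<in> {..d - l}"
    then have i: "l \<le> i + l" "i + l \<le> d" using l by auto
    have "(d choose (i + l)) * ((i + l) choose l) = (d choose l) * ((d - l) choose i)"
      using choose_mult[OF i] by simp
    then have "(of_nat (d choose (i + l)) * of_nat ((i + l) choose l) :: 'k) =
        of_nat (d choose l) * of_nat ((d - l) choose i)"
      by (simp only: of_nat_mult[symmetric])
    then show "of_nat (d choose l) * of_nat ((d - l) choose i) * y ^ i *
         L (N ^ (d - l - i) * mz ^ (i + l)) = T (i + l)"
      by (simp add: T_def add.commute)
  qed
  also have "\<dots> = (\<Sum>k\<in>{l..d}. T k)"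
    using l by (intro sum.reindex_bij_witness[of _ "\<lambda>k. k - l" "\<lambda>i. i + l"]) auto
  also have "\<dots> = (\<Sum>k<e. if k \<le> d then T k else 0)"
  proof -
    have "(\<Sum>k\<in>{l..d}. T k) = (\<Sum>k\<in>{l..d} \<inter> {..<e}. T k)"
      by (rule sum.mono_neutral_right) (auto simp: T_def high)
    also have "\<dots> = (\<Sum>k<e. if k \<le> d then T k else 0)"
      by (rule sum.mono_neutral_cong_left) (auto simp: T_def binomial_eq_0)
    finally show ?thesis .
  qed
  also have "\<dots> = poly (taylor e y l (dual_family e d L)) s"
  proof -
    have "(if k \<le> d then T k else 0) = of_nat (k choose l) * y ^ (k - l) * poly (dual_family e d L k) s"
      if "k < e" for k
    proof (cases "k \<le> d")
      case True
      then show ?thesis by (simp add: T_def poly_dual_family[OF L that True] N_def mult_ac)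
    next
      case False
      then have "dual_family e d L k = 0" by (simp add: poly_eq_iff coeff_dual_family)
      then show ?thesis using False by simp
    qed
    then show ?thesis by (simp add: taylor_def poly_sum)
  qed
  finally show ?thesis by (simp add: N_def)
qed

text \<open>With \<open>M\<close> the linear form of the point,
  \<open>mx + sc s my + sc y mz = M + sc (s - x) my\<close>. The coefficient of
  \<open>(s - x) ^ j\<close> involves \<open>M ^ (d - l - j)\<close>, which contains
  \<open>M ^ c\<close> whenever \<open>j < d + 1 - c - l\<close>.\<close>

lemma vanish_dual_family:
  fixes L :: "'k::field_char_0 poly3 \<Rightarrow> 'k"
  assumes L: "functional L" and kill: "\<And>m. m \<in> tail e d \<Longrightarrow> L (mz ^ e * mon m) = 0"
    and kill': "\<And>m. c \<le> d \<Longrightarrow> m \<in> bnd e (d - c) \<Longrightarrow> L (linform 1 x y ^ c * mon m) = 0"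
  shows "vanish e (dual_family e d L) x y (d + 1 - c)"
  unfolding vanish_def
proof (intro allI impI)
  fix l assume l: "l < e"
  let ?t = "taylor e y l (dual_family e d L)"
  let ?M = "linform 1 x y :: 'k poly3"
  show "[:- x, 1:] ^ (d + 1 - c - l) dvd ?t"
  proof (cases "l \<le> d")
    case False
    have "dual_family e d L k = 0" if "d < k" for k
      using that by (simp add: poly_eq_iff coeff_dual_family)
    then have "?t = 0" using False unfolding taylor_def
      by (intro sum.neutral) (auto simp: binomial_eq_0 not_le)
    then show ?thesis by simp
  next
    case True
    \<comment> \<open>\<open>kill'\<close> covers only cofactors of \<open>z\<close>-exponent below
      \<open>e\<close>; the remaining ones contain \<open>mz ^ e\<close> and fall under
      \<open>kill\<close>.\<close>
    have M_kill: "L (?M ^ c * mon m) = 0" if c: "c \<le> d" and m: "m \<in> expos (d - c)" for m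
    proof (cases "m \<in> bnd e (d - c)")
      case False
      then obtain m' where m': "m' \<in> tail e (d - c)" "m = (0, 0, e) + m'"
        using m expos_split[of "d - c" e] by blast
      then have "homog (?M ^ c * mon m') (int c * 1 + int (mdeg m'))"
        by (intro homog_mult homog_power homog_linform homog_mon)
      moreover have "int c * 1 + int (mdeg m') = int d - int e"
        using m'(1) c by (auto simp: tail_def expos_def split: if_splits)
      ultimately have "L (mz ^ e * (?M ^ c * mon m')) = 0"
        using functional_high_z[OF L kill] by simp
      moreover have "mz ^ e * (?M ^ c * mon m') = ?M ^ c * mon m"
        by (simp only: m'(2) mon_powers mon_mult[symmetric] mult_ac)
      ultimately show ?thesis by simp
    qed (use kill' c in blast)
    define a where "a j = of_nat (d choose l) * (of_nat ((d - l) choose j) *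
        L (?M ^ (d - l - j) * my ^ j * mz ^ l))" for j
    have a0: "a j = 0" if j: "j < d + 1 - c - l" for j
    proof -
      have "?M ^ (d - l - j) = ?M ^ c * ?M ^ (d - l - j - c)"
        using j by (simp flip: power_add)
      then have "?M ^ (d - l - j) * my ^ j * mz ^ l = ?M ^ c * (?M ^ (d - l - j - c) * mon (0, j, l))"
        by (simp add: mon_powers mon_mult mult.assoc)
      moreover have "homog (?M ^ (d - l - j - c) * mon (0, j, l)) (int (d - l - j - c) * 1 + int (j + l))"
        using homog_mon[of "(0, j, l)"] by (intro homog_mult homog_power homog_linform) simp
      then have "?M ^ (d - l - j - c) * mon (0, j, l) \<in> hom (d - c)"
        using j by (simp add: hom_def of_nat_diff)
      then have "\<exists>u. ?M ^ (d - l - j - c) * mon (0, j, l) = (\<Sum>m\<in>expos (d - c). sc (u m) (mon m))"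
        unfolding hom_eq_span by (intro span_family) simp_all
      then obtain u where "?M ^ (d - l - j - c) * mon (0, j, l) = (\<Sum>m\<in>expos (d - c). sc (u m) (mon m))"
        by blast
      ultimately have "?M ^ (d - l - j) * my ^ j * mz ^ l = (\<Sum>m\<in>expos (d - c). sc (u m) (?M ^ c * mon m))"
        by (simp add: sum_distrib_left sc_mult_right)
      then have "L (?M ^ (d - l - j) * my ^ j * mz ^ l) = 0"
        using M_kill j by (simp add: functional_sum[OF L] functional_sc[OF L])
      then show ?thesis by (simp add: a_def)
    qed
    have "?t = (\<Sum>j\<le>d - l. smult (a j) ([:- x, 1:] ^ j))"
    proof (rule poly_eq_poly_eq_iff[THEN iffD1], rule ext)
      fix s
      have "mx + sc s my + sc y mz = ?M + sc (s - x) my"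
        by (simp add: linform_mon P3.scale_left_diff_distrib)
      then have "poly ?t s = of_nat (d choose l) * L ((?M + sc (s - x) my) ^ (d - l) * mz ^ l)"
        using poly_taylor_dual_family[OF L kill l True] by simp
      also have "L ((?M + sc (s - x) my) ^ (d - l) * mz ^ l) =
          (\<Sum>j\<le>d - l. of_nat ((d - l) choose j) * (s - x) ^ j * L (?M ^ (d - l - j) * my ^ j * mz ^ l))"
        by (simp add: binomial_sc sum_distrib_right sc_mult_left functional_sum[OF L]
            functional_sc[OF L])
      also have "of_nat (d choose l) * \<dots> = (\<Sum>j\<le>d - l. a j * (s - x) ^ j)"
        by (simp add: a_def sum_distrib_left mult_ac)
      finally show "poly ?t s = poly (\<Sum>j\<le>d - l. smult (a j) ([:- x, 1:] ^ j)) s"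
        by (simp add: poly_sum)
    qed
    moreover have "[:- x, 1:] ^ (d + 1 - c - l) dvd smult (a j) ([:- x, 1:] ^ j)" for j
    proof (cases "j < d + 1 - c - l")
      case False
      then show ?thesis by (intro dvd_smult le_imp_power_dvd) simp
    qed (simp add: a0)
    ultimately show ?thesis by (simp add: dvd_sum)
  qed
qed

text \<open>The inverse system in degree \<open>d\<close>, by the classical dictionary between
  powers of linear forms and fat points: a generator \<open>M ^ c\<close> becomes multiplicity
  \<open>d + 1 - c\<close> at the point of \<open>M\<close>, and \<open>z ^ e\<close> becomes the
  bound on the second variable.\<close>

definition apolar :: "nat \<Rightarrow> nat \<Rightarrow> (nat \<times> nat) list \<Rightarrow> (nat \<Rightarrow> 'k::comm_ring_1) \<Rightarrow> (nat \<Rightarrow> 'k) \<Rightarrow>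
    (nat \<Rightarrow> 'k poly) set" where
  "apolar e d ps x y = {f. degb e d f \<and>
     (\<forall>k<length ps. vanish e f (x k) (y k) (d + 1 - snd (ps ! k)))}"

text \<open>Pulled back along \<open>dual_family\<close>, each \<open>\<phi> j\<close> is evaluation
  of \<open>L\<close> at one fixed vector; these vectors form \<open>E\<close>. A functional killing
  \<open>fvec\<close> and \<open>E\<close> has dual family zero, and as multinomial coefficients are
  nonzero in characteristic zero, it vanishes on every monomial of degree \<open>d\<close>.\<close>

lemma codimension_of_dimle:
  fixes v0 :: "nat \<Rightarrow> 'k::field_char_0"
  assumes dim: "dimle n (apolar e d ps x y)"
    and z: "lf v0 t = linform 0 0 1"
    and pts: "\<And>k. k < length ps \<Longrightarrow> lf v0 (fst (ps ! k)) = linform 1 (x k) (y k)"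
  shows "\<exists>E. finite E \<and> card E \<le> n \<and> hom d \<subseteq> P3.span (fvec ps t e v0 ` fidx ps e d \<union> E)"
proof -
  obtain \<phi> where \<phi>: "\<And>j. j < n \<Longrightarrow> lin_fun (\<phi> j)"
    and inj: "\<And>f. f \<in> apolar e d ps x y \<Longrightarrow> (\<forall>j<n. \<phi> j f = 0) \<Longrightarrow> f = (\<lambda>k. 0)"
    using dim unfolding dimle_def by blast
  define E where "E = (\<lambda>j. \<Sum>m\<in>bnd e d. sc (\<phi> j (dual_unit d m)) (mon m)) ` {..<n}"
  let ?S = "fvec ps t e v0 ` fidx ps e d \<union> E"
  have "g \<in> P3.span ?S" if g: "g \<in> hom d" for g
  proof (rule ccontr)
    assume "g \<notin> P3.span ?S"
    from exists_functional[OF this] obtain L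
      where L: "functional L" and L0': "\<forall>x\<in>?S. L x = 0" and Lg: "L g = 1"
      by (elim exE conjE)
    note L0 = L0'[rule_format]
    have kill: "L (mz ^ e * mon m) = 0" if "m \<in> tail e d" for m
    proof -
      have "(length ps, m) \<in> fidx ps e d" using that by (simp add: fidx_def blk_def)
      then have "L (fvec ps t e v0 (length ps, m)) = 0" by (intro L0) blast
      then show ?thesis using lf_z_power[OF z, of e] by (simp add: fvec_def mon_powers)
    qed
    have kill': "L (linform 1 (x k) (y k) ^ snd (ps ! k) * mon m) = 0"
      if "k < length ps" "snd (ps ! k) \<le> d" "m \<in> bnd e (d - snd (ps ! k))" for k m
    proof -
      have "(k, m) \<in> fidx ps e d" using that by (simp add: fidx_def blk_def)
      then have "L (fvec ps t e v0 (k, m)) = 0" by (intro L0) blast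
      then show ?thesis using that(1) pts by (simp add: fvec_def forms_nth)
    qed
    have "dual_family e d L \<in> apolar e d ps x y"
      unfolding apolar_def mem_Collect_eq
      by (intro conjI degb_dual_family allI impI vanish_dual_family L) (rule kill kill'; assumption)+
    moreover have "\<phi> j (dual_family e d L) = 0" if j: "j < n" for j
    proof -
      have "L (\<Sum>m\<in>bnd e d. sc (\<phi> j (dual_unit d m)) (mon m)) = 0"
        by (rule L0) (use j in \<open>auto simp: E_def\<close>)
      then show ?thesis
        unfolding dual_family_def lin_fun_sum[OF \<phi>[OF j] finite_bnd]
        by (simp add: functional_sum[OF L] functional_sc[OF L] mult.commute)
    qed
    ultimately have 0: "dual_family e d L = (\<lambda>k. 0)" using inj by blast
    have "L (mon m) = 0" if m: "m \<in> expos d" for m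
    proof (cases "m \<in> bnd e d")
      case True
      obtain a b c where abc: "m = (a, b, c)" by (cases m)
      have *: "c < e" "b + c \<le> d" "a = d - c - b" using True by (auto simp: abc bnd_def expos_def)
      have "coeff (dual_family e d L c) b = 0" by (simp add: 0)
      then show ?thesis using * by (auto simp: coeff_dual_family abc)
    next
      case False
      then obtain m' where "m' \<in> tail e d" "m = (0, 0, e) + m'" using m expos_split[of d e] by blast
      then show ?thesis using kill[of m'] by (simp add: mon_powers mon_mult)
    qed
    then have "L h = 0" if "h \<in> mon ` expos d" for h using that by blast
    from functional_span[OF L this g[unfolded hom_eq_span]] Lg show False by simp
  qed
  moreover have "finite E" "card E \<le> n"
    unfolding E_def using card_image_le[of "{..<n}"] by auto
  ultimately show ?thesis by blast
qed

subsection \<open>Bounding spaces of families\<close>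

lemma dimle_mono:
  assumes "dimle n V" "W \<subseteq> V" "n \<le> n'" shows "dimle n' W"
proof -
  obtain \<phi> where \<phi>: "\<And>j. j < n \<Longrightarrow> lin_fun (\<phi> j)"
    "\<And>f. f \<in> V \<Longrightarrow> (\<forall>j<n. \<phi> j f = 0) \<Longrightarrow> f = (\<lambda>k. 0)"
    using assms(1) unfolding dimle_def by blast
  define \<theta> where "\<theta> j = (if j < n then \<phi> j else (\<lambda>f. 0))" for j
  have "lin_fun (\<theta> j)" for j using \<phi>(1) by (simp add: \<theta>_def lin_fun_def)
  moreover have "f = (\<lambda>k. 0)" if f: "f \<in> W" and z: "\<forall>j<n'. \<theta> j f = 0" for f
  proof (rule \<phi>(2))
    have "\<phi> j f = 0" if "j < n" for j
      using z[rule_format, of j] that assms(3) by (simp add: \<theta>_def)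
    then show "\<forall>j<n. \<phi> j f = 0" by blast
  qed (use f assms(2) in blast)
  ultimately show ?thesis unfolding dimle_def by (intro exI[of _ \<theta>]) blast
qed

lemma dimle_zero: "V \<subseteq> {\<lambda>k. 0} \<Longrightarrow> dimle 0 V"
  unfolding dimle_def by auto

lemma dimle_transfer:
  assumes "dimle n W"
    and "\<And>f g. T (\<lambda>k. f k + g k) = (\<lambda>k. T f k + T g k)"
    and "\<And>c f. T (\<lambda>k. smult c (f k)) = (\<lambda>k. smult c (T f k))"
    and "\<And>f. f \<in> V \<Longrightarrow> T f \<in> W" and "\<And>f. f \<in> V \<Longrightarrow> T f = (\<lambda>k. 0) \<Longrightarrow> f = (\<lambda>k. 0)"
  shows "dimle n V"
proof -
  obtain \<phi> where \<phi>: "\<And>j. j < n \<Longrightarrow> lin_fun (\<phi> j)"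
    "\<And>f. f \<in> W \<Longrightarrow> (\<forall>j<n. \<phi> j f = 0) \<Longrightarrow> f = (\<lambda>k. 0)"
    using assms(1) unfolding dimle_def by blast
  have "lin_fun (\<lambda>f. \<phi> j (T f))" if "j < n" for j
    using \<phi>(1)[OF that] unfolding lin_fun_def assms(2,3) by blast
  then show ?thesis
    unfolding dimle_def using \<phi>(2) assms(4,5)
    by (intro exI[of _ "\<lambda>j f. \<phi> j (T f)"]) blast
qed

lemma dimle_add_conditions:
  assumes "dimle n {f \<in> V. \<forall>i<r. \<psi> i f = 0}" "\<And>i. i < r \<Longrightarrow> lin_fun (\<psi> i)"
  shows "dimle (n + r) V"
proof -
  obtain \<phi> where \<phi>: "\<And>j. j < n \<Longrightarrow> lin_fun (\<phi> j)"
    "\<And>f. f \<in> {f \<in> V. \<forall>i<r. \<psi> i f = 0} \<Longrightarrow> (\<forall>j<n. \<phi> j f = 0) \<Longrightarrow> f = (\<lambda>k. 0)"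
    using assms(1) unfolding dimle_def by blast
  define \<theta> where "\<theta> j = (if j < n then \<phi> j else \<psi> (j - n))" for j
  have "lin_fun (\<theta> j)" if "j < n + r" for j using that \<phi>(1) assms(2) by (auto simp: \<theta>_def)
  moreover have "f = (\<lambda>k. 0)" if "f \<in> V" and z: "\<forall>j<n + r. \<theta> j f = 0" for f
  proof (rule \<phi>(2))
    have "\<psi> i f = 0" if "i < r" for i using z[rule_format, of "n + i"] that by (simp add: \<theta>_def)
    then show "f \<in> {f \<in> V. \<forall>i<r. \<psi> i f = 0}" using that(1) by blast
    have "\<phi> j f = 0" if "j < n" for j using z[rule_format, of j] that by (simp add: \<theta>_def)
    then show "\<forall>j<n. \<phi> j f = 0" by blast
  qed
  ultimately show ?thesis unfolding dimle_def by (intro exI[of _ \<theta>]) blast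
qed

text \<open>Steinitz exchange: a functional that does not vanish on \<open>V\<close> replaces one of the given ones.\<close>
lemma dimle_exchange:
  fixes V :: "(nat \<Rightarrow> 'k::field poly) set"
  assumes "dimle n V" and sub: "\<And>c f g. f \<in> V \<Longrightarrow> g \<in> V \<Longrightarrow> (\<lambda>k. f k + smult c (g k)) \<in> V"
    and \<psi>: "lin_fun \<psi>" and v: "v \<in> V" "\<psi> v \<noteq> 0"
  shows "dimle (n - 1) {f \<in> V. \<psi> f = 0}"
proof -
  obtain \<phi> where \<phi>: "\<And>j. j < n \<Longrightarrow> lin_fun (\<phi> j)"
    and inj: "\<And>f. f \<in> V \<Longrightarrow> (\<forall>j<n. \<phi> j f = 0) \<Longrightarrow> f = (\<lambda>k. 0)"
    using assms(1) unfolding dimle_def by blast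
  have "v \<noteq> (\<lambda>k. 0)" using v(2) lin_fun_zero[OF \<psi>] by blast
  then obtain i where i: "i < n" "\<phi> i v \<noteq> 0" using inj[OF v(1)] by blast
  define s where "s j = (if j = i then n - 1 else j)" for j
  define r where "r j = \<phi> (s j) v / \<phi> i v" for j
  define \<theta> where "\<theta> j f = \<phi> (s j) f - r j * \<phi> i f" for j f
  have s: "s j < n" if "j < n - 1" for j using that by (auto simp: s_def)
  have "lin_fun (\<theta> j)" if "j < n - 1" for j
    using \<phi>[OF s[OF that]] \<phi>[OF i(1)] unfolding lin_fun_def \<theta>_def by (simp add: algebra_simps)
  moreover have "w = (\<lambda>k. 0)" if w: "w \<in> V" "\<psi> w = 0" and z: "\<forall>j<n - 1. \<theta> j w = 0" for w
  proof -
    define c where "c = - (\<phi> i w / \<phi> i v)"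
    define u where "u = (\<lambda>k. w k + smult c (v k))"
    have \<phi>u: "\<phi> j u = \<phi> j w + c * \<phi> j v" if "j < n" for j
      unfolding u_def by (simp add: lin_fun_add[OF \<phi>[OF that], of w] lin_fun_smult[OF \<phi>[OF that]])
    have "\<phi> j u = 0" if j: "j < n" for j
    proof (cases "j = i")
      case True
      then show ?thesis using \<phi>u[OF j] i(2) by (simp add: c_def)
    next
      case False
      obtain j' where j': "j' < n - 1" "s j' = j"
      proof (cases "j = n - 1")
        case True
        then have "i < n - 1" "s i = j" using False i(1) by (auto simp: s_def)
        then show ?thesis using that by blast
      next
        case neq: False
        then have "j < n - 1" "s j = j" using j False by (auto simp: s_def)
        then show ?thesis using that by blast
      qed
      then have "\<theta> j' w = 0" using z by blast
      then show ?thesis using \<phi>u[OF j] j'(2) by (simp add: \<theta>_def r_def c_def mult.commute)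
    qed
    moreover have "u \<in> V" unfolding u_def using sub w(1) v(1) by blast
    ultimately have u0: "u = (\<lambda>k. 0)" using inj by blast
    have "\<psi> u = \<psi> w + c * \<psi> v"
      unfolding u_def by (simp add: lin_fun_add[OF \<psi>, of w] lin_fun_smult[OF \<psi>])
    then have "c = 0" using u0 lin_fun_zero[OF \<psi>] w(2) v(2) by simp
    then show ?thesis using u0 by (simp add: u_def fun_eq_iff)
  qed
  ultimately show ?thesis unfolding dimle_def by (intro exI[of _ \<theta>]) blast
qed

subsection \<open>Divisibility by powers of linear polynomials\<close>

lemma lin_power_dvd_cancel:
  fixes Q h :: "'k::field poly"
  assumes "[:- x, 1:] ^ m dvd Q * h" "poly Q x \<noteq> 0"
  shows "[:- x, 1:] ^ m dvd h"
proof (cases "h = 0")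
  case False
  have "Q \<noteq> 0" using assms(2) by auto
  then have ne: "Q * h \<noteq> 0" using False by simp
  have "order x Q = 0" using assms(2) by (simp add: order_root)
  then have "order x (Q * h) = order x h" using order_mult[OF ne] by simp
  then show ?thesis using assms(1) ne False by (simp add: order_divides)
qed simp

lemma lin_power_dvd_reduce:
  fixes R T :: "'k::field poly"
  assumes "[:- x, 1:] ^ (n + m) dvd ([:- x, 1:] ^ n * R) * T" "poly R x \<noteq> 0"
  shows "[:- x, 1:] ^ m dvd T"
proof -
  have "[:- x, 1:] ^ n * [:- x, 1:] ^ m dvd [:- x, 1:] ^ n * (R * T)"
    using assms(1) by (simp only: power_add mult.assoc)
  then have "[:- x, 1:] ^ m dvd R * T" by (subst (asm) dvd_mult_cancel_left) simp
  then show ?thesis by (rule lin_power_dvd_cancel[OF _ assms(2)])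
qed

definition lin_prod :: "'i set \<Rightarrow> ('i \<Rightarrow> 'k::comm_ring_1) \<Rightarrow> ('i \<Rightarrow> nat) \<Rightarrow> 'k poly" where
  "lin_prod A x n = (\<Prod>k\<in>A. [:- x k, 1:] ^ n k)"

lemma poly_lin_prod: "finite A \<Longrightarrow> poly (lin_prod A x n) z = (\<Prod>k\<in>A. (z - x k) ^ n k)"
  by (simp add: lin_prod_def poly_prod)

lemma lin_prod_nonzero: "lin_prod A x n \<noteq> (0 :: 'k::field poly)"
  by (cases "finite A") (auto simp: lin_prod_def)

lemma degree_lin_prod: "degree (lin_prod A x n :: 'k::field poly) = sum n A"
proof (cases "finite A")
  case True
  then have "degree (lin_prod A x n) = (\<Sum>k\<in>A. degree ([:- x k, 1:] ^ n k))"
    unfolding lin_prod_def by (intro degree_prod_eq_sum_degree) auto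
  then show ?thesis by (simp add: degree_linear_power)
qed (simp add: lin_prod_def)

lemma lin_prod_remove:
  "finite A \<Longrightarrow> k \<in> A \<Longrightarrow> lin_prod A x n = [:- x k, 1:] ^ n k * lin_prod (A - {k}) x n"
  by (simp add: lin_prod_def prod.remove)

lemma poly_lin_prod_other:
  fixes x :: "'i \<Rightarrow> 'k::field"
  assumes "finite A" "\<And>i. i \<in> A \<Longrightarrow> n i > 0 \<Longrightarrow> z \<noteq> x i"
  shows "poly (lin_prod A x n) z \<noteq> 0"
proof -
  have "(z - x i) ^ n i \<noteq> 0" if "i \<in> A" for i
    using assms(2)[OF that] by (cases "n i") auto
  then show ?thesis using assms(1) by (simp add: poly_lin_prod)
qed

lemma lin_prod_dvd:
  fixes f :: "'k::field poly"
  assumes "finite A" "\<And>i j. i \<in> A \<Longrightarrow> j \<in> A \<Longrightarrow> n i > 0 \<Longrightarrow> n j > 0 \<Longrightarrow> x i = x j \<Longrightarrow> i = j"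
    and "\<And>k. k \<in> A \<Longrightarrow> [:- x k, 1:] ^ n k dvd f"
  shows "lin_prod A x n dvd f"
  using assms
proof (induction A rule: finite_induct)
  case (insert k A)
  have "lin_prod A x n dvd f"
  proof (rule insert.IH)
    fix i j assume "i \<in> A" "j \<in> A" "0 < n i" "0 < n j" "x i = x j"
    then show "i = j" using insert.prems(1) by simp
  qed (use insert.prems(2) in simp)
  then obtain h where h: "f = lin_prod A x n * h" by (elim dvdE)
  have "[:- x k, 1:] ^ n k dvd h"
  proof (cases "n k = 0")
    case False
    have "poly (lin_prod A x n) (x k) \<noteq> 0"
    proof (rule poly_lin_prod_other[OF insert.hyps(1)])
      fix i assume "i \<in> A" "0 < n i"
      then show "x k \<noteq> x i" using insert.prems(1)[of k i] insert.hyps(2) False by auto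
    qed
    moreover have "[:- x k, 1:] ^ n k dvd lin_prod A x n * h" using insert.prems(2)[of k] h by simp
    ultimately show ?thesis by (rule lin_power_dvd_cancel[rotated])
  qed simp
  then show ?case using insert.hyps h by (simp add: lin_prod_def mult.commute mult_dvd_mono)
qed (simp add: lin_prod_def)

text \<open>The bound is additive so that it also covers \<open>degree Q > N\<close>, where every
  coefficient of \<open>h\<close> is zero; this is the case of more conditions than
  dimensions.\<close>

lemma coeff_bound_mult:
  fixes Q h :: "'k::field poly"
  assumes "\<And>j. N < j + k \<Longrightarrow> coeff (Q * h) j = 0" "Q \<noteq> 0" "N < j + k + degree Q"
  shows "coeff h j = 0"
proof (rule ccontr)
  assume c: "coeff h j \<noteq> 0"
  then have "h \<noteq> 0" "j \<le> degree h" by (auto simp: le_degree)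
  then have "degree (Q * h) = degree Q + degree h" "Q * h \<noteq> 0"
    using assms(2) by (simp_all add: degree_mult_eq)
  moreover from this have "coeff (Q * h) (degree Q + degree h) \<noteq> 0"
    by (metis leading_coeff_0_iff)
  ultimately show False using assms(1)[of "degree Q + degree h"] assms(3) \<open>j \<le> degree h\<close> by simp
qed

lemma degbD: "degb e d f \<Longrightarrow> d < j + k \<Longrightarrow> coeff (f k) j = 0"
  and degb_high: "degb e d f \<Longrightarrow> e \<le> k \<Longrightarrow> f k = 0"
  by (simp_all add: degb_def)

lemma degb_div:
  fixes f h :: "nat \<Rightarrow> 'k::field poly"
  assumes "degb e d f" "\<And>k. f k = Q * h k" "Q \<noteq> 0" "degree Q \<le> d"
  shows "degb e (d - degree Q) h"
  unfolding degb_def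
proof (intro conjI allI impI)
  fix k assume "e \<le> k"
  then show "h k = 0" using degb_high[OF assms(1)] assms(2,3) by (metis mult_eq_0_iff)
next
  fix k j assume "d - degree Q < j + k"
  then have j: "d < j + k + degree Q" using assms(4) by simp
  have "coeff (Q * h k) i = 0" if "d < i + k" for i
    using degbD[OF assms(1) that] by (simp add: assms(2))
  from coeff_bound_mult[OF this assms(3) j] show "coeff (h k) j = 0" .
qed

lemma taylor_mult: "taylor e y l (\<lambda>k. Q * h k) = Q * taylor e y l h"
  by (simp add: taylor_def sum_distrib_left)

lemma taylor_add: "taylor e y l (\<lambda>k. f k + g k) = taylor e y l f + taylor e y l g"
  and taylor_smult: "taylor e y l (\<lambda>k. smult c (f k)) = smult c (taylor e y l f)"
  by (simp_all add: taylor_def poly_eq_iff coeff_sum sum.distrib distrib_left sum_distrib_left mult_ac)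

lemma taylor_1: "taylor (Suc 0) y 0 f = f 0"
  and taylor_2: "taylor 2 y 0 f = f 0 + smult y (f 1)" "taylor 2 y (Suc 0) f = f 1"
  and taylor_3: "taylor 3 y 0 f = f 0 + smult y (f 1) + smult (y\<^sup>2) (f 2)"
    "taylor 3 y (Suc 0) f = f 1 + smult (2 * y) (f 2)" "taylor 3 y 2 f = f 2"
  by (simp_all add: taylor_def numeral_2_eq_2 numeral_3_eq_3 algebra_simps)

lemma all_less_2: "(\<forall>l<2. P l) \<longleftrightarrow> P 0 \<and> P (Suc 0)"
  and all_less_3: "(\<forall>l<3. P l) \<longleftrightarrow> P 0 \<and> P (Suc 0) \<and> P (2::nat)"
  by (auto simp: numeral_2_eq_2 numeral_3_eq_3 less_Suc_eq)

lemma lin_dvd_iff: "[:- x, 1:] dvd p \<longleftrightarrow> poly p x = 0" for x :: "'k::field"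
  by (simp add: poly_eq_0_iff_dvd)

subsection \<open>Multiplication by a form and by its square\<close>

lemma div_lin: "(p + q) div r = p div r + q div (r :: 'k::field poly)"
    "smult c p div r = smult c (p div r)"
  by (simp_all add: poly_div_add_left div_smult_left)

lemma dimle_univariate: "dimle (Suc N) {f. degb (Suc 0) N f}"
proof -
  have "f = (\<lambda>k. 0)" if f: "degb (Suc 0) N f" and z: "\<forall>j<Suc N. coeff (f 0) j = 0"
    for f :: "nat \<Rightarrow> 'a poly"
  proof
    fix k
    show "f k = 0"
    proof (cases k)
      case 0
      have "coeff (f 0) j = 0" for j using z degbD[OF f, of j 0] by (cases "j < Suc N") auto
      then show ?thesis using 0 by (simp add: poly_eq_iff)
    qed (use degb_high[OF f] in simp)
  qed
  then show ?thesis
    unfolding dimle_def by (intro exI[of _ "\<lambda>j f. coeff (f 0) j"]) (auto simp: lin_fun_def)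
qed

definition mult_at :: "nat \<Rightarrow> (nat \<times> nat) list \<Rightarrow> nat \<Rightarrow> nat" where
  "mult_at d ps k = d + 1 - snd (ps ! k)"

lemma apolar_iff: "f \<in> apolar e d ps x y \<longleftrightarrow> degb e d f \<and>
    (\<forall>k<length ps. vanish e f (x k) (y k) (mult_at d ps k))"
  by (simp add: apolar_def mult_at_def)

text \<open>For \<open>e = 1\<close> a family is a single polynomial of degree at most
  \<open>d\<close> and the conditions say that \<open>Q\<close> divides it: Hermite interpolation at
  distinct nodes.\<close>

lemma dimle_apolar_1:
  fixes x y :: "nat \<Rightarrow> 'k::field"
  assumes "inj_on x {..<length ps}"
  shows "dimle (d + 1 - (\<Sum>k<length ps. mult_at d ps k)) (apolar (Suc 0) d ps x y)"
proof -
  define Q where "Q = lin_prod {..<length ps} x (mult_at d ps)"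
  have Q0: "Q \<noteq> 0" and Qd: "degree Q = (\<Sum>k<length ps. mult_at d ps k)"
    by (simp_all add: Q_def lin_prod_nonzero degree_lin_prod)
  have dv: "Q dvd f 0" if "f \<in> apolar (Suc 0) d ps x y" for f
    unfolding Q_def using that assms
    by (intro lin_prod_dvd) (auto simp: apolar_iff vanish_def taylor_1 inj_on_def)
  have eq: "f k = Q * (f k div Q)" if "f \<in> apolar (Suc 0) d ps x y" for f k
    using dv[OF that] degb_high[of "Suc 0" d f k] that by (cases k) (auto simp: apolar_iff)
  show ?thesis
  proof (cases "degree Q \<le> d")
    case True
    have "dimle (Suc (d - degree Q)) (apolar (Suc 0) d ps x y)"
    proof (rule dimle_transfer[OF dimle_univariate, where T = "\<lambda>f k. f k div Q"])
      fix f assume f: "f \<in> apolar (Suc 0) d ps x y"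
      then have "degb (Suc 0) d f" by (simp add: apolar_iff)
      then show "(\<lambda>k. f k div Q) \<in> {f. degb (Suc 0) (d - degree Q) f}"
        using degb_div[where h = "\<lambda>k. f k div Q", OF _ eq[OF f] Q0 True] by blast
      show "f = (\<lambda>k. 0)" if "(\<lambda>k. f k div Q) = (\<lambda>k. 0)"
        using eq[OF f] that by (metis mult_zero_right ext)
    qed (simp_all add: div_lin)
    then show ?thesis using True by (simp add: Qd Suc_diff_le)
  next
    case False
    have "f = (\<lambda>k. 0)" if f: "f \<in> apolar (Suc 0) d ps x y" for f
    proof
      fix k
      have db: "degb (Suc 0) d f" using f by (simp add: apolar_iff)
      have "coeff (f k div Q) j = 0" for j
      proof (rule coeff_bound_mult[of d k Q])
        show "coeff (Q * (f k div Q)) j = 0" if "d < j + k" for j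
          using degbD[OF db that] eq[OF f, of k] by simp
      qed (use Q0 False in auto)
      then have "f k div Q = 0" by (simp add: poly_eq_iff)
      then show "f k = 0" using eq[OF f, of k] by simp
    qed
    then have "apolar (Suc 0) d ps x y \<subseteq> {\<lambda>k. 0}" by blast
    then show ?thesis by (rule dimle_mono[OF dimle_zero]) simp_all
  qed
qed

text \<open>With \<open>y k = x k ^ (D + 1)\<close> the family \<open>h\<close> turns into the single polynomial
  \<open>h 0 + t ^ (D + 1) * h 1\<close> without loss of information.\<close>
lemma dimle_apolar_2:
  fixes x :: "nat \<Rightarrow> 'k::field"
  assumes x: "inj_on x {..<length ps}" and D: "d = D + (\<Sum>k<length ps. mult_at d ps k - 1)"
  shows "dimle (2 * D + 1 - card {k. k < length ps \<and> 0 < mult_at d ps k})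
    (apolar 2 d ps x (\<lambda>k. x k ^ (D + 1)))"
proof -
  define n where "n k = mult_at d ps k - 1" for k
  define Q where "Q = lin_prod {..<length ps} x n"
  define J where "J = {k. k < length ps \<and> 0 < mult_at d ps k}"
  define Q' where "Q' = lin_prod J x (\<lambda>k. 1)"
  define V where "V = apolar 2 d ps x (\<lambda>k. x k ^ (D + 1))"
  define H where "H f = f 0 div Q + monom 1 (D + 1) * (f 1 div Q)" for f :: "nat \<Rightarrow> 'k poly"
  have fJ: "finite J" by (simp add: J_def)
  have Q0: "Q \<noteq> 0" and Qd: "degree Q = d - D" and Dd: "D \<le> d"
    using D by (simp_all add: Q_def lin_prod_nonzero degree_lin_prod n_def)
  have Q'0: "Q' \<noteq> 0" and Q'd: "degree Q' = card J"
    by (simp_all add: Q'_def lin_prod_nonzero degree_lin_prod)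
  have van: "[:- x k, 1:] ^ mult_at d ps k dvd f 0 + smult (x k ^ (D + 1)) (f 1)"
    "[:- x k, 1:] ^ n k dvd f 1" if "f \<in> V" "k < length ps" for f k
    using that unfolding V_def apolar_iff vanish_def all_less_2 taylor_2 n_def by auto
  have van0: "[:- x k, 1:] ^ n k dvd f 0" if "f \<in> V" "k < length ps" for f k
  proof -
    have "[:- x k, 1:] ^ n k dvd f 0 + smult (x k ^ (D + 1)) (f 1)"
      using van(1)[OF that] by (rule dvd_trans[rotated]) (simp add: n_def le_imp_power_dvd)
    then show ?thesis using van(2)[OF that] by (metis dvd_add_left_iff dvd_smult)
  qed
  have eq: "f k = Q * (f k div Q)" if f: "f \<in> V" for f k
  proof -
    have "Q dvd f 0" "Q dvd f 1"
      unfolding Q_def using x van(2)[OF f] van0[OF f]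
      by (auto intro!: lin_prod_dvd simp: inj_on_def)
    moreover have "f k = 0" if "2 \<le> k" using f that by (auto simp: V_def apolar_iff degb_high)
    ultimately show ?thesis by (cases "k = 0"; cases "k = 1") auto
  qed
  have db: "degb 2 D (\<lambda>k. f k div Q)" if f: "f \<in> V" for f
    using degb_div[where h = "\<lambda>k. f k div Q", OF _ eq[OF f] Q0, of 2 d] f Qd Dd
    by (simp add: V_def apolar_iff)
  have "Q' dvd H f" if f: "f \<in> V" for f
    unfolding Q'_def
  proof (rule lin_prod_dvd[OF fJ])
    fix k assume k: "k \<in> J"
    have kl: "k < length ps" "mult_at d ps k = Suc (n k)" using k by (auto simp: J_def n_def)
    define T where "T = f 0 div Q + smult (x k ^ (D + 1)) (f 1 div Q)"
    define R where "R = lin_prod ({..<length ps} - {k}) x n"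
    have QT: "Q * T = f 0 + smult (x k ^ (D + 1)) (f 1)"
      using eq[OF f, of 0] eq[OF f, of 1] by (simp add: T_def distrib_left)
    have QR: "Q = [:- x k, 1:] ^ n k * R"
      unfolding Q_def R_def using kl by (intro lin_prod_remove) auto
    have "[:- x k, 1:] ^ 1 dvd T"
    proof (rule lin_power_dvd_reduce)
      show "[:- x k, 1:] ^ (n k + 1) dvd [:- x k, 1:] ^ n k * R * T"
        using van(1)[OF f kl(1)] unfolding kl(2) QT[symmetric] QR by simp
      show "poly R (x k) \<noteq> 0"
        unfolding R_def using x kl by (intro poly_lin_prod_other) (auto simp: inj_on_def)
    qed
    then have "poly T (x k) = 0" by (simp add: lin_dvd_iff)
    then have "poly (H f) (x k) = 0" by (simp add: T_def H_def poly_monom)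
    then show "[:- x k, 1:] ^ 1 dvd H f" by (simp add: lin_dvd_iff)
  next
    fix i j assume "i \<in> J" "j \<in> J" "x i = x j"
    then show "i = j" using x by (auto simp: J_def inj_on_def)
  qed
  then have HQ: "H f = Q' * (H f div Q')" if "f \<in> V" for f using that by simp
  \<comment> \<open>After division by \<open>Q\<close> the first polynomial has degree at most
    \<open>D\<close>, so the summands of \<open>H f\<close> occupy disjoint ranges of exponents. The
    second has degree at most \<open>D - 1\<close> or is zero, whence the bound \<open>2 * D\<close>
    on the degree of \<open>H f\<close>.\<close>
  have cH: "coeff (H f) j = (if j \<le> D then coeff (f 0 div Q) j else coeff (f 1 div Q) (j - (D + 1)))"
    if f: "f \<in> V" for f j
    using degbD[OF db[OF f], of j 0] by (auto simp: H_def coeff_monom_mult)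
  have Hbound: "coeff (H f) j = 0" if "f \<in> V" "2 * D < j" for f j
    using cH[OF that(1)] degbD[OF db[OF that(1)], of "j - (D + 1)" 1] that(2) by auto
  have H0: "f = (\<lambda>k. 0)" if f: "f \<in> V" and z: "H f = 0" for f
  proof -
    have "coeff (f 0 div Q) j = 0" for j
      using cH[OF f, of j] degbD[OF db[OF f], of j 0] z by (cases "j \<le> D") auto
    moreover have "coeff (f 1 div Q) j = 0" for j using cH[OF f, of "j + (D + 1)"] z by simp
    ultimately have "f 0 div Q = 0" "f 1 div Q = 0" by (simp_all add: poly_eq_iff)
    then have "f 0 = 0" "f 1 = 0" using eq[OF f, of 0] eq[OF f, of 1] by (simp_all only: mult_zero_right)
    moreover have "f k = 0" if "2 \<le> k" for k using f that by (auto simp: V_def apolar_iff degb_high)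
    ultimately have "f k = 0" for k by (cases "k = 0"; cases "k = 1") auto
    then show ?thesis by blast
  qed
  have "dimle (2 * D + 1 - card J) V"
  proof (cases "card J \<le> 2 * D")
    case True
    let ?T = "\<lambda>f k. if k = 0 then H f div Q' else (0 :: 'k poly)"
    have "dimle (Suc (2 * D - card J)) V"
    proof (rule dimle_transfer[OF dimle_univariate, where T = ?T])
      fix f assume f: "f \<in> V"
      have "coeff (H f div Q') j = 0" if "2 * D - card J < j" for j
        by (rule coeff_bound_mult[of "2 * D" 0 Q'])
           (use that True Q'0 Q'd HQ[OF f] Hbound[OF f] in auto)
      then show "?T f \<in> {f. degb (Suc 0) (2 * D - card J) f}" by (auto simp: degb_def)
      show "f = (\<lambda>k. 0)" if "?T f = (\<lambda>k. 0)"
      proof -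
        have "H f div Q' = 0" using fun_cong[OF that, of 0] by simp
        then show ?thesis using HQ[OF f] H0[OF f] by simp
      qed
    qed (auto simp: H_def div_lin fun_eq_iff distrib_left smult_add_right algebra_simps)
    then show ?thesis using True by (simp add: Suc_diff_le)
  next
    case False
    have "f = (\<lambda>k. 0)" if f: "f \<in> V" for f
    proof (rule H0[OF f])
      have "coeff (H f div Q') j = 0" for j
        by (rule coeff_bound_mult[of "2 * D" 0 Q'])
           (use False Q'0 Q'd HQ[OF f] Hbound[OF f] in auto)
      then have "H f div Q' = 0" by (simp add: poly_eq_iff)
      then show "H f = 0" using HQ[OF f] by simp
    qed
    then have "V \<subseteq> {\<lambda>k. 0}" by blast
    then show ?thesis by (rule dimle_mono[OF dimle_zero]) simp_all
  qed
  then show ?thesis by (simp add: V_def J_def)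
qed

subsection \<open>Multiplication by the cube of a form: double points\<close>

text \<open>Curves of degree \<open>D\<close> with a point of multiplicity \<open>D - 2\<close> at infinity and double points at \<open>P\<close>;
  \<open>conf TYPE('k) D n K\<close> says that for some \<open>n\<close> double points they form a space of dimension at most \<open>K\<close>.\<close>
definition dbl :: "nat \<Rightarrow> ('k::field \<times> 'k) set \<Rightarrow> (nat \<Rightarrow> 'k poly) set" where
  "dbl D P = {h. degb 3 D h \<and> (\<forall>p\<in>P. vanish 3 h (fst p) (snd p) 2)}"

definition conf :: "'k::field itself \<Rightarrow> nat \<Rightarrow> nat \<Rightarrow> nat \<Rightarrow> bool" where
  "conf TYPE('k) D n K \<longleftrightarrow> (\<exists>P :: ('k \<times> 'k) set. finite P \<and> card P = n \<and> inj_on fst P \<and> dimle K (dbl D P))"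

lemma vanish_3_2: "vanish 3 h x y 2 \<longleftrightarrow>
    [:- x, 1:]\<^sup>2 dvd taylor 3 y 0 h \<and> poly (taylor 3 y (Suc 0) h) x = 0" for x :: "'k::field"
  by (simp add: vanish_def all_less_3 lin_dvd_iff)

lemma family_3_eq_0:
  fixes f :: "nat \<Rightarrow> 'k::comm_ring_1 poly"
  shows "f 0 = 0 \<Longrightarrow> f 1 = 0 \<Longrightarrow> f 2 = 0 \<Longrightarrow> degb 3 D f \<Longrightarrow> f = (\<lambda>k. 0)"
proof
  fix k :: nat assume "f 0 = 0" "f 1 = 0" "f 2 = 0" "degb 3 D f"
  moreover have "k = 0 \<or> k = 1 \<or> k = 2 \<or> 3 \<le> k" by linarith
  ultimately show "f k = 0" using degb_high[of 3 D f k] by metis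
qed

text \<open>The Cremona step divides by the second coordinates of the points. The shift of the
  second variable by \<open>c\<close>, realised on families by \<open>T\<close>, makes them nonzero
  and preserves degrees and multiplicities.\<close>

lemma conf_nonzero:
  fixes P :: "('k::field_char_0 \<times> 'k) set"
  assumes "finite P" "inj_on fst P" "dimle K (dbl D P)"
  shows "\<exists>P' :: ('k \<times> 'k) set. finite P' \<and> card P' = card P \<and> inj_on fst P' \<and>
    (\<forall>p\<in>P'. snd p \<noteq> 0) \<and> dimle K (dbl D P')"
proof -
  obtain c where c: "c \<notin> (\<lambda>p. - snd p) ` P"
    using ex_new_if_finite[OF infinite_UNIV_char_0 finite_imageI[OF assms(1)]] by blast
  define s where "s p = (fst p, snd p + c)" for p :: "'k \<times> 'k"
  have inj: "inj_on s P" by (rule inj_onI) (simp add: s_def prod_eq_iff)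
  define T where "T f = (\<lambda>k::nat. if k = 0 then f 0 + smult c (f 1) + smult (c\<^sup>2) (f 2)
    else if k = 1 then f 1 + smult (2 * c) (f 2) else if k = 2 then f 2 else 0)"
    for f :: "nat \<Rightarrow> 'k poly"
  have T_simps: "T f 0 = f 0 + smult c (f 1) + smult (c\<^sup>2) (f 2)" "T f 1 = f 1 + smult (2 * c) (f 2)"
    "T f 2 = f 2" for f
    by (simp_all add: T_def)
  have tay: "taylor 3 y 0 (T f) = taylor 3 (y + c) 0 f"
    "taylor 3 y (Suc 0) (T f) = taylor 3 (y + c) (Suc 0) f" for y f
    using T_simps[of f]
    by (simp_all add: taylor_3 poly_eq_iff power2_eq_square algebra_simps)
  have "dimle K (dbl D (s ` P))"
  proof (rule dimle_transfer[OF assms(3), where T = T])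
    fix f assume f: "f \<in> dbl D (s ` P)"
    then have db: "degb 3 D f" by (simp add: dbl_def)
    have "degb 3 D (T f)"
      using degb_high[OF db] degbD[OF db] unfolding degb_def T_def by auto
    moreover have "vanish 3 (T f) (fst p) (snd p) 2" if "p \<in> P" for p
    proof -
      have "vanish 3 f (fst (s p)) (snd (s p)) 2" using f that by (simp add: dbl_def)
      then show ?thesis by (simp add: vanish_3_2 tay s_def)
    qed
    ultimately show "T f \<in> dbl D P" by (simp add: dbl_def)
    show "f = (\<lambda>k. 0)" if z: "T f = (\<lambda>k. 0)"
    proof -
      have "f 2 = 0" "f 1 = 0" "f 0 = 0" using T_simps[of f] by (simp_all add: z)
      then show ?thesis using db by (intro family_3_eq_0)
    qed
  qed (auto simp: T_def fun_eq_iff smult_add_right algebra_simps)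
  moreover have "inj_on fst (s ` P)" using assms(2) by (auto simp: inj_on_def s_def)
  moreover have "\<forall>p\<in>s ` P. snd p \<noteq> 0"
  proof
    fix p assume "p \<in> s ` P"
    then obtain q where q: "q \<in> P" "snd p = snd q + c" by (auto simp: s_def)
    have "c \<noteq> - snd q" using c q(1) by blast
    then show "snd p \<noteq> 0" using q(2) by (simp add: eq_neg_iff_add_eq_0 add.commute)
  qed
  ultimately show ?thesis using assms(1) inj
    by (intro exI[of _ "s ` P"]) (simp add: card_image)
qed

text \<open>The quadratic Cremona transformation based at the point of multiplicity \<open>D - 2\<close> and at two
  double points, written as the elementary transformation \<open>y \<mapsto> q / y\<close>.\<close>
lemma conf_step:
  assumes "conf TYPE('k::field_char_0) D n K"
  shows "conf TYPE('k) (D + 2) (n + 2) K"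
proof -
  obtain P0 :: "('k \<times> 'k) set" where "finite P0" "card P0 = n" "inj_on fst P0" "dimle K (dbl D P0)"
    using assms unfolding conf_def by blast
  then obtain P :: "('k \<times> 'k) set" where P: "finite P" "card P = n" "inj_on fst P"
      "\<forall>p\<in>P. snd p \<noteq> 0" "dimle K (dbl D P)"
    using conf_nonzero by metis
  obtain a where a: "a \<notin> fst ` P"
    using ex_new_if_finite[OF infinite_UNIV_char_0 finite_imageI[OF P(1)]] by blast
  obtain b where b: "b \<notin> insert a (fst ` P)"
    using ex_new_if_finite[OF infinite_UNIV_char_0, of "insert a (fst ` P)"] P(1) by auto
  define q where "q = [:- a, 1:] * [:- b, 1:]"
  have q0: "q \<noteq> 0" and dq: "degree q = 2" by (simp_all add: q_def degree_mult_eq)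
  define s where "s p = (fst p, poly q (fst p) / snd p)" for p :: "'k \<times> 'k"
  define P' where "P' = insert (a, 0) (insert (b, 0) (s ` P))"
  have inj: "inj_on s P" using P(3) by (auto simp: inj_on_def s_def)
  have fst_s: "fst (s p) = fst p" for p by (simp add: s_def)
  have new: "(z, w) \<notin> s ` P" if "z \<notin> fst ` P" for z w
  proof
    assume "(z, w) \<in> s ` P"
    then obtain p where "p \<in> P" "(z, w) = s p" by blast
    then show False using that by (simp add: s_def)
  qed
  have "(b, 0) \<notin> s ` P" "(a, 0) \<notin> insert (b, 0) (s ` P)"
    using new[of b 0] new[of a 0] a b by auto
  then have card: "card P' = n + 2" using P(1,2) inj by (simp add: P'_def card_image)
  have inj': "inj_on fst P'"
    unfolding P'_def
  proof (intro inj_on_insert[THEN iffD2] conjI)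
    show "inj_on fst (s ` P)" using P(3) by (auto simp: inj_on_def s_def)
  qed (use a b in \<open>force simp: s_def\<close>)+
  \<comment> \<open>As a bivariate polynomial, \<open>T g\<close> is
    \<open>y ^ 2 * g (s, q / y) / q ^ 2\<close>. The substitution reverses the coefficients, and the
    double points at \<open>(a, 0)\<close> and \<open>(b, 0)\<close> make the divisions
    exact.\<close>
  define T where "T g = (\<lambda>k::nat. if k = 0 then g 2 else if k = 1 then g 1 div q
    else if k = 2 then g 0 div q\<^sup>2 else 0)"
    for g :: "nat \<Rightarrow> 'k poly"
  have dv: "q\<^sup>2 dvd g 0" "q dvd g 1" if g: "g \<in> dbl (D + 2) P'" for g
  proof -
    have ab: "poly [:- a, 1:] b \<noteq> 0" using b by simp
    have v: "vanish 3 g a 0 2" "vanish 3 g b 0 2" using g by (simp_all add: dbl_def P'_def)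
    have "[:- a, 1:]\<^sup>2 dvd g 0" using v(1) by (simp add: vanish_3_2 taylor_3)
    then obtain u where u: "g 0 = [:- a, 1:]\<^sup>2 * u" by (elim dvdE)
    have "[:- b, 1:]\<^sup>2 dvd [:- a, 1:]\<^sup>2 * u" using v(2) by (simp add: vanish_3_2 taylor_3 u)
    then have "[:- b, 1:]\<^sup>2 dvd u" by (rule lin_power_dvd_cancel) (use ab in simp)
    then show "q\<^sup>2 dvd g 0" unfolding u q_def power_mult_distrib by (rule mult_dvd_mono[OF dvd_refl])
    have "[:- a, 1:] dvd g 1" using v(1) by (simp add: vanish_3_2 taylor_3 lin_dvd_iff)
    then obtain w where w: "g 1 = [:- a, 1:] * w" by (elim dvdE)
    have "poly (g 1) b = 0" using v(2) by (simp add: vanish_3_2 taylor_3)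
    then have "poly w b = 0" unfolding w using ab by simp
    then have "[:- b, 1:] dvd w" by (simp only: lin_dvd_iff)
    then show "q dvd g 1" unfolding w q_def by (rule mult_dvd_mono[OF dvd_refl])
  qed
  have "dimle K (dbl (D + 2) P')"
  proof (rule dimle_transfer[OF P(5), where T = T])
    fix g assume g: "g \<in> dbl (D + 2) P'"
    then have db: "degb 3 (D + 2) g" by (simp add: dbl_def)
    define h where "h = T g"
    have g_eq: "g 0 = q\<^sup>2 * h 2" "g 1 = q * h 1" "g 2 = h 0"
      using dv[OF g] by (simp_all add: h_def T_def)
    have high: "h k = 0" if "3 \<le> k" for k using that by (simp add: h_def T_def)
    have low: "coeff (h k) j = 0" if j: "D < j + k" for k j
    proof -
      consider "k = 0" | "k = 1" | "k = 2" | "3 \<le> k" by linarith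
      then show ?thesis
      proof cases
        case 1
        then show ?thesis using degbD[OF db, of j 2] j g_eq(3) by simp
      next
        case 2
        have c: "coeff (q * h 1) i = 0" if "D + 2 < i + 1" for i
          using degbD[OF db that] g_eq(2) by simp
        have "D + 2 < j + 1 + degree q" using 2 j dq by simp
        from coeff_bound_mult[OF c q0 this] show ?thesis using 2 by simp
      next
        case 3
        have c: "coeff (q\<^sup>2 * h 2) i = 0" if "D + 2 < i + 0" for i
          using degbD[OF db that] g_eq(1) by simp
        have "D + 2 < j + 0 + degree (q\<^sup>2)" "q\<^sup>2 \<noteq> 0"
          using 3 j dq q0 by (simp_all add: degree_power_eq)
        from coeff_bound_mult[OF c this(2,1)] show ?thesis using 3 by simp
      qed (simp add: high)
    qed
    have van: "vanish 3 h (fst p) (snd p) 2" if p: "p \<in> P" for p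
    proof -
      define x where "x = fst p"
      define w where "w = snd p"
      define Y where "Y = poly q x / w"
      define T0 where "T0 = h 0 + smult w (h 1) + smult (w\<^sup>2) (h 2)"
      define T1 where "T1 = h 1 + smult (2 * w) (h 2)"
      define \<delta> where "\<delta> = q - [:poly q x:]"
      have w: "w \<noteq> 0" using P(4) p by (simp add: w_def)
      have "x \<noteq> a" "x \<noteq> b" using a b p by (auto simp: x_def)
      then have qx: "poly q x \<noteq> 0" unfolding q_def poly_mult by simp
      then have Y: "Y \<noteq> 0" "poly q x = w * Y" using w by (simp_all add: Y_def)
      have "vanish 3 g (fst (s p)) (snd (s p)) 2" using g p by (simp add: dbl_def P'_def)
      then have A: "[:- x, 1:]\<^sup>2 dvd g 0 + smult Y (g 1) + smult (Y\<^sup>2) (g 2)"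
        and B: "poly (g 1) x + 2 * Y * poly (g 2) x = 0"
        by (simp_all add: vanish_3_2 taylor_3 s_def x_def Y_def w_def)
      have \<delta>: "[:- x, 1:] dvd \<delta>" by (simp add: \<delta>_def lin_dvd_iff)
      have q_eq: "q = [:w * Y:] + \<delta>" by (simp add: \<delta>_def Y(2))
      \<comment> \<open>Expansion around \<open>q = w * Y + \<delta>\<close>, where
        \<open>\<delta>\<close> vanishes at \<open>x\<close>. Once \<open>T1\<close> also vanishes
        at \<open>x\<close>, everything except the \<open>T0\<close> term is divisible by the square
        of \<open>s - x\<close>.\<close>
      have expand: "g 0 + smult Y (g 1) + smult (Y\<^sup>2) (g 2) =
          smult (Y\<^sup>2) T0 + (\<delta> * smult Y T1 + \<delta>\<^sup>2 * h 2)"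
        unfolding g_eq T0_def T1_def
        by (subst (1 2) q_eq, rule poly_eq_poly_eq_iff[THEN iffD1], rule ext)
           (simp add: power2_eq_square algebra_simps)
      have "poly (g 0 + smult Y (g 1) + smult (Y\<^sup>2) (g 2)) x = 0"
        unfolding lin_dvd_iff[symmetric] by (rule dvd_trans[OF _ A]) (simp only: power2_eq_square dvd_triv_left)
      moreover have "poly \<delta> x = 0" using \<delta> by (simp only: lin_dvd_iff)
      ultimately have "Y\<^sup>2 * poly T0 x = 0" unfolding expand by simp
      then have t0: "poly T0 x = 0" using Y(1) by simp
      \<comment> \<open>Twice \<open>poly T0 x = 0\<close> minus the bracket obtained here is
        \<open>w * poly T1 x = 0\<close>.\<close>
      have "Y * (w * poly (h 1) x + 2 * poly (h 0) x) = 0"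
        using B unfolding g_eq poly_mult Y(2) by (simp add: algebra_simps)
      then have "w * poly (h 1) x + 2 * poly (h 0) x = 0" using Y(1) by simp
      moreover have "poly (h 0) x + w * poly (h 1) x + w\<^sup>2 * poly (h 2) x = 0"
        using t0 by (simp add: T0_def)
      ultimately have "w * (poly (h 1) x + 2 * w * poly (h 2) x) = 0" by algebra
      then have t1: "poly T1 x = 0" using w by (simp add: T1_def)
      then have "[:- x, 1:] dvd T1" by (simp only: lin_dvd_iff)
      then have "[:- x, 1:]\<^sup>2 dvd \<delta> * smult Y T1 + \<delta>\<^sup>2 * h 2"
        unfolding power2_eq_square using \<delta>
        by (intro dvd_add mult_dvd_mono dvd_mult2 dvd_smult)
      then have "[:- x, 1:]\<^sup>2 dvd smult (Y\<^sup>2) T0"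
        using A unfolding expand by (simp only: dvd_add_left_iff)
      then have "[:- x, 1:]\<^sup>2 dvd T0" using Y(1) by (simp add: dvd_smult_iff)
      then show ?thesis using t1 by (simp add: vanish_3_2 taylor_3 T0_def T1_def x_def w_def)
    qed
    show "T g \<in> dbl D P"
      using high low van by (simp add: dbl_def degb_def h_def)
    show "g = (\<lambda>k. 0)" if "T g = (\<lambda>k. 0)"
    proof (rule family_3_eq_0[OF _ _ _ db])
      show "g 0 = 0" "g 1 = 0" "g 2 = 0" using g_eq that by (simp_all add: h_def)
    qed
  qed (auto simp: T_def fun_eq_iff div_lin)
  moreover have "finite P'" using P(1) by (simp add: P'_def)
  ultimately show ?thesis unfolding conf_def using card inj' by blast
qed

lemma conf_iterate: "conf TYPE('k::field_char_0) D n K \<Longrightarrow> conf TYPE('k) (D + 2 * r) (n + 2 * r) K"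
proof (induction r)
  case (Suc r)
  then show ?case using conf_step[of "D + 2 * r" "n + 2 * r" K] by (simp add: add.commute)
qed simp

section \<open>Dimension bounds for at most \<open>D\<close> double points in degree
  \<open>D\<close>\<close>

lemma dimle_coeffs:
  assumes "\<And>h. h \<in> V \<Longrightarrow> (\<forall>i<length ks. coeff (h (fst (ks ! i))) (snd (ks ! i)) = 0) \<Longrightarrow> h = (\<lambda>k. 0)"
  shows "dimle (length ks) V"
  unfolding dimle_def using assms
  by (intro exI[of _ "\<lambda>i h. coeff (h (fst (ks ! i))) (snd (ks ! i))"]) (auto simp: lin_fun_def)

lemma coeff_lin_power_dvd:
  fixes p :: "'k::field poly"
  assumes "[:- 0, 1:] ^ m dvd p" "j < m" shows "coeff p j = 0"
proof -
  have "[:- 0, 1:] ^ m = (monom 1 m :: 'k poly)" by (simp add: monom_altdef)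
  then show ?thesis using assms by (auto simp: coeff_monom_mult elim: dvdE)
qed

text \<open>Starting points for the Cremona step, one for each parity, with the number of double
  points equal to the degree or one less. For one double point in degree 1 the space is zero; the
  weaker bound 1 treats both parities alike.\<close>

lemma conf_base:
  "conf TYPE('k::field_char_0) 0 0 1" "conf TYPE('k) 1 0 3" "conf TYPE('k) 1 1 1" "conf TYPE('k) 2 1 3"
proof -
  have zero: "h = (\<lambda>k. 0)" if db: "degb 3 D h" and D: "D \<le> 2"
    and c: "\<And>k j. k < 3 \<Longrightarrow> j + k \<le> D \<Longrightarrow> coeff (h k) j = 0" for D and h :: "nat \<Rightarrow> 'k poly"
  proof -
    have "h k = 0" if "k < 3" for k
    proof (rule poly_eqI)
      fix j show "coeff (h k) j = coeff 0 j"
        using c[OF that, of j] degbD[OF db, of j k] by (cases "j + k \<le> D") auto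
    qed
    then show ?thesis using db by (intro family_3_eq_0[of h D]) auto
  qed
  have pt: "coeff (h 0) 0 = 0" "coeff (h 0) 1 = 0" "coeff (h 1) 0 = 0"
    if "h \<in> dbl D {(0, 0)}" for D and h :: "nat \<Rightarrow> 'k poly"
  proof -
    have v: "vanish 3 h 0 0 2" using that by (simp add: dbl_def)
    then show "coeff (h 0) 0 = 0" "coeff (h 0) 1 = 0"
      using coeff_lin_power_dvd[of 2 "h 0" 0] coeff_lin_power_dvd[of 2 "h 0" 1]
      by (simp_all add: vanish_3_2 taylor_3)
    show "coeff (h 1) 0 = 0" using v by (simp add: vanish_3_2 taylor_3 poly_0_coeff_0)
  qed
  have small: "k < 3 \<Longrightarrow> j + k \<le> D \<Longrightarrow> D \<le> 2 \<Longrightarrow>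
      (k, j) \<in> {(0, 0), (0, 1), (1, 0), (0, 2), (1, 1), (2, 0)}" for k j D :: nat by auto
  have "dimle (length [(0 :: nat, 0 :: nat)]) (dbl 0 {} :: (nat \<Rightarrow> 'k poly) set)"
  proof (rule dimle_coeffs)
    fix h :: "nat \<Rightarrow> 'k poly"
    assume "h \<in> dbl 0 {}" "\<forall>i<length [(0 :: nat, 0 :: nat)]. coeff (h (fst ([(0, 0)] ! i))) (snd ([(0, 0)] ! i)) = 0"
    then show "h = (\<lambda>k. 0)" by (intro zero[of 0]) (auto simp: dbl_def)
  qed
  then show "conf TYPE('k) 0 0 1" unfolding conf_def by (intro exI[of _ "{}"]) simp
  have "dimle (length [(0 :: nat, 0 :: nat), (0, 1), (1, 0)]) (dbl 1 {} :: (nat \<Rightarrow> 'k poly) set)"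
  proof (rule dimle_coeffs)
    fix h :: "nat \<Rightarrow> 'k poly"
    assume h: "h \<in> dbl 1 {}" and "\<forall>i<length [(0 :: nat, 0 :: nat), (0, 1), (1, 0)].
      coeff (h (fst ([(0, 0), (0, 1), (1, 0)] ! i))) (snd ([(0, 0), (0, 1), (1, 0)] ! i)) = 0"
    then have "coeff (h 0) 0 = 0" "coeff (h 0) 1 = 0" "coeff (h 1) 0 = 0"
      by (simp_all add: less_Suc_eq all_conj_distrib)
    moreover have "k < 3 \<Longrightarrow> j + k \<le> 1 \<Longrightarrow> (k, j) \<in> {(0, 0), (0, 1), (1, 0)}" for k j :: nat by auto
    ultimately show "h = (\<lambda>k. 0)" using h by (intro zero[of 1]) (auto simp: dbl_def)
  qed
  then show "conf TYPE('k) 1 0 3" unfolding conf_def by (intro exI[of _ "{}"]) (simp add: eval_nat_numeral)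
  have "dbl 1 {(0, 0)} \<subseteq> {\<lambda>k. 0 :: 'k poly}"
  proof
    fix h :: "nat \<Rightarrow> 'k poly" assume h: "h \<in> dbl 1 {(0, 0)}"
    have "k < 3 \<Longrightarrow> j + k \<le> 1 \<Longrightarrow> (k, j) \<in> {(0, 0), (0, 1), (1, 0)}" for k j :: nat by auto
    then have "h = (\<lambda>k. 0)" using h pt[OF h] by (intro zero[of 1]) (auto simp: dbl_def)
    then show "h \<in> {\<lambda>k. 0}" by simp
  qed
  then have "dimle 1 (dbl 1 {(0, 0)} :: (nat \<Rightarrow> 'k poly) set)"
    by (rule dimle_mono[OF dimle_zero]) simp_all
  then show "conf TYPE('k) 1 1 1" unfolding conf_def by (intro exI[of _ "{(0, 0)}"]) simp
  have "dimle (length [(0 :: nat, 2 :: nat), (1, 1), (2, 0)]) (dbl 2 {(0, 0)} :: (nat \<Rightarrow> 'k poly) set)"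
  proof (rule dimle_coeffs)
    fix h :: "nat \<Rightarrow> 'k poly"
    assume h: "h \<in> dbl 2 {(0, 0)}" and "\<forall>i<length [(0 :: nat, 2 :: nat), (1, 1), (2, 0)].
      coeff (h (fst ([(0, 2), (1, 1), (2, 0)] ! i))) (snd ([(0, 2), (1, 1), (2, 0)] ! i)) = 0"
    then have "coeff (h 0) 2 = 0" "coeff (h 1) 1 = 0" "coeff (h 2) 0 = 0"
      by (simp_all add: less_Suc_eq all_conj_distrib)
    then have "coeff (h k) j = 0" if "k < 3" "j + k \<le> 2" for k j
      using small[OF that order_refl] pt[OF h] by auto
    moreover have "degb 3 2 h" using h by (simp add: dbl_def)
    ultimately show "h = (\<lambda>k. 0)" using zero[of 2 h] by blast
  qed
  then show "conf TYPE('k) 2 1 3" unfolding conf_def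
    by (intro exI[of _ "{(0, 0)}"]) (simp add: eval_nat_numeral)
qed

text \<open>The bound is 1 rather than the expected 0, to allow for the squared curve that occurs
  for even \<open>D\<close>.\<close>

lemma conf_diagonal: "conf TYPE('k::field_char_0) D D 1"
proof (cases "even D")
  case True
  then obtain r where "D = 2 * r" by blast
  then show ?thesis using conf_iterate[OF conf_base(1), of r] by simp
next
  case False
  then obtain r where "D = 2 * r + 1" by (elim oddE)
  then show ?thesis using conf_iterate[OF conf_base(3), of r] by simp
qed

text \<open>Here 3 is the expected dimension: the families of degree \<open>n + 1\<close> have
  dimension \<open>3 * (n + 1)\<close>, and \<open>n\<close> double points impose
  \<open>3 * n\<close> conditions.\<close>

lemma conf_subdiagonal: "conf TYPE('k::field_char_0) (Suc n) n 3"
proof (cases "even n")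
  case True
  then obtain r where "n = 2 * r" by blast
  then show ?thesis using conf_iterate[OF conf_base(2), of r] by simp
next
  case False
  then obtain r where "n = 2 * r + 1" by (elim oddE)
  then show ?thesis using conf_iterate[OF conf_base(4), of r] by (simp add: numeral_2_eq_2)
qed

lemma double_root_dvd:
  fixes p :: "'k::field poly"
  assumes "poly p x = 0" "poly (pderiv p) x = 0" shows "[:- x, 1:]\<^sup>2 dvd p"
proof -
  obtain r where r: "p = [:- x, 1:] * r" using assms(1) by (auto simp: poly_eq_0_iff_dvd)
  have "pderiv [:- x, 1:] = 1" by (simp add: pderiv_pCons)
  then have "pderiv p = [:- x, 1:] * pderiv r + r" by (simp only: r pderiv_mult mult_1_right)
  then have "poly r x = 0" using assms(2) by simp
  then have "[:- x, 1:] dvd r" by (simp only: lin_dvd_iff)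
  then show ?thesis unfolding r power2_eq_square by (rule mult_dvd_mono[OF dvd_refl])
qed

text \<open>A double point amounts to three linear conditions: the value, the derivative in the
  first variable, and the first Taylor coefficient in the second.\<close>

lemma conf_remove:
  assumes "conf TYPE('k::field) D (Suc n) K" shows "conf TYPE('k) D n (K + 3)"
proof -
  obtain P :: "('k \<times> 'k) set" where P: "finite P" "card P = Suc n" "inj_on fst P" "dimle K (dbl D P)"
    using assms unfolding conf_def by blast
  obtain p where p: "p \<in> P" using P(2) by (metis card.empty equals0I nat.distinct(1))
  define t0 where "t0 h = taylor 3 (snd p) 0 h" for h :: "nat \<Rightarrow> 'k poly"
  define t1 where "t1 h = taylor 3 (snd p) (Suc 0) h" for h :: "nat \<Rightarrow> 'k poly"
  define \<psi> where "\<psi> i h = (if i = 0 then poly (t0 h) (fst p) else if i = Suc 0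
    then poly (pderiv (t0 h)) (fst p) else poly (t1 h) (fst p))" for i and h :: "nat \<Rightarrow> 'k poly"
  have lin: "lin_fun (\<psi> i)" for i
    by (auto simp: lin_fun_def \<psi>_def t0_def t1_def taylor_add taylor_smult pderiv_add pderiv_smult)
  have sub: "{h \<in> dbl D (P - {p}). \<forall>i<3. \<psi> i h = 0} \<subseteq> dbl D P"
  proof
    fix h assume h: "h \<in> {h \<in> dbl D (P - {p}). \<forall>i<3. \<psi> i h = 0}"
    then have "\<psi> 0 h = 0" "\<psi> (Suc 0) h = 0" "\<psi> 2 h = 0" by simp_all
    then have "vanish 3 h (fst p) (snd p) 2"
      using double_root_dvd[of "t0 h" "fst p"] by (simp add: vanish_3_2 \<psi>_def t0_def t1_def)
    then show "h \<in> dbl D P" using h by (auto simp: dbl_def)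
  qed
  have "dimle (K + 3) (dbl D (P - {p}))"
    by (rule dimle_add_conditions[OF dimle_mono[OF P(4) sub order_refl] lin])
  moreover have "card (P - {p}) = n" using P(1,2) p by simp
  ultimately show ?thesis unfolding conf_def using P(1,3)
    by (intro exI[of _ "P - {p}"]) (auto intro: inj_on_subset)
qed

text \<open>Descending induction on \<open>n\<close> from \<open>n = D - 1\<close>: dropping a
  double point raises the bound by three, which is exactly the expected increase.\<close>

lemma conf_independent:
  assumes "n < D" shows "conf TYPE('k::field_char_0) D n (3 * (D - n))"
  using assms
proof (induction "D - n" arbitrary: n)
  case (Suc m)
  show ?case
  proof (cases "Suc n = D")
    case True
    then show ?thesis using conf_subdiagonal[of n] by (auto simp: True[symmetric])
  next
    case False
    then have "conf TYPE('k) D (Suc n) (3 * (D - Suc n))" using Suc by (intro Suc.hyps(1)) auto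
    then have "conf TYPE('k) D n (3 * (D - Suc n) + 3)" by (rule conf_remove)
    moreover have "3 * (D - Suc n) + 3 = 3 * (D - n)" using Suc.prems by simp
    ultimately show ?thesis by metis
  qed
qed simp

section \<open>Simple points, and reduction of arbitrary multiplicities to simple and double
  points\<close>

lemma family_nonvanishing_point:
  fixes h :: "nat \<Rightarrow> 'k::field_char_0 poly"
  assumes "degb 3 D h" "h \<noteq> (\<lambda>k. 0)" "finite F"
  shows "\<exists>x y. x \<notin> F \<and> poly (taylor 3 y 0 h) x \<noteq> 0"
proof -
  obtain k where k: "h k \<noteq> 0" using assms(2) by blast
  have "finite (F \<union> {x. poly (h k) x = 0})" using k assms(3) by (simp add: poly_roots_finite)
  then obtain x where x: "x \<notin> F" "poly (h k) x \<noteq> 0"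
    using ex_new_if_finite[OF infinite_UNIV_char_0] by blast
  let ?p = "[:poly (h 0) x, poly (h 1) x, poly (h 2) x:]"
  have "k = 0 \<or> k = 1 \<or> k = 2" using k degb_high[OF assms(1), of k] by fastforce
  then have "?p \<noteq> 0" using x(2) by auto
  then have "finite {y. poly ?p y = 0}" by (rule poly_roots_finite)
  then obtain y where "poly ?p y \<noteq> 0"
    using ex_new_if_finite[OF infinite_UNIV_char_0] by blast
  then have "poly (taylor 3 y 0 h) x \<noteq> 0"
    by (simp add: taylor_3 power2_eq_square algebra_simps)
  with x(1) show ?thesis by blast
qed

text \<open>A point where some member of the space is nonzero lowers the dimension by one; once the
  space is zero, any further point will do. \<open>F\<close> and the distinct first coordinates keep
  the nodes apart for the later division by \<open>lin_prod\<close>.\<close>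

lemma dimle_simple_points:
  fixes V :: "(nat \<Rightarrow> 'k::field_char_0 poly) set"
  assumes V: "dimle K V" "\<And>h. h \<in> V \<Longrightarrow> degb 3 D h"
    and sub: "\<And>c f g. f \<in> V \<Longrightarrow> g \<in> V \<Longrightarrow> (\<lambda>k. f k + smult c (g k)) \<in> V"
    and F: "finite F"
  shows "\<exists>P. finite P \<and> card P = r \<and> inj_on fst P \<and> fst ` P \<inter> F = {} \<and>
    dimle (K - r) {h \<in> V. \<forall>p\<in>P. poly (taylor 3 (snd p) 0 h) (fst p) = 0}"
proof (induction r)
  case 0
  then show ?case using V(1) by (intro exI[of _ "{}"]) simp
next
  case (Suc r)
  then obtain P where P: "finite P" "card P = r" "inj_on fst P" "fst ` P \<inter> F = {}"
    and dim: "dimle (K - r) {h \<in> V. \<forall>p\<in>P. poly (taylor 3 (snd p) 0 h) (fst p) = 0}"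
    by blast
  define W where "W = {h \<in> V. \<forall>p\<in>P. poly (taylor 3 (snd p) 0 h) (fst p) = 0}"
  have fin: "finite (F \<union> fst ` P)" using F P(1) by simp
  have "\<exists>x y. x \<notin> F \<union> fst ` P \<and> dimle (K - r - 1) {h \<in> W. poly (taylor 3 y 0 h) x = 0}"
  proof (cases "W \<subseteq> {\<lambda>k. 0}")
    case True
    obtain x where "x \<notin> F \<union> fst ` P" using ex_new_if_finite[OF infinite_UNIV_char_0 fin] by blast
    moreover have "dimle (K - r - 1) {h \<in> W. poly (taylor 3 0 0 h) x = 0}"
      using True by (intro dimle_mono[OF dimle_zero[OF True]]) auto
    ultimately show ?thesis by blast
  next
    case False
    then obtain h where h: "h \<in> W" "h \<noteq> (\<lambda>k. 0)" by blast
    then have "degb 3 D h" using V(2) by (simp add: W_def)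
    then obtain x y where xy: "x \<notin> F \<union> fst ` P" "poly (taylor 3 y 0 h) x \<noteq> 0"
      using family_nonvanishing_point[OF _ h(2) fin] by blast
    have "dimle (K - r - 1) {f \<in> W. (\<lambda>f. poly (taylor 3 y 0 f) x) f = 0}"
    proof (rule dimle_exchange[OF dim[folded W_def] _ _ h(1)])
      show "(\<lambda>k. f k + smult c (g k)) \<in> W" if "f \<in> W" "g \<in> W" for c f g
        using that sub by (auto simp: W_def taylor_add taylor_smult)
      show "lin_fun (\<lambda>f. poly (taylor 3 y 0 f) x)" by (simp add: lin_fun_def taylor_add taylor_smult)
    qed (rule xy(2))
    with xy(1) show ?thesis by auto
  qed
  then obtain x y where xy: "x \<notin> F \<union> fst ` P" "dimle (K - r - 1) {h \<in> W. poly (taylor 3 y 0 h) x = 0}"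
    by blast
  have "{h \<in> W. poly (taylor 3 y 0 h) x = 0} =
      {h \<in> V. \<forall>p\<in>insert (x, y) P. poly (taylor 3 (snd p) 0 h) (fst p) = 0}"
    by (auto simp: W_def)
  then have "dimle (K - Suc r) {h \<in> V. \<forall>p\<in>insert (x, y) P. poly (taylor 3 (snd p) 0 h) (fst p) = 0}"
    using xy(2) by simp
  moreover have "(x, y) \<notin> P" using xy(1) by force
  moreover have "inj_on fst (insert (x, y) P)" using P(3) xy(1) by auto
  ultimately show ?case using P xy(1) by (intro exI[of _ "insert (x, y) P"]) auto
qed

lemma dbl_subspace:
  assumes "f \<in> dbl D P" "g \<in> dbl D P" shows "(\<lambda>k. f k + smult c (g k)) \<in> dbl D P"
proof -
  have "degb 3 D (\<lambda>k. f k + smult c (g k))" using assms by (simp add: dbl_def degb_def)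
  moreover have "vanish 3 (\<lambda>k. f k + smult c (g k)) x y m" if "vanish 3 f x y m" "vanish 3 g x y m"
    for x y m
    using that unfolding vanish_def taylor_add taylor_smult by (simp add: dvd_add dvd_smult)
  ultimately show ?thesis using assms by (simp add: dbl_def)
qed

text \<open>Dividing by the powers \<open>m - 2\<close> of the linear factors at the nodes turns
  multiplicity \<open>m\<close> into \<open>min m 2\<close>. Only the residual conditions at
  \<open>J2\<close> and \<open>J1\<close> are kept, so a convenient subconfiguration can be
  selected.\<close>

lemma dimle_apolar_3:
  assumes J2: "J2 \<subseteq> {k. k < length ps \<and> 2 \<le> mult_at d ps k}"
    and J1: "J1 \<subseteq> {k. k < length ps \<and> 1 \<le> mult_at d ps k}" "J1 \<inter> J2 = {}"
    and D: "d = D + (\<Sum>k<length ps. mult_at d ps k - 2)"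
    and conf: "conf TYPE('k::field_char_0) D (card J2) K"
  shows "\<exists>x y :: nat \<Rightarrow> 'k. dimle (K - card J1) (apolar 3 d ps x y)"
proof -
  have fJ: "finite J1" "finite J2" using J1 J2 by (auto intro: finite_subset[of _ "{..<length ps}"])
  obtain P2 :: "('k \<times> 'k) set" where P2: "finite P2" "card P2 = card J2" "inj_on fst P2"
    "dimle K (dbl D P2)" using conf unfolding conf_def by blast
  have "\<exists>P. finite P \<and> card P = card J1 \<and> inj_on fst P \<and> fst ` P \<inter> fst ` P2 = {} \<and>
      dimle (K - card J1) {h \<in> dbl D P2. \<forall>p\<in>P. poly (taylor 3 (snd p) 0 h) (fst p) = 0}"
  proof (rule dimle_simple_points[OF P2(4), of D])
    show "degb 3 D h" if "h \<in> dbl D P2" for h using that by (simp add: dbl_def)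
  qed (use P2(1) in \<open>auto intro: dbl_subspace\<close>)
  then obtain P1 where P1: "finite P1" "card P1 = card J1" "inj_on fst P1" "fst ` P1 \<inter> fst ` P2 = {}"
    and dim: "dimle (K - card J1) {h \<in> dbl D P2. \<forall>p\<in>P1. poly (taylor 3 (snd p) 0 h) (fst p) = 0}"
    by blast
  obtain b2 where b2: "bij_betw b2 J2 P2" using finite_same_card_bij[OF fJ(2) P2(1)] P2(2) by auto
  obtain b1 where b1: "bij_betw b1 J1 P1" using finite_same_card_bij[OF fJ(1) P1(1)] P1(2) by auto
  \<comment> \<open>Positions outside \<open>J1\<close> and \<open>J2\<close> may still contribute
    factors to \<open>Q\<close>, so they too need first coordinates different from all
    others.\<close>
  have "infinite (UNIV - (fst ` P2 \<union> fst ` P1) :: 'k set)"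
    using P1(1) P2(1) infinite_UNIV_char_0 by (simp add: Diff_infinite_finite)
  then obtain g :: "nat \<Rightarrow> 'k" where g: "inj g" "range g \<subseteq> UNIV - (fst ` P2 \<union> fst ` P1)"
    using infinite_countable_subset by blast
  define b where "b k = (if k \<in> J2 then b2 k else if k \<in> J1 then b1 k else (g k, 0))" for k
  define x y where "x k = fst (b k)" and "y k = snd (b k)" for k
  have bP: "k \<in> J2 \<Longrightarrow> b k \<in> P2" "k \<in> J1 \<Longrightarrow> b k \<in> P1"
    "k \<notin> J2 \<Longrightarrow> k \<notin> J1 \<Longrightarrow> x k = g k \<and> x k \<notin> fst ` P2 \<union> fst ` P1" for k
  proof -
    show "k \<in> J2 \<Longrightarrow> b k \<in> P2" using bij_betwE[OF b2] by (simp add: b_def)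
    show "k \<in> J1 \<Longrightarrow> b k \<in> P1" using bij_betwE[OF b1] J1(2) by (auto simp: b_def)
    assume "k \<notin> J2" "k \<notin> J1"
    then have "x k = g k" by (simp add: x_def b_def)
    moreover have "g k \<notin> fst ` P2 \<union> fst ` P1" using g(2) by blast
    ultimately show "x k = g k \<and> x k \<notin> fst ` P2 \<union> fst ` P1" by simp
  qed
  have "x i = x j \<Longrightarrow> i = j" for i j
  proof -
    assume eq: "x i = x j"
    have i2: "i \<in> J2 \<longleftrightarrow> x i \<in> fst ` P2" and i1: "i \<in> J1 \<longleftrightarrow> x i \<in> fst ` P1" for i
      using bP[of i] P1(4) unfolding x_def by blast+
    consider "i \<in> J2" "j \<in> J2" | "i \<in> J1" "j \<in> J1" | "i \<notin> J2 \<union> J1" "j \<notin> J2 \<union> J1"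
      using i2[of i] i2[of j] i1[of i] i1[of j] eq by auto
    then show "i = j"
    proof cases
      case 1
      then have "b i = b j" using inj_onD[OF P2(3) eq[unfolded x_def] bP(1) bP(1)] by blast
      then have "b2 i = b2 j" using 1 by (simp add: b_def)
      then show ?thesis using 1 b2 by (auto simp: bij_betw_def inj_on_def)
    next
      case 2
      then have "i \<notin> J2" "j \<notin> J2" using J1(2) by blast+
      moreover have "b i = b j" using 2 inj_onD[OF P1(3) eq[unfolded x_def] bP(2) bP(2)] by blast
      ultimately have "b1 i = b1 j" using 2 by (simp add: b_def)
      then show ?thesis using 2 b1 by (auto simp: bij_betw_def inj_on_def)
    next
      case 3
      then show ?thesis using bP(3)[of i] bP(3)[of j] eq g(1) by (auto dest: injD)
    qed
  qed
  then have inj: "inj_on x {..<length ps}" by (auto intro: inj_onI)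
  define n where "n k = mult_at d ps k - 2" for k
  define Q where "Q = lin_prod {..<length ps} x n"
  have Q0: "Q \<noteq> 0" and Qd: "degree Q = d - D" and Dd: "D \<le> d"
    using D by (simp_all add: Q_def lin_prod_nonzero degree_lin_prod n_def)
  have "dimle (K - card J1) (apolar 3 d ps x y)"
  proof (rule dimle_transfer[OF dim, where T = "\<lambda>f k. f k div Q"])
    fix f assume f: "f \<in> apolar 3 d ps x y"
    have db: "degb 3 d f" using f by (simp add: apolar_iff)
    have van: "[:- x k, 1:] ^ (mult_at d ps k - l) dvd taylor 3 (y k) l f" if "k < length ps" "l < 3" for k l
      using f that by (simp add: apolar_iff vanish_def)
    have "[:- x k, 1:] ^ n k dvd f 0 \<and> [:- x k, 1:] ^ n k dvd f 1 \<and> [:- x k, 1:] ^ n k dvd f 2"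
      if k: "k < length ps" for k
    proof -
      have t: "[:- x k, 1:] ^ n k dvd taylor 3 (y k) l f" if "l < 3" for l
        by (rule dvd_trans[OF le_imp_power_dvd van[OF k that]]) (use that in \<open>simp add: n_def\<close>)
      have 2: "[:- x k, 1:] ^ n k dvd f 2" using t[of 2] by (simp add: taylor_3)
      have "[:- x k, 1:] ^ n k dvd f 1 + smult (2 * y k) (f 2)" using t[of "Suc 0"] by (simp add: taylor_3)
      then have 1: "[:- x k, 1:] ^ n k dvd f 1" using 2 by (metis dvd_add_left_iff dvd_smult)
      have "[:- x k, 1:] ^ n k dvd f 0 + smult (y k) (f 1) + smult ((y k)\<^sup>2) (f 2)"
        using t[of 0] by (simp add: taylor_3)
      then have "[:- x k, 1:] ^ n k dvd f 0" using 1 2 by (metis dvd_add_left_iff dvd_smult)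
      with 1 2 show ?thesis by blast
    qed
    then have Qdvd: "Q dvd f 0" "Q dvd f 1" "Q dvd f 2"
      unfolding Q_def using inj by (auto intro!: lin_prod_dvd simp: inj_on_def)
    have eq: "f k = Q * (f k div Q)" for k
    proof -
      have "k = 0 \<or> k = 1 \<or> k = 2 \<or> 3 \<le> k" by linarith
      then show ?thesis using Qdvd degb_high[OF db, of k] by (elim disjE) simp_all
    qed
    define h where "h = (\<lambda>k. f k div Q)"
    have f_h: "f k = Q * h k" for k using eq by (simp add: h_def)
    then have f_eq: "f = (\<lambda>k. Q * h k)" by blast
    have dh: "degb 3 D h" using degb_div[OF db f_h Q0] Qd Dd by simp
    have red: "[:- x k, 1:] ^ r dvd taylor 3 (y k) l h"
      if k: "k < length ps" "l < 3" "n k + r \<le> mult_at d ps k - l" for k l r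
    proof -
      define R where "R = lin_prod ({..<length ps} - {k}) x n"
      have QR: "Q = [:- x k, 1:] ^ n k * R"
        unfolding Q_def R_def using k by (intro lin_prod_remove) auto
      have "[:- x k, 1:] ^ (n k + r) dvd taylor 3 (y k) l f"
        by (rule dvd_trans[OF le_imp_power_dvd[OF k(3)] van[OF k(1,2)]])
      then have "[:- x k, 1:] ^ (n k + r) dvd [:- x k, 1:] ^ n k * R * taylor 3 (y k) l h"
        by (simp only: f_eq taylor_mult QR)
      then show ?thesis
      proof (rule lin_power_dvd_reduce)
        show "poly R (x k) \<noteq> 0"
          unfolding R_def using inj k by (intro poly_lin_prod_other) (auto simp: inj_on_def)
      qed
    qed
    have "vanish 3 h (fst p) (snd p) 2" if pP: "p \<in> P2" for p
    proof -
      obtain k where k: "k \<in> J2" "p = b2 k" using bij_betw_imp_surj_on[OF b2] pP by blast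
      then have p: "fst p = x k" "snd p = y k" by (simp_all add: x_def y_def b_def)
      have kl: "k < length ps" "2 \<le> mult_at d ps k" using J2 k(1) by auto
      show ?thesis
        unfolding p vanish_def by (intro allI impI red kl) (use kl in \<open>auto simp: n_def\<close>)
    qed
    moreover have "poly (taylor 3 (snd p) 0 h) (fst p) = 0" if pP: "p \<in> P1" for p
    proof -
      obtain k where k: "k \<in> J1" "p = b1 k" using bij_betw_imp_surj_on[OF b1] pP by blast
      moreover have "k \<notin> J2" using k(1) J1(2) by blast
      ultimately have p: "fst p = x k" "snd p = y k" by (simp_all add: x_def y_def b_def)
      have kl: "k < length ps" "1 \<le> mult_at d ps k" using J1 k(1) by auto
      have "[:- x k, 1:] ^ 1 dvd taylor 3 (y k) 0 h" using kl by (intro red) (auto simp: n_def)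
      then show ?thesis by (simp add: p lin_dvd_iff)
    qed
    ultimately show "(\<lambda>k. f k div Q) \<in>
        {h \<in> dbl D P2. \<forall>p\<in>P1. poly (taylor 3 (snd p) 0 h) (fst p) = 0}"
      unfolding h_def[symmetric] using dh by (simp add: dbl_def)
    show "f = (\<lambda>k. 0)" if "(\<lambda>k. f k div Q) = (\<lambda>k. 0)"
      unfolding f_eq using that by (simp add: h_def fun_eq_iff)
  qed (simp_all add: div_lin)
  then show ?thesis by blast
qed

subsection \<open>Maximal rank of general multiplication maps\<close>

lemma general_max_rank_of_dimle:
  fixes x y :: "nat \<Rightarrow> 'k::field_char_0"
  assumes dist: "distinct (map fst ps)" "t \<notin> fst ` set ps"
    and idx: "\<And>i. i \<in> fst ` set ps \<Longrightarrow> i < N" and t: "t < N"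
    and dim: "dimle n (apolar e d ps x y)" "n \<le> card (bnd e d) - cost ps e d"
  shows "general (3 * N) (\<lambda>v::nat \<Rightarrow> 'k.
    (cost ps e d \<le> card (bnd e d) \<longrightarrow> mult_inj (forms v ps) (lf v t ^ e) e (int d)) \<and>
    (card (bnd e d) \<le> cost ps e d \<longrightarrow> mult_surj (forms v ps) (lf v t ^ e) e (int d)))"
proof -
  define pos where "pos = the_inv_into {..<length ps} (\<lambda>k. fst (ps ! k))"
  have inj: "inj_on (\<lambda>k. fst (ps ! k)) {..<length ps}"
    using dist(1) by (auto simp: inj_on_def distinct_conv_nth)
  have pos: "pos (fst (ps ! k)) = k" if "k < length ps" for k
    unfolding pos_def using the_inv_into_f_f[OF inj, of k] that by simp
  \<comment> \<open>The multiplier \<open>t\<close> is specialised to \<open>z\<close>, and the form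
    at list position \<open>k\<close> to the one with coefficients \<open>1\<close>,
    \<open>x k\<close>, \<open>y k\<close>.\<close>
  define v0 where "v0 j = (let i = j div 3; r = j mod 3 in
      if i = t then (if r = 2 then 1 else 0)
      else if r = 0 then 1 else if r = 1 then x (pos i) else y (pos i))" for j
  have arith: "(3 * k) div 3 = k" "(3 * k) mod 3 = 0" "(3 * k + 1) div 3 = k" "(3 * k + 1) mod 3 = 1"
    "(3 * k + 2) div 3 = k" "(3 * k + 2) mod 3 = 2" for k :: nat
    by presburger+
  have z: "lf v0 t = linform 0 0 1"
    unfolding lf_def v0_def Let_def arith by simp
  have pts: "lf v0 (fst (ps ! k)) = linform 1 (x k) (y k)" if "k < length ps" for k
  proof -
    have "fst (ps ! k) \<noteq> t" using dist(2) that by auto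
    then show ?thesis unfolding lf_def v0_def Let_def arith by (simp add: pos[OF that])
  qed
  obtain E where E: "finite E" "card E \<le> n" "hom d \<subseteq> P3.span (fvec ps t e v0 ` fidx ps e d \<union> E)"
    using codimension_of_dimle[OF dim(1) z pts] by blast
  show ?thesis
    by (rule general_max_rank[OF _ t z E(1) _ E(3)]) (use idx E(2) dim(2) in auto)
qed

text \<open>The sum in the definition of p(B), with truncation replacing the restriction on the
  index: p(B) is the largest \<open>d\<close> with \<open>sig ps d \<le> d\<close>.\<close>

definition sig :: "(nat \<times> nat) list \<Rightarrow> nat \<Rightarrow> nat" where
  "sig ps d = (\<Sum>k<length ps. mult_at d ps k)"

lemma cost_mult_at: "cost ps e d = (\<Sum>k<length ps. \<Sum>l<e. mult_at d ps k - l)"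
  unfolding cost_def
proof (rule sum.cong[OF refl])
  fix k
  show "(if snd (ps ! k) \<le> d then card (bnd e (d - snd (ps ! k))) else 0) = (\<Sum>l<e. mult_at d ps k - l)"
    unfolding card_bnd mult_at_def by (auto intro!: sum.cong simp: Suc_diff_le)
qed

definition generic_position :: "(nat \<times> nat) list \<Rightarrow> nat \<Rightarrow> nat \<Rightarrow> bool" where
  "generic_position ps t N \<longleftrightarrow> distinct (map fst ps) \<and> t \<notin> fst ` set ps \<and>
     (\<forall>i\<in>fst ` set ps. i < N) \<and> t < N"

lemma general_rank_1:
  assumes "generic_position ps t N"
  shows "general (3 * N) (\<lambda>v::nat \<Rightarrow> 'k::field_char_0.
    (sig ps d \<le> d \<longrightarrow> mult_inj (forms v ps) (lf v t) 1 (int d)) \<and>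
    (d < sig ps d \<longrightarrow> mult_surj (forms v ps) (lf v t) 1 (int d)))"
proof -
  have c: "cost ps (Suc 0) d = sig ps d" "card (bnd (Suc 0) d) = Suc d"
    by (simp_all add: cost_mult_at card_bnd sig_def)
  have dim: "dimle (d + 1 - sig ps d) (apolar (Suc 0) d ps of_nat (\<lambda>k. 0 :: 'k))"
    unfolding sig_def by (rule dimle_apolar_1) (simp add: inj_on_def)
  have "general (3 * N) (\<lambda>v::nat \<Rightarrow> 'k.
    (cost ps (Suc 0) d \<le> card (bnd (Suc 0) d) \<longrightarrow> mult_inj (forms v ps) (lf v t ^ Suc 0) (Suc 0) (int d)) \<and>
    (card (bnd (Suc 0) d) \<le> cost ps (Suc 0) d \<longrightarrow> mult_surj (forms v ps) (lf v t ^ Suc 0) (Suc 0) (int d)))"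
    by (rule general_max_rank_of_dimle[OF _ _ _ _ dim])
       (use assms c in \<open>auto simp: generic_position_def\<close>)
  then show ?thesis by (rule general_mono) (auto simp: c)
qed

lemma mult_at_Suc: "mult_at (Suc d) ps k - 1 = mult_at d ps k"
  by (simp add: mult_at_def)

lemma card_filter_sum: "card {k. k < n \<and> P k} = (\<Sum>k<n. if P k then 1 else 0 :: nat)" for n :: nat
proof -
  have "(\<Sum>k<n. if P k then 1 else 0 :: nat) = (\<Sum>k\<in>{k\<in>{..<n}. P k}. 1)"
    by (rule sum.inter_filter[symmetric]) simp
  then show ?thesis by simp
qed

text \<open>For \<open>q\<close> the threshold, \<open>q + 1\<close> is the only degree in which the
  two factors of the square lie on different sides of it.\<close>

lemma general_rank_2:
  assumes "generic_position ps t N" and q: "sig ps q \<le> q"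
  shows "general (3 * N) (\<lambda>v::nat \<Rightarrow> 'k::field_char_0.
    max_rank (forms v ps) (lf v t ^ 2) 2 (int (Suc q)))"
proof -
  let ?d = "Suc q"
  let ?x = "of_nat :: nat \<Rightarrow> 'k"
  define D where "D = ?d - sig ps q"
  have s: "(\<Sum>k<length ps. mult_at ?d ps k - 1) = sig ps q"
    unfolding sig_def mult_at_Suc ..
  have dim: "dimle (2 * D + 1 - card {k. k < length ps \<and> 0 < mult_at ?d ps k})
      (apolar 2 ?d ps ?x (\<lambda>k. ?x k ^ (D + 1)))"
  proof (rule dimle_apolar_2)
    show "?d = D + (\<Sum>k<length ps. mult_at ?d ps k - 1)" unfolding s D_def using q by simp
  qed (simp add: inj_on_def)
  have "cost ps 2 ?d = (\<Sum>k<length ps. 2 * (mult_at ?d ps k - 1) + (if 0 < mult_at ?d ps k then 1 else 0))"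
    unfolding cost_mult_at by (rule sum.cong) (auto simp: numeral_2_eq_2)
  also have "\<dots> = 2 * sig ps q + card {k. k < length ps \<and> 0 < mult_at ?d ps k}"
    by (simp add: sum.distrib card_filter_sum sum_distrib_left[symmetric] s del: One_nat_def)
  finally have "2 * D + 1 - card {k. k < length ps \<and> 0 < mult_at ?d ps k} \<le> card (bnd 2 ?d) - cost ps 2 ?d"
    using q by (simp add: card_bnd numeral_2_eq_2 D_def)
  then have "general (3 * N) (\<lambda>v::nat \<Rightarrow> 'k.
    (cost ps 2 ?d \<le> card (bnd 2 ?d) \<longrightarrow> mult_inj (forms v ps) (lf v t ^ 2) 2 (int ?d)) \<and>
    (card (bnd 2 ?d) \<le> cost ps 2 ?d \<longrightarrow> mult_surj (forms v ps) (lf v t ^ 2) 2 (int ?d)))"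
    by (intro general_max_rank_of_dimle[OF _ _ _ _ dim])
       (use assms(1) in \<open>auto simp: generic_position_def\<close>)
  then show ?thesis by (rule general_mono) (metis max_rank_def nat_le_linear)
qed

lemma cost_3: "cost ps 3 d = 3 * (\<Sum>k<length ps. mult_at d ps k - 2) +
    3 * card {k. k < length ps \<and> 2 \<le> mult_at d ps k} + card {k. k < length ps \<and> mult_at d ps k = 1}"
proof -
  have "cost ps 3 d = (\<Sum>k<length ps. 3 * (mult_at d ps k - 2) +
      3 * (if 2 \<le> mult_at d ps k then 1 else 0) + (if mult_at d ps k = 1 then 1 else 0))"
    unfolding cost_mult_at by (rule sum.cong) (auto simp: numeral_3_eq_3)
  then show ?thesis
    by (simp add: sum.distrib card_filter_sum sum_distrib_left[symmetric] del: One_nat_def)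
qed

lemma sig_mult_at_2: "sig ps p = (\<Sum>k<length ps. mult_at (Suc p) ps k - 2) +
    card {k. k < length ps \<and> 2 \<le> mult_at (Suc p) ps k}"
proof -
  have "sig ps p = (\<Sum>k<length ps. (mult_at (Suc p) ps k - 2) +
      (if 2 \<le> mult_at (Suc p) ps k then 1 else 0))"
    unfolding sig_def by (rule sum.cong) (auto simp: mult_at_def)
  then show ?thesis by (simp add: sum.distrib card_filter_sum)
qed

lemma card_bnd_3: "card (bnd 3 (Suc p)) = 3 * Suc p"
  by (simp add: card_bnd numeral_3_eq_3)

text \<open>\<open>sig ps p \<le> p\<close> translates into \<open>card J2 < D\<close>, the range
  where double points impose independent conditions; then \<open>3 * (D - card J2) - card J1\<close>
  is the expected dimension.\<close>

lemma general_rank_3: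
  assumes gp: "generic_position ps t N" and p: "sig ps p \<le> p"
  shows "general (3 * N) (\<lambda>v::nat \<Rightarrow> 'k::field_char_0.
    (cost ps 3 (Suc p) \<le> 3 * Suc p \<longrightarrow> mult_inj (forms v ps) (lf v t ^ 3) 3 (int (Suc p))) \<and>
    (3 * Suc p \<le> cost ps 3 (Suc p) \<longrightarrow> mult_surj (forms v ps) (lf v t ^ 3) 3 (int (Suc p))))"
proof -
  define S where "S = (\<Sum>k<length ps. mult_at (Suc p) ps k - 2)"
  define J2 where "J2 = {k. k < length ps \<and> 2 \<le> mult_at (Suc p) ps k}"
  define J1 where "J1 = {k. k < length ps \<and> mult_at (Suc p) ps k = 1}"
  define D where "D = Suc p - S"
  have sg: "S + card J2 \<le> p" using p by (simp add: sig_mult_at_2 S_def J2_def)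
  have "\<exists>x y :: nat \<Rightarrow> 'k. dimle (3 * (D - card J2) - card J1) (apolar 3 (Suc p) ps x y)"
  proof (rule dimle_apolar_3)
    show "Suc p = D + (\<Sum>k<length ps. mult_at (Suc p) ps k - 2)"
      unfolding S_def[symmetric] D_def using sg by simp
    show "conf TYPE('k) D (card J2) (3 * (D - card J2))"
      by (rule conf_independent) (use sg in \<open>simp add: D_def\<close>)
  qed (auto simp: J1_def J2_def)
  then obtain x y :: "nat \<Rightarrow> 'k" where dim: "dimle (3 * (D - card J2) - card J1) (apolar 3 (Suc p) ps x y)"
    by blast
  have le: "3 * (D - card J2) - card J1 \<le> card (bnd 3 (Suc p)) - cost ps 3 (Suc p)"
    unfolding card_bnd_3 cost_3 S_def[symmetric] J1_def[symmetric] J2_def[symmetric] D_def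
    using sg by simp
  show ?thesis
    unfolding card_bnd_3[symmetric]
    by (rule general_max_rank_of_dimle[OF _ _ _ _ dim le]) (use gp in \<open>auto simp: generic_position_def\<close>)
qed

text \<open>In degree \<open>p + 2\<close> at least \<open>D\<close> double points impose conditions on a system of degree \<open>D\<close>,
  which leaves at most the double of one curve; the extra simple point removes it.\<close>
lemma general_rank_top:
  assumes gp: "generic_position (ps @ [(i, p + 2)]) t N" and p: "sig ps p \<le> p" "Suc p < sig ps (Suc p)"
  shows "general (3 * N) (\<lambda>v::nat \<Rightarrow> 'k::field_char_0.
    mult_surj (forms v (ps @ [(i, p + 2)])) (lf v t ^ 3) 3 (int (p + 2)))"
proof -
  let ?ps = "ps @ [(i, p + 2)]"
  let ?d = "Suc (Suc p)"
  let ?l = "length ps"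
  define S where "S = (\<Sum>k<length ?ps. mult_at ?d ?ps k - 2)"
  define I2 where "I2 = {k. k < length ?ps \<and> 2 \<le> mult_at ?d ?ps k}"
  define D where "D = ?d - S"
  have m_app: "mult_at e ?ps k = mult_at e ps k" if "k < ?l" for e k
    using that by (simp add: mult_at_def nth_append)
  have m_last: "mult_at ?d ?ps ?l = 1" by (simp add: mult_at_def nth_append)
  have "S = (\<Sum>k<?l. mult_at ?d ps k - 2)" unfolding S_def using m_app m_last by simp
  also have "\<dots> = sig ps p" unfolding sig_def by (rule sum.cong) (auto simp: mult_at_def)
  finally have S: "S = sig ps p" .
  have I2: "I2 = {k. k < ?l \<and> 2 \<le> mult_at ?d ps k}"
    using m_app m_last by (auto simp: I2_def less_Suc_eq)
  have "sig ps (Suc p) = S + card I2"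
    unfolding I2 using sig_mult_at_2[of ps "Suc p"] \<open>S = (\<Sum>k<?l. mult_at ?d ps k - 2)\<close> by simp
  \<comment> \<open>Here the failure of the defining inequality in degree \<open>p + 1\<close>
    enters. Exactly \<open>D\<close> of these double points are used below.\<close>
  then have card_I2: "D \<le> card I2" using p(2) by (simp add: D_def)
  have "finite I2" by (simp add: I2)
  then obtain J2 where J2: "J2 \<subseteq> I2" "card J2 = D" using obtain_subset_with_card_n[OF card_I2] by metis
  have "\<exists>x y :: nat \<Rightarrow> 'k. dimle (1 - card {?l}) (apolar 3 ?d ?ps x y)"
  proof (rule dimle_apolar_3)
    show "J2 \<subseteq> {k. k < length ?ps \<and> 2 \<le> mult_at ?d ?ps k}" using J2(1) by (simp add: I2_def)
    show "{?l} \<subseteq> {k. k < length ?ps \<and> 1 \<le> mult_at ?d ?ps k}" using m_last by simp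
    show "{?l} \<inter> J2 = {}" using J2(1) I2 by auto
    show "?d = D + (\<Sum>k<length ?ps. mult_at ?d ?ps k - 2)"
      unfolding S_def[symmetric] D_def using S p(1) by simp
    show "conf TYPE('k) D (card J2) 1" unfolding J2(2) by (rule conf_diagonal)
  qed
  then obtain x y :: "nat \<Rightarrow> 'k" where dim: "dimle 0 (apolar 3 ?d ?ps x y)" by auto
  have "card (bnd 3 ?d) \<le> cost ?ps 3 ?d"
    unfolding card_bnd_3 cost_3 S_def[symmetric] I2_def[symmetric]
    using card_I2 S p(1) by (simp add: D_def)
  moreover have "general (3 * N) (\<lambda>v::nat \<Rightarrow> 'k.
    (cost ?ps 3 ?d \<le> card (bnd 3 ?d) \<longrightarrow> mult_inj (forms v ?ps) (lf v t ^ 3) 3 (int ?d)) \<and>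
    (card (bnd 3 ?d) \<le> cost ?ps 3 ?d \<longrightarrow> mult_surj (forms v ?ps) (lf v t ^ 3) 3 (int ?d)))"
    by (rule general_max_rank_of_dimle[OF _ _ _ _ dim]) (use gp in \<open>auto simp: generic_position_def\<close>)
  ultimately show ?thesis by (auto elim: general_mono)
qed

subsection \<open>Maximal rank is generically true or generically false\<close>

definition gidx :: "(nat \<times> nat) list \<Rightarrow> nat \<Rightarrow> (nat \<times> nat \<times> nat \<times> nat) set" where
  "gidx ps D = Sigma {..<length ps} (\<lambda>k. if snd (ps ! k) \<le> D then expos (D - snd (ps ! k)) else {})"

definition gvec :: "(nat \<times> nat) list \<Rightarrow> (nat \<Rightarrow> 'k::comm_ring_1) \<Rightarrow> nat \<times> nat \<times> nat \<times> nat \<Rightarrow> 'k poly3" where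
  "gvec ps v = (\<lambda>(k, m). forms v ps ! k * mon m)"

lemma finite_gidx [simp]: "finite (gidx ps D)"
  by (simp add: gidx_def)

lemma gvec_in_ideal: "x \<in> gidx ps D \<Longrightarrow> gvec ps v x \<in> ideal_gen (forms v ps)"
proof -
  assume "x \<in> gidx ps D"
  then obtain k m where x: "x = (k, m)" "k < length ps" by (auto simp: gidx_def)
  then have "forms v ps ! k \<in> ideal_gen (forms v ps)" by (intro ideal_gen_nth) simp
  from ideal_gen_mult[OF this, of "mon m"] show ?thesis by (simp add: x gvec_def mult.commute)
qed

lemma homog_gvec: "x \<in> gidx ps D \<Longrightarrow> homog (gvec ps v x) (int D)"
proof -
  assume "x \<in> gidx ps D"
  then obtain k m where x: "x = (k, m)" "k < length ps" "snd (ps ! k) \<le> D" "mdeg m = D - snd (ps ! k)"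
    by (auto simp: gidx_def expos_def split: if_splits)
  then show ?thesis
    using homog_mult[OF homog_forms[OF x(2), of v] homog_mon[of m]]
    by (simp add: gvec_def of_nat_diff)
qed

lemma polyvec_gvec:
  assumes "\<forall>i\<in>fst ` set ps. i < N" "x \<in> gidx ps D"
  shows "(\<lambda>v. gvec ps v x) \<in> polyvec (3 * N)"
proof -
  obtain k m where x: "x = (k, m)" "k < length ps" using assms(2) by (auto simp: gidx_def)
  then show ?thesis
    using assms(1) by (simp add: gvec_def forms_nth polyvec_mult polyvec_const polyvec_lf_power)
qed

lemma ideal_span_gvec:
  fixes v :: "nat \<Rightarrow> 'k::field"
  assumes "homog f (int D)"
  shows "f \<in> ideal_gen (forms v ps) \<longleftrightarrow> f \<in> P3.span (gvec ps v ` gidx ps D)"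
proof
  assume "f \<in> ideal_gen (forms v ps)"
  then obtain c where f: "f = (\<Sum>k<length ps. c k * forms v ps ! k)"
    and c: "\<forall>k<length ps. homog (c k) (int D - int (snd (ps ! k)))"
    using ideal_gen_homog[of f "forms v ps" "int D" "\<lambda>k. int (snd (ps ! k))"] assms homog_forms
    by auto
  have "c k * forms v ps ! k \<in> P3.span (gvec ps v ` gidx ps D)" if k: "k < length ps" for k
  proof -
    obtain u where u: "c k = (\<Sum>m\<in>tail (snd (ps ! k)) D. sc (u m) (mon m))"
      using homog_tail_expansion c k by blast
    have "(k, m) \<in> gidx ps D" if "m \<in> tail (snd (ps ! k)) D" for m
      using that k by (auto simp: gidx_def tail_def)
    then have "gvec ps v (k, m) \<in> P3.span (gvec ps v ` gidx ps D)" if "m \<in> tail (snd (ps ! k)) D" for m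
      using that by (intro P3.span_base imageI)
    then have "(\<Sum>m\<in>tail (snd (ps ! k)) D. sc (u m) (gvec ps v (k, m))) \<in> P3.span (gvec ps v ` gidx ps D)"
      by (intro P3.span_sum P3.span_scale)
    moreover have "c k * forms v ps ! k = (\<Sum>m\<in>tail (snd (ps ! k)) D. sc (u m) (gvec ps v (k, m)))"
      unfolding u gvec_def by (simp add: sum_distrib_right sc_mult_left mult.commute[of "forms v ps ! k"])
    ultimately show ?thesis by simp
  qed
  then show "f \<in> P3.span (gvec ps v ` gidx ps D)" unfolding f by (intro P3.span_sum) simp
next
  assume f: "f \<in> P3.span (gvec ps v ` gidx ps D)"
  have "P3.subspace (ideal_gen (forms v ps))"
    by (auto simp: P3.subspace_def ideal_gen_add sc_def intro: ideal_gen_mult)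
  moreover have "gvec ps v ` gidx ps D \<subseteq> ideal_gen (forms v ps)" using gvec_in_ideal by blast
  ultimately show "f \<in> ideal_gen (forms v ps)" using f P3.span_minimal by blast
qed

definition mvec :: "(nat \<times> nat) list \<Rightarrow> nat \<Rightarrow> nat \<Rightarrow> (nat \<Rightarrow> 'k::comm_ring_1) \<Rightarrow>
    (nat \<times> nat \<times> nat \<times> nat) + (nat \<times> nat \<times> nat) \<Rightarrow> 'k poly3" where
  "mvec ps t e v = case_sum (gvec ps v) (\<lambda>m. lf v t ^ e * mon m)"

lemma mvec_sum:
  assumes "finite A" "finite B"
  shows "(\<Sum>i\<in>A <+> B. sc (c i) (mvec ps t e v i)) = (\<Sum>x\<in>A. sc (c (Inl x)) (gvec ps v x)) +
    lf v t ^ e * (\<Sum>m\<in>B. sc (c (Inr m)) (mon m))"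
  using assms by (simp add: sum.Plus mvec_def sum_distrib_left sc_mult_right)

lemma polyvec_mvec:
  assumes "\<forall>i\<in>fst ` set ps. i < N" "t < N" "i \<in> gidx ps D <+> B"
  shows "(\<lambda>v. mvec ps t e v i) \<in> polyvec (3 * N)"
  using assms
  by (cases i) (auto simp: mvec_def intro!: polyvec_gvec polyvec_mult polyvec_const polyvec_lf_power)

lemma mult_surj_iff_spanning:
  fixes v :: "nat \<Rightarrow> 'k::field"
  shows "mult_surj (forms v ps) (lf v t ^ e) e (int d) \<longleftrightarrow>
    hom d \<subseteq> P3.span (mvec ps t e v ` (gidx ps d <+> tail e d))"
proof
  assume S: "mult_surj (forms v ps) (lf v t ^ e) e (int d)"
  show "hom d \<subseteq> P3.span (mvec ps t e v ` (gidx ps d <+> tail e d))"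
  proof
    fix g :: "'k poly3" assume "g \<in> hom d"
    then have g: "homog g (int d)" by (simp add: hom_def)
    obtain f where f: "homog f (int d - int e)" "g - lf v t ^ e * f \<in> ideal_gen (forms v ps)"
      using mult_surjD[OF S g] by blast
    have "homog (lf v t ^ e * f) (int d)" using homog_mult[OF homog_lf_power[of v t e] f(1)] by simp
    then have "g - lf v t ^ e * f \<in> P3.span (gvec ps v ` gidx ps d)"
      using ideal_span_gvec f(2) homog_diff[OF g] by blast
    then obtain a where a: "g - lf v t ^ e * f = (\<Sum>x\<in>gidx ps d. sc (a x) (gvec ps v x))"
      using span_family[OF finite_gidx] by blast
    obtain b where b: "f = (\<Sum>m\<in>tail e d. sc (b m) (mon m))" using homog_tail_expansion[OF f(1)] by blast
    have "(\<Sum>i\<in>gidx ps d <+> tail e d. sc (case_sum a b i) (mvec ps t e v i)) = g"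
      unfolding mvec_sum[OF finite_gidx finite_tail] using a b by (simp add: algebra_simps)
    then show "g \<in> P3.span (mvec ps t e v ` (gidx ps d <+> tail e d))"
      using family_span[of "case_sum a b" "mvec ps t e v" "gidx ps d <+> tail e d"] by simp
  qed
next
  assume S: "hom d \<subseteq> P3.span (mvec ps t e v ` (gidx ps d <+> tail e d))"
  show "mult_surj (forms v ps) (lf v t ^ e) e (int d)"
    unfolding mult_surj_def
  proof (intro allI impI)
    fix g :: "'k poly3" assume "homog g (int d)"
    then have "g \<in> P3.span (mvec ps t e v ` (gidx ps d <+> tail e d))" using S by (auto simp: hom_def)
    then obtain c where "g = (\<Sum>i\<in>gidx ps d <+> tail e d. sc (c i) (mvec ps t e v i))"
      using span_family[of "gidx ps d <+> tail e d" g "mvec ps t e v"] by auto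
    then have "g - lf v t ^ e * (\<Sum>m\<in>tail e d. sc (c (Inr m)) (mon m)) =
        (\<Sum>x\<in>gidx ps d. sc (c (Inl x)) (gvec ps v x))"
      by (simp add: mvec_sum)
    also have "\<dots> \<in> ideal_gen (forms v ps)"
      by (rule ideal_gen_sum) (simp add: sc_def ideal_gen_mult gvec_in_ideal)
    finally show "\<exists>f. homog f (int d - int e) \<and> g - lf v t ^ e * f \<in> ideal_gen (forms v ps)"
      by (intro exI[of _ "\<Sum>m\<in>tail e d. sc (c (Inr m)) (mon m)"] conjI homog_tail_sum)
  qed
qed

text \<open>Surjectivity is spanning by a fixed family, an open condition: it holds generically as
  soon as it holds at one point.\<close>

lemma decided_mult_surj:
  assumes "\<forall>i\<in>fst ` set ps. i < N" "t < N"
  shows "decided (3 * N) (\<lambda>v::nat \<Rightarrow> 'k::field_char_0. mult_surj (forms v ps) (lf v t ^ e) e (int d))"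
proof -
  let ?I = "gidx ps d <+> tail e d"
  let ?S = "\<lambda>v::nat \<Rightarrow> 'k. hom d \<subseteq> P3.span ((\<lambda>i. mvec ps t e v i) ` ?I)"
  have h: "mvec ps t e v i \<in> hom d" if "i \<in> ?I" for i and v :: "nat \<Rightarrow> 'k"
    using that
  proof (cases i)
    case (Inl x)
    then show ?thesis using that homog_gvec[of x ps d v] by (auto simp: mvec_def hom_def)
  next
    case (Inr m)
    then have "e \<le> d" "mdeg m = d - e" using that by (auto simp: tail_def expos_def split: if_splits)
    then show ?thesis using homog_mult[OF homog_lf_power[of v t e] homog_mon[of m]]
      by (simp add: Inr mvec_def hom_def of_nat_diff)
  qed
  have "decided (3 * N) ?S"
  proof (cases "\<exists>v0. ?S v0")
    case True
    then obtain v0 where "?S v0" by blast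
    then have "general (3 * N) ?S"
      using assms by (intro general_spanning[where ?v0.0 = v0] polyvec_mvec h) auto
    then show ?thesis by (simp add: decided_def)
  next
    case False
    then have "general (3 * N) (\<lambda>v. \<not> ?S v)" by (intro general_True) blast
    then show ?thesis by (simp add: decided_def)
  qed
  then show ?thesis unfolding mult_surj_iff_spanning .
qed

lemma lin_indep_empty: "lin_indep {} w" by (simp add: lin_indep_def)

text \<open>Choose generically valid bases of the ideal in degrees \<open>d - e\<close> and \<open>d\<close> among the generators and a
  monomial complement in degree \<open>d - e\<close>; injectivity then becomes linear independence of a fixed
  family, which holds either generically or nowhere.\<close>
lemma decided_mult_inj:
  assumes idx: "\<forall>i\<in>fst ` set ps. i < N" "t < N"
  shows "decided (3 * N) (\<lambda>v::nat \<Rightarrow> 'k::field_char_0. mult_inj (forms v ps) (lf v t ^ e) e (int d))"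
proof (cases "e \<le> d")
  case False
  then have "mult_inj (forms v ps) (lf v t ^ e) e (int d)" for v :: "nat \<Rightarrow> 'k"
    by (intro mult_inj_neg) simp
  then show ?thesis unfolding decided_def by (intro disjI1 general_True)
next
  case True
  define r where "r = d - e"
  have r: "int d - int e = int r" "tail e d = expos r" using True by (simp_all add: r_def tail_def of_nat_diff)
  have g: "(\<lambda>v::nat \<Rightarrow> 'k. gvec ps v x) \<in> polyvec (3 * N)" if "x \<in> gidx ps D" for x D
    using polyvec_gvec[OF idx(1) that] .
  define basis where "basis D J v \<longleftrightarrow> lin_indep J (\<lambda>x. gvec ps v x) \<and>
    (\<forall>x\<in>gidx ps D. gvec ps v x \<in> P3.span ((\<lambda>x. gvec ps v x) ` J))" for D J and v :: "nat \<Rightarrow> 'k"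
  have ex_basis: "\<exists>J\<subseteq>gidx ps D. general (3 * N) (basis D J)" for D
    using general_basis[where w = "\<lambda>x v. gvec ps v x" and I = "gidx ps D" and ?I0.0 = "{}", OF finite_gidx g]
    by (auto simp: lin_indep_empty basis_def[abs_def])
  obtain I1 where I1: "I1 \<subseteq> gidx ps r" "general (3 * N) (basis r I1)" using ex_basis by blast
  obtain I2 where I2: "I2 \<subseteq> gidx ps d" "general (3 * N) (basis d I2)" using ex_basis by blast
  have fin: "finite I1" "finite I2" using I1(1) I2(1) by (auto intro: finite_subset[OF _ finite_gidx])
  define w where "w i v = case_sum (gvec ps v) mon i"
    for i :: "(nat \<times> nat \<times> nat \<times> nat) + (nat \<times> nat \<times> nat)" and v :: "nat \<Rightarrow> 'k"
  have w_sum: "(\<Sum>i\<in>A <+> B. sc (c i) (w i v)) =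
      (\<Sum>x\<in>A. sc (c (Inl x)) (gvec ps v x)) + (\<Sum>m\<in>B. sc (c (Inr m)) (mon m))"
    if "finite A" "finite B" for A B c v
    using that by (simp add: sum.Plus w_def)
  obtain v1 where v1: "basis r I1 v1" using general_ex[OF I1(2)] by blast
  have "\<exists>J. Inl ` I1 \<subseteq> J \<and> J \<subseteq> I1 <+> expos r \<and> general (3 * N) (\<lambda>v. lin_indep J (\<lambda>i. w i v) \<and>
      (\<forall>i\<in>I1 <+> expos r. w i v \<in> P3.span ((\<lambda>i. w i v) ` J)))"
  proof (rule general_basis)
    show "finite (I1 <+> expos r)" using fin by simp
    show "w i \<in> polyvec (3 * N)" if "i \<in> I1 <+> expos r" for i
      using that I1(1) g by (cases i) (auto simp: w_def[abs_def] polyvec_const)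
    have "(\<Sum>i\<in>Inl ` I1. sc (c i) (w i v1)) = (\<Sum>x\<in>I1. sc (c (Inl x)) (gvec ps v1 x))" for c
      by (simp add: sum.reindex w_def)
    then show "lin_indep (Inl ` I1) (\<lambda>i. w i v1)"
      using v1 by (auto simp: lin_indep_def basis_def)
  qed auto
  then obtain J where J: "Inl ` I1 \<subseteq> J" "J \<subseteq> I1 <+> expos r"
    and gJ: "general (3 * N) (\<lambda>v. lin_indep J (\<lambda>i. w i v) \<and>
      (\<forall>i\<in>I1 <+> expos r. w i v \<in> P3.span ((\<lambda>i. w i v) ` J)))" by blast
  define T where "T = {m. Inr m \<in> J}"
  have T: "T \<subseteq> expos r" using J(2) by (auto simp: T_def)
  then have fT: "finite T" by (rule finite_subset) simp
  have JT: "J = I1 <+> T" using J by (auto simp: T_def Plus_def)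
  let ?K = "I2 <+> T"
  let ?Q = "\<lambda>v::nat \<Rightarrow> 'k. lin_indep ?K (\<lambda>i. mvec ps t e v i)"
  have "decided (3 * N) ?Q"
  proof (cases "\<exists>v0. ?Q v0")
    case True
    then obtain v0 where v0: "?Q v0" by blast
    have "general (3 * N) ?Q"
    proof (rule general_lin_indep[where ?v0.0 = v0])
      show "(\<lambda>v. mvec ps t e v i) \<in> polyvec (3 * N)" if "i \<in> ?K" for i
        using that I2(1) by (intro polyvec_mvec[OF idx, of i d T]) auto
    qed (use v0 fin fT in auto)
    then show ?thesis by (simp add: decided_def)
  next
    case False
    then have "general (3 * N) (\<lambda>v. \<not> ?Q v)" by (intro general_True) blast
    then show ?thesis by (simp add: decided_def)
  qed
  moreover have "general (3 * N) (\<lambda>v. ?Q v \<longleftrightarrow> mult_inj (forms v ps) (lf v t ^ e) e (int d))"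
  proof (rule general_mono[OF general_conj[OF general_conj[OF I1(2) I2(2)] gJ]])
    fix v :: "nat \<Rightarrow> 'k"
    let ?I = "ideal_gen (forms v ps)"
    assume A: "(basis r I1 v \<and> basis d I2 v) \<and> lin_indep J (\<lambda>i. w i v) \<and>
      (\<forall>i\<in>I1 <+> expos r. w i v \<in> P3.span ((\<lambda>i. w i v) ` J))"
    have expand: "\<exists>a. f = (\<Sum>x\<in>B. sc (a x) (gvec ps v x))"
      if B: "basis D B v" "finite B" and f: "f \<in> ?I" "homog f (int D)" for f D B
    proof -
      have "gvec ps v ` gidx ps D \<subseteq> P3.span (gvec ps v ` B)" using B(1) unfolding basis_def by blast
      then have "P3.span (gvec ps v ` gidx ps D) \<subseteq> P3.span (gvec ps v ` B)"
        by (intro P3.span_minimal P3.subspace_span)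
      moreover have "f \<in> P3.span (gvec ps v ` gidx ps D)" using f ideal_span_gvec by blast
      ultimately have "f \<in> P3.span (gvec ps v ` B)" by blast
      then show ?thesis by (rule span_family[OF B(2)])
    qed
    have in_ideal: "(\<Sum>x\<in>B. sc (a x) (gvec ps v x)) \<in> ?I" if "B \<subseteq> gidx ps D" for a B D
      using that by (intro ideal_gen_sum) (auto simp: sc_def intro!: ideal_gen_mult gvec_in_ideal)
    have indJ: "lin_indep (I1 <+> T) (\<lambda>i. w i v)" using A JT by simp
    have homT: "homog (\<Sum>m\<in>T. sc (b m) (mon m)) (int r)" for b :: "_ \<Rightarrow> 'k"
    proof (rule homog_sum)
      fix m assume "m \<in> T"
      then have "mdeg m = r" using T by (auto simp: expos_def)
      then show "homog (sc (b m) (mon m)) (int r)" using homog_sc[OF homog_mon[of m]] by metis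
    qed
    have homLT: "homog (lf v t ^ e * f) (int d)" if "homog f (int r)" for f
      using homog_mult[OF homog_lf_power[of v t e] that] True by (simp add: r_def)
    show "?Q v \<longleftrightarrow> mult_inj (forms v ps) (lf v t ^ e) e (int d)"
    proof
      assume Q: "?Q v"
      show "mult_inj (forms v ps) (lf v t ^ e) e (int d)"
        unfolding mult_inj_def r(1)
      proof (intro allI impI, elim conjE)
        fix f assume f: "homog f (int r)" "lf v t ^ e * f \<in> ?I"
        have "mon ` expos r \<subseteq> P3.span ((\<lambda>i. w i v) ` (I1 <+> T))"
        proof
          fix z :: "'k poly3" assume "z \<in> mon ` expos r"
          then obtain m where "m \<in> expos r" "z = w (Inr m) v" by (auto simp: w_def)
          then show "z \<in> P3.span ((\<lambda>i. w i v) ` (I1 <+> T))" using A JT by auto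
        qed
        then have "hom r \<subseteq> P3.span ((\<lambda>i. w i v) ` (I1 <+> T))"
          unfolding hom_eq_span by (intro P3.span_minimal P3.subspace_span)
        then have "f \<in> P3.span ((\<lambda>i. w i v) ` (I1 <+> T))" using f(1) by (auto simp: hom_def)
        then obtain c where "f = (\<Sum>i\<in>I1 <+> T. sc (c i) (w i v))"
          using span_family[of "I1 <+> T" f "\<lambda>i. w i v"] fin fT by auto
        then have fc: "f = (\<Sum>x\<in>I1. sc (c (Inl x)) (gvec ps v x)) + (\<Sum>m\<in>T. sc (c (Inr m)) (mon m))"
          by (simp add: w_sum fin fT)
        let ?h = "\<Sum>m\<in>T. sc (c (Inr m)) (mon m)"
        have "lf v t ^ e * f - lf v t ^ e * (\<Sum>x\<in>I1. sc (c (Inl x)) (gvec ps v x)) \<in> ?I"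
          by (intro ideal_gen_diff f(2)) (rule ideal_gen_mult[OF in_ideal[OF I1(1)]])
        then have he: "lf v t ^ e * ?h \<in> ?I" by (simp add: fc algebra_simps)
        have "\<exists>a. lf v t ^ e * ?h = (\<Sum>x\<in>I2. sc (a x) (gvec ps v x))"
          by (rule expand[OF _ fin(2) he homLT[OF homT]]) (use A in blast)
        then obtain a where a: "lf v t ^ e * ?h = (\<Sum>x\<in>I2. sc (a x) (gvec ps v x))" by blast
        have "(\<Sum>i\<in>?K. sc (case_sum (\<lambda>x. - a x) (\<lambda>m. c (Inr m)) i) (mvec ps t e v i)) = 0"
          by (simp add: mvec_sum fin fT a P3.scale_minus_left sum_negf)
        then have "c (Inr m) = 0" if "m \<in> T" for m
          using lin_indepD[OF Q, of "case_sum (\<lambda>x. - a x) (\<lambda>m. c (Inr m))" "Inr m"] that by auto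
        then have "?h = 0" by simp
        then show "f \<in> ?I" using fc in_ideal[OF I1(1)] by simp
      qed
    next
      assume inj: "mult_inj (forms v ps) (lf v t ^ e) e (int d)"
      show "?Q v"
        unfolding lin_indep_def
      proof (intro allI impI)
        fix c assume "(\<Sum>i\<in>?K. sc (c i) (mvec ps t e v i)) = 0"
        then have s: "(\<Sum>x\<in>I2. sc (c (Inl x)) (gvec ps v x)) +
            lf v t ^ e * (\<Sum>m\<in>T. sc (c (Inr m)) (mon m)) = 0" by (simp add: mvec_sum fin fT)
        let ?h = "\<Sum>m\<in>T. sc (c (Inr m)) (mon m)"
        have "lf v t ^ e * ?h = - (\<Sum>x\<in>I2. sc (c (Inl x)) (gvec ps v x))"
          using s by (simp add: eq_neg_iff_add_eq_0 add.commute)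
        then have "lf v t ^ e * ?h \<in> ?I" using ideal_gen_neg[OF in_ideal[OF I2(1)]] by simp
        moreover have "homog ?h (int d - int e)" unfolding r(1) by (rule homT)
        ultimately have h: "?h \<in> ?I" by (rule mult_injD[OF inj, rotated])
        have "\<exists>a. ?h = (\<Sum>x\<in>I1. sc (a x) (gvec ps v x))"
          by (rule expand[OF _ fin(1) h homT]) (use A in blast)
        then obtain a where a: "?h = (\<Sum>x\<in>I1. sc (a x) (gvec ps v x))" by blast
        have "(\<Sum>i\<in>I1 <+> T. sc (case_sum (\<lambda>x. - a x) (\<lambda>m. c (Inr m)) i) (w i v)) = 0"
          by (simp add: w_sum fin fT a P3.scale_minus_left sum_negf)
        then have c2: "c (Inr m) = 0" if "m \<in> T" for m
          using lin_indepD[OF indJ, of "case_sum (\<lambda>x. - a x) (\<lambda>m. c (Inr m))" "Inr m"] that by auto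
        then have "(\<Sum>x\<in>I2. sc (c (Inl x)) (gvec ps v x)) = 0" using s by simp
        moreover have "lin_indep I2 (\<lambda>x. gvec ps v x)" using A by (simp add: basis_def)
        ultimately have "c (Inl x) = 0" if "x \<in> I2" for x
          using lin_indepD[of I2 "\<lambda>x. gvec ps v x" "\<lambda>x. c (Inl x)"] that by blast
        then show "\<forall>i\<in>?K. c i = 0" using c2 by auto
      qed
    qed
  qed
  ultimately show ?thesis by (rule decided_cong[rotated])
qed

lemma decided_max_rank:
  assumes "\<forall>i\<in>fst ` set ps. i < N" "t < N"
  shows "decided (3 * N) (\<lambda>v::nat \<Rightarrow> 'k::field_char_0. max_rank (forms v ps) (lf v t ^ e) e (int d))"
  unfolding max_rank_def using decided_mult_inj[OF assms] decided_mult_surj[OF assms]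
  by (rule decided_disj)

subsection \<open>The number p(B)\<close>

definition csum :: "nat list \<Rightarrow> nat \<Rightarrow> nat" where
  "csum cs j = (\<Sum>k<length cs. j + 1 - cs ! k)"

lemma pnum_csum: "pnum cs = (GREATEST j. csum cs j \<le> j)"
proof -
  have "(\<Sum>i | i < length cs \<and> cs ! i \<le> j. j + 1 - cs ! i) = csum cs j" for j
    unfolding csum_def by (rule sum.mono_neutral_left) auto
  then show ?thesis by (simp add: pnum_def)
qed

text \<open>If some exponent is at most \<open>j + 1\<close>, the sum increases strictly from
  \<open>j\<close> to \<open>j + 1\<close>; otherwise it is zero in degree \<open>j\<close>. Hence
  the inequality is inherited downwards and p(B) is a true threshold.\<close>

lemma csum_down:
  assumes "csum cs (Suc j) \<le> Suc j" shows "csum cs j \<le> j"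
proof (cases "\<exists>k<length cs. cs ! k \<le> Suc j")
  case True
  then obtain k where k: "k < length cs" "cs ! k \<le> Suc j" by blast
  have "csum cs j < csum cs (Suc j)"
    unfolding csum_def using k by (intro sum_strict_mono_ex1) (auto intro!: bexI[of _ k])
  then show ?thesis using assms by simp
next
  case False
  then have "csum cs j = 0" by (force simp: csum_def)
  then show ?thesis by simp
qed

lemma csum_down_le: "csum cs k \<le> k \<Longrightarrow> j \<le> k \<Longrightarrow> csum cs j \<le> j"
proof (induction k)
  case (Suc k)
  then show ?case using csum_down[OF Suc.prems(1)] by (cases "j = Suc k") auto
qed simp

lemma pnum_eqI:
  assumes "csum cs p \<le> p" "Suc p < csum cs (Suc p)" shows "pnum cs = p"
  unfolding pnum_csum
proof (rule Greatest_equality)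
  fix j assume "csum cs j \<le> j"
  then show "j \<le> p" using csum_down_le[of cs j "Suc p"] assms(2) by (meson not_less not_less_eq_eq)
qed (rule assms(1))

text \<open>Two generators already force \<open>j \<le> cs ! 0 + cs ! 1\<close>, and positive
  exponents make \<open>j = 0\<close> admissible, so the \<open>GREATEST\<close> in
  \<open>pnum\<close> is attained.\<close>

lemma pnum_bounds:
  assumes "2 \<le> length cs" "\<And>k. k < length cs \<Longrightarrow> 0 < cs ! k"
  shows "csum cs (pnum cs) \<le> pnum cs" "Suc (pnum cs) < csum cs (Suc (pnum cs))"
proof -
  have bound: "j \<le> cs ! 0 + cs ! 1" if "csum cs j \<le> j" for j
  proof -
    have "(j + 1 - cs ! 0) + (j + 1 - cs ! 1) = (\<Sum>k\<in>{0, 1}. j + 1 - cs ! k)" by simp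
    also have "\<dots> \<le> csum cs j" unfolding csum_def using assms(1) by (intro sum_mono2) auto
    finally show ?thesis using that by simp
  qed
  have zero: "csum cs 0 \<le> 0" using assms(2) by (simp add: csum_def Suc_le_eq)
  show "csum cs (pnum cs) \<le> pnum cs"
    unfolding pnum_csum by (rule GreatestI_nat[where P = "\<lambda>j. csum cs j \<le> j", OF zero]) (rule bound)
  have "\<not> csum cs (Suc (pnum cs)) \<le> Suc (pnum cs)"
  proof
    assume "csum cs (Suc (pnum cs)) \<le> Suc (pnum cs)"
    then have "Suc (pnum cs) \<le> pnum cs"
      unfolding pnum_csum by (rule Greatest_le_nat[where P = "\<lambda>j. csum cs j \<le> j"]) (rule bound)
    then show False by simp
  qed
  then show "Suc (pnum cs) < csum cs (Suc (pnum cs))" by simp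
qed

lemma sig_csum: "sig ps d = csum (map snd ps) d"
  unfolding sig_def csum_def mult_at_def by simp

lemma csum_snoc: "csum (cs @ [b]) j = csum cs j + (j + 1 - b)"
  by (simp add: csum_def nth_append)

lemma card_expos_less: "a < b \<Longrightarrow> card (expos a) < card (expos b)"
proof -
  have "card (expos n) < card (expos (Suc n))" for n
    using card_expos[of "Suc n" "Suc 0"] by (simp add: card_bnd tail_def)
  then show "a < b \<Longrightarrow> card (expos a) < card (expos b)"
    by (rule lift_Suc_mono_less[of "\<lambda>d. card (expos d)"])
qed

text \<open>One form of positive degree has fewer monomial multiples in degree \<open>D\<close> than
  there are monomials, for every \<open>D\<close>.\<close>

lemma not_artinian:
  fixes v :: "nat \<Rightarrow> 'k::field"
  assumes "length ps \<le> 1" "\<And>k. k < length ps \<Longrightarrow> 0 < snd (ps ! k)"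
  shows "\<not> artinian (forms v ps)"
proof
  assume "artinian (forms v ps)"
  then obtain D where D: "\<And>f. homog f (int D) \<Longrightarrow> f \<in> ideal_gen (forms v ps)"
    unfolding artinian_def by blast
  have "hom D \<subseteq> P3.span (gvec ps v ` gidx ps D)"
  proof
    fix f :: "'k poly3" assume "f \<in> hom D"
    then have f: "homog f (int D)" by (simp add: hom_def)
    show "f \<in> P3.span (gvec ps v ` gidx ps D)" using ideal_span_gvec[OF f] D[OF f] by blast
  qed
  then have "card (expos D) \<le> card (gvec ps v ` gidx ps D)" by (rule hom_span_card[rotated]) simp
  also have "\<dots> \<le> card (gidx ps D)" by (rule card_image_le) simp
  finally have le: "card (expos D) \<le> card (gidx ps D)" .
  have "card (gidx ps D) = (\<Sum>k<length ps. card (if snd (ps ! k) \<le> D then expos (D - snd (ps ! k)) else {}))"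
    unfolding gidx_def by (rule card_SigmaI) auto
  also have "\<dots> < card (expos D)"
  proof -
    have pos: "0 < card (expos D)" using card_expos[of D "Suc 0"] by (simp add: card_bnd)
    show ?thesis
    proof (cases "length ps = 1")
      case True
      then have eq: "{..<length ps} = {0}" by auto
      have less: "card (expos (D - snd (ps ! 0))) < card (expos D)" if "snd (ps ! 0) \<le> D"
      proof (rule card_expos_less)
        show "D - snd (ps ! 0) < D" using assms(2)[of 0] True that by simp
      qed
      show ?thesis unfolding eq using pos less by simp
    next
      case False
      then show ?thesis using assms(1) pos by simp
    qed
  qed
  finally show False using le by simp
qed

section \<open>Combining the generic conditions and comparing with \<open>SLP\<close>\<close>

lemma forms_snoc: "forms v (ps @ [(i, c)]) = forms v ps @ [lf v i ^ c]"
  by (simp add: forms_def)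

text \<open>The hypotheses of the algebraic equivalence concern finitely many exponents and degrees,
  because surjectivity propagates upwards from the first degree after each threshold. So they hold
  simultaneously at a general point.\<close>

lemma general_lefschetz_conditions:
  fixes a :: "nat list"
  assumes s: "length a = s" "2 \<le> s" and pos: "\<And>k. k < s \<Longrightarrow> 0 < a ! k"
  defines "ps \<equiv> zip [0..<s] a" and "p \<equiv> pnum a"
  shows "general (3 * (s + 2)) (\<lambda>v::nat \<Rightarrow> 'k::field_char_0.
    ((\<forall>d\<ge>1. max_rank_each_degree (forms v ps @ [lf v s ^ 3]) (lf v (s + 1) ^ d) d) \<longleftrightarrow>
      (\<forall>b. 3 \<le> b \<and> b \<le> p \<longrightarrow> max_rank_each_degree (forms v ps @ [lf v (s + 1) ^ b]) (lf v s ^ 3) 3)) \<and>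
    ((\<forall>b. 3 \<le> b \<and> b \<le> p \<longrightarrow> max_rank_each_degree (forms v ps @ [lf v (s + 1) ^ b]) (lf v s ^ 3) 3) \<longleftrightarrow>
      (\<forall>b. 3 \<le> b \<and> b \<le> p \<longrightarrow> max_rank (forms v ps @ [lf v (s + 1) ^ b]) (lf v s ^ 3) 3
        (int (pnum (a @ [b])) + 2))))"
proof -
  define pb where "pb b = pnum (a @ [b])" for b
  define q where "q = pnum (a @ [3])"
  let ?N = "s + 2"
  let ?B = "\<lambda>b. ps @ [(s + 1, b)]"
  let ?C = "ps @ [(s, 3)]"
  have map_ps: "map fst ps = [0..<s]" "map snd ps = a" using s(1) by (simp_all add: ps_def)
  have fst_ps: "fst ` set ps = {0..<s}" using map_ps(1) by (metis list.set_map set_upt)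
  have gp: "generic_position ps s ?N" "generic_position ps (s + 1) ?N"
    "generic_position (?B b) s ?N" "generic_position ?C (s + 1) ?N" for b
    using map_ps(1) fst_ps unfolding generic_position_def by auto
  have sig: "sig ps j = csum a j" "sig (?B b) j = csum (a @ [b]) j" "sig ?C j = csum (a @ [3]) j" for b j
    by (simp_all add: sig_csum map_ps)
  have p: "csum a p \<le> p" "Suc p < csum a (Suc p)"
    unfolding p_def using s pos by (simp_all add: pnum_bounds)
  have pb: "csum (a @ [b]) (pb b) \<le> pb b" "Suc (pb b) < csum (a @ [b]) (Suc (pb b))" if "0 < b" for b
    unfolding pb_def using s pos that by (auto intro!: pnum_bounds simp: nth_append less_Suc_eq)
  have q: "csum (a @ [3]) q \<le> q" "Suc q < csum (a @ [3]) (Suc q)"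
    using pb[of 3] by (simp_all add: q_def pb_def)
  \<comment> \<open>A generator of degree \<open>p + 1\<close> contributes nothing in degree
    \<open>p\<close>, while in degree \<open>p + 1\<close> the sum is too large already.\<close>
  have pbp: "pb (Suc p) = p" unfolding pb_def by (rule pnum_eqI) (use p in \<open>simp_all add: csum_snoc\<close>)
  define R where "R rs t v d \<longleftrightarrow> (sig rs d \<le> d \<longrightarrow> mult_inj (forms v rs) (lf v t) 1 (int d)) \<and>
    (d < sig rs d \<longrightarrow> mult_surj (forms v rs) (lf v t) 1 (int d))" for rs t d and v :: "nat \<Rightarrow> 'k"
  define U where "U rs t v d \<longleftrightarrow>
    (cost rs 3 (Suc d) \<le> 3 * Suc d \<longrightarrow> mult_inj (forms v rs) (lf v t ^ 3) 3 (int (Suc d))) \<and>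
    (3 * Suc d \<le> cost rs 3 (Suc d) \<longrightarrow> mult_surj (forms v rs) (lf v t ^ 3) 3 (int (Suc d)))"
    for rs t d and v :: "nat \<Rightarrow> 'k"
  have gR: "general (3 * ?N) (\<lambda>v. \<forall>d\<in>{..D}. R rs t v d)" if "generic_position rs t ?N" for rs t D
    unfolding R_def by (intro general_ball general_rank_1 that) simp
  have gU: "general (3 * ?N) (\<lambda>v. U rs t v d)" if "generic_position rs t ?N" "sig rs d \<le> d" for rs t d
    unfolding U_def by (rule general_rank_3[OF that])
  have g1: "general (3 * ?N) (\<lambda>v. \<forall>d\<in>{..Suc p}. R ps s v d)" by (intro gR gp)
  have g2: "general (3 * ?N) (\<lambda>v. \<forall>d\<in>{..p}. R ps (s + 1) v d)" by (intro gR gp)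
  have g3: "general (3 * ?N) (\<lambda>v. \<forall>b\<in>{3..p}. \<forall>d\<in>{..Suc (pb b)}. R (?B b) s v d)"
    by (intro general_ball gR gp) simp
  have g4: "general (3 * ?N) (\<lambda>v. \<forall>d\<in>{..Suc q}. R ?C (s + 1) v d)" by (intro gR gp)
  have g5: "general (3 * ?N) (\<lambda>v::nat \<Rightarrow> 'k. max_rank (forms v ?C) (lf v (s + 1) ^ 2) 2 (int (Suc q)))"
    by (rule general_rank_2[OF gp(4)]) (simp add: sig q)
  have g6: "general (3 * ?N) (\<lambda>v. U ps s v p)" by (intro gU gp) (simp add: sig p)
  have g7: "general (3 * ?N) (\<lambda>v. U ps (s + 1) v p)" by (intro gU gp) (simp add: sig p)
  have g8: "general (3 * ?N) (\<lambda>v. \<forall>b\<in>{3..Suc p}. U (?B b) s v (pb b))"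
  proof (rule general_ball)
    fix b assume "b \<in> {3..Suc p}"
    then have "sig (?B b) (pb b) \<le> pb b" unfolding sig by (intro pb(1)) simp
    then show "general (3 * ?N) (\<lambda>v. U (?B b) s v (pb b))" by (intro gU gp)
  qed simp
  have g9: "general (3 * ?N) (\<lambda>v::nat \<Rightarrow> 'k.
      mult_surj (forms v (?B (p + 2))) (lf v s ^ 3) 3 (int (p + 2)))"
    by (rule general_rank_top[OF gp(3)]) (simp_all add: sig p)
  show ?thesis
  proof (rule general_mono[OF general_conj[OF g1 general_conj[OF g2 general_conj[OF g3 general_conj[OF g4
      general_conj[OF g5 general_conj[OF g6 general_conj[OF g7 general_conj[OF g8 g9]]]]]]]]], elim conjE)
    fix v :: "nat \<Rightarrow> 'k"
    assume c1: "\<forall>d\<in>{..Suc p}. R ps s v d" and c2: "\<forall>d\<in>{..p}. R ps (s + 1) v d"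
      and c3: "\<forall>b\<in>{3..p}. \<forall>d\<in>{..Suc (pb b)}. R (?B b) s v d"
      and c4: "\<forall>d\<in>{..Suc q}. R ?C (s + 1) v d"
      and c5: "max_rank (forms v ?C) (lf v (s + 1) ^ 2) 2 (int (Suc q))"
      and c6: "U ps s v p" and c7: "U ps (s + 1) v p"
      and c8: "\<forall>b\<in>{3..Suc p}. U (?B b) s v (pb b)"
      and c9: "mult_surj (forms v (?B (p + 2))) (lf v s ^ 3) 3 (int (p + 2))"
    have 1: "mult_inj (forms v ps) (lf v s) 1 (int d)" if "d \<le> p" for d
      using c1 csum_down_le[OF p(1) that] that by (simp add: R_def sig)
    have 2: "mult_surj (forms v ps) (lf v s) 1 (int (Suc p))"
      using c1[rule_format, of "Suc p"] p(2) by (simp add: R_def sig)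
    have 3: "mult_inj (forms v ps) (lf v (s + 1)) 1 (int d)" if "d \<le> p" for d
      using c2 csum_down_le[OF p(1) that] that by (simp add: R_def sig)
    have 4: "mult_inj (forms v ps @ [lf v (s + 1) ^ b]) (lf v s) 1 (int d)"
      if "3 \<le> b" "b \<le> p" "d \<le> pb b" for b d
      using c3[rule_format, of b d] csum_down_le[OF pb(1) that(3)] that
      unfolding R_def sig forms_snoc by simp
    have 5: "mult_surj (forms v ps @ [lf v (s + 1) ^ b]) (lf v s) 1 (int (Suc (pb b)))"
      if "3 \<le> b" "b \<le> p" for b
      using c3[rule_format, of b "Suc (pb b)"] pb(2)[of b] that unfolding R_def sig forms_snoc by simp
    have 6: "mult_inj (forms v ps @ [lf v s ^ 3]) (lf v (s + 1)) 1 (int d)" if "d \<le> q" for d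
      using c4[rule_format, of d] csum_down_le[OF q(1) that] that unfolding R_def sig forms_snoc by simp
    have 7: "mult_surj (forms v ps @ [lf v s ^ 3]) (lf v (s + 1)) 1 (int (Suc q))"
      using c4[rule_format, of "Suc q"] q(2) unfolding R_def sig forms_snoc by simp
    have 8: "max_rank (forms v ps @ [lf v s ^ 3]) (lf v (s + 1) ^ 2) 2 (int (Suc q))"
      using c5 unfolding forms_snoc .
    \<comment> \<open>The numerical criterion in \<open>U\<close> does not depend on the multiplier,
      so the cubes of both forms are injective together.\<close>
    have 9: "(mult_inj (forms v ps) (lf v s ^ 3) 3 (int (Suc p)) \<and>
        mult_inj (forms v ps) (lf v (s + 1) ^ 3) 3 (int (Suc p))) \<or>
      mult_surj (forms v ps) (lf v s ^ 3) 3 (int (Suc p))"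
      using c6 c7 unfolding U_def by (meson nat_le_linear)
    have 10: "max_rank (forms v ps @ [lf v (s + 1) ^ b]) (lf v s ^ 3) 3 (int (Suc (pb b)))"
      if "3 \<le> b" "b \<le> Suc p" for b
      using c8[rule_format, of b] that unfolding U_def max_rank_def forms_snoc
      by (meson atLeastAtMost_iff nat_le_linear)
    have 11: "mult_surj (forms v ps @ [lf v (s + 1) ^ (p + 2)]) (lf v s ^ 3) 3 (int (p + 2))"
      using c9 unfolding forms_snoc .
    note L = lefschetz_cube_equivalence[OF homog_list_forms homog_lf homog_lf 1 2 3 4 5 6 7 8 9 10 pbp 11]
    show "((\<forall>d\<ge>1. max_rank_each_degree (forms v ps @ [lf v s ^ 3]) (lf v (s + 1) ^ d) d) \<longleftrightarrow>
      (\<forall>b. 3 \<le> b \<and> b \<le> p \<longrightarrow> max_rank_each_degree (forms v ps @ [lf v (s + 1) ^ b]) (lf v s ^ 3) 3)) \<and>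
    ((\<forall>b. 3 \<le> b \<and> b \<le> p \<longrightarrow> max_rank_each_degree (forms v ps @ [lf v (s + 1) ^ b]) (lf v s ^ 3) 3) \<longleftrightarrow>
      (\<forall>b. 3 \<le> b \<and> b \<le> p \<longrightarrow> max_rank (forms v ps @ [lf v (s + 1) ^ b]) (lf v s ^ 3) 3
        (int (pnum (a @ [b])) + 2)))"
      using L unfolding pb_def by (intro conjI)
  qed
qed

text \<open>The last form is moved while the others stay fixed: if the pointwise condition holds
  generically, it does so for a general last form; if it fails generically, no open set
  of last forms can satisfy it.\<close>
lemma general_SLP_iff:
  assumes "decided (3 * (k + 1)) (\<lambda>v::nat \<Rightarrow> 'k::field_char_0.
      \<forall>d\<ge>1. max_rank_each_degree (gs v) (lf v k ^ d) d)"
    and gs: "\<And>v v'. (\<forall>i<3 * k. v i = v' i) \<Longrightarrow> gs v = gs v'"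
  shows "general (3 * (k + 1)) (\<lambda>v::nat \<Rightarrow> 'k.
      SLP (gs v) \<longleftrightarrow> (\<forall>d\<ge>1. max_rank_each_degree (gs v) (lf v k ^ d) d))"
proof -
  let ?n = "3 * (k + 1)"
  let ?Q = "\<lambda>v::nat \<Rightarrow> 'k. \<forall>d\<ge>1. max_rank_each_degree (gs v) (lf v k ^ d) d"
  define upd where "upd v u i = (if i < 3 * k then v i else u (i - 3 * k))" for v u :: "nat \<Rightarrow> 'k" and i
  have gs_upd: "gs (upd v u) = gs v" for v u by (rule gs) (simp add: upd_def)
  have lf_upd: "lf (upd v u) k = linform (u 0) (u 1) (u 2)" for v u
    by (simp add: lf_def upd_def)
  have upd_self: "upd v (\<lambda>i. v (i + 3 * k)) = v" for v by (rule ext) (simp add: upd_def)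
  have restrict: "(\<lambda>u. f (upd v u)) \<in> polyfun 3" if "f \<in> polyfun ?n" for f v
    using that
  proof (rule polyfun_subst)
    fix i assume "i < ?n"
    then show "(\<lambda>u. upd v u i) \<in> polyfun 3"
      by (cases "i < 3 * k") (auto simp: upd_def intro: polyfun_const polyfun_var)
  qed
  from assms(1) consider "general ?n ?Q" | "general ?n (\<lambda>v. \<not> ?Q v)" unfolding decided_def by blast
  then show ?thesis
  proof cases
    case 1
    then obtain f v0 where f: "f \<in> polyfun ?n" "f v0 \<noteq> 0" "\<forall>v. f v \<noteq> 0 \<longrightarrow> ?Q v"
      unfolding general_polyfun by blast
    have "SLP (gs v) \<longleftrightarrow> ?Q v" if v: "f v \<noteq> 0" for v
    proof -
      have "SLP (gs v)"
        unfolding SLP_def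
      proof (rule generalI[OF restrict[OF f(1)]])
        show "f (upd v (\<lambda>i. v (i + 3 * k))) \<noteq> 0" using v by (simp add: upd_self)
        fix u assume "f (upd v u) \<noteq> 0"
        then have "?Q (upd v u)" using f(3) by blast
        then show "\<forall>d\<ge>1. max_rank_each_degree (gs v) (linform (u 0) (u 1) (u 2) ^ d) d"
          by (simp only: gs_upd lf_upd)
      qed
      then show ?thesis using f(3) v by blast
    qed
    then show ?thesis by (rule generalI[OF f(1,2)])
  next
    case 2
    then obtain f v0 where f: "f \<in> polyfun ?n" "f v0 \<noteq> 0" "\<forall>v. f v \<noteq> 0 \<longrightarrow> \<not> ?Q v"
      unfolding general_polyfun by blast
    have "SLP (gs v) \<longleftrightarrow> ?Q v" if v: "f v \<noteq> 0" for v
    proof -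
      have "\<not> SLP (gs v)"
      proof
        assume "SLP (gs v)"
        then have S: "general 3 (\<lambda>u. \<forall>d\<ge>1. max_rank_each_degree (gs v) (linform (u 0) (u 1) (u 2) ^ d) d)"
          unfolding SLP_def .
        have "general 3 (\<lambda>u. f (upd v u) \<noteq> 0)"
          by (rule generalI[OF restrict[OF f(1)], of v "\<lambda>i. v (i + 3 * k)"]) (use v in \<open>simp_all add: upd_self\<close>)
        from general_ex[OF general_conj[OF S this]] obtain u where
          u: "\<forall>d\<ge>1. max_rank_each_degree (gs v) (linform (u 0) (u 1) (u 2) ^ d) d" "f (upd v u) \<noteq> 0"
          by blast
        have "?Q (upd v u)" using u(1) by (simp only: gs_upd lf_upd)
        then show False using f(3) u(2) by blast
      qed
      then show ?thesis using f(3) v by blast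
    qed
    then show ?thesis by (rule generalI[OF f(1,2)])
  qed
qed

theorem theorem7p5:
  fixes s :: nat and a :: "nat list"
  assumes "length a = s" and "\<forall>i<s. 0 < a ! i"
  shows "general (3 * s + 6) (\<lambda>v::nat \<Rightarrow> 'k::field_char_0.
    (let Ls = map (\<lambda>i. linform (v (3*i)) (v (3*i+1)) (v (3*i+2))) [0..<s];
         I = map (\<lambda>i. Ls ! i ^ (a ! i)) [0..<s];
         ell = linform (v (3*s)) (v (3*s+1)) (v (3*s+2));
         L = linform (v (3*s+3)) (v (3*s+4)) (v (3*s+5));
         Pa = SLP (I @ [ell ^ 3]);
         Pb = (\<forall>b. 3 \<le> b \<and> b \<le> pnum a \<longrightarrow>
                 max_rank_each_degree (I @ [L ^ b]) (ell ^ 3) 3);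
         Pc = (\<forall>b. 3 \<le> b \<and> b \<le> pnum a \<longrightarrow>
                 max_rank (I @ [L ^ b]) (ell ^ 3) 3 (int (pnum (a @ [b])) + 2))
     in artinian I \<longrightarrow> (Pa \<longleftrightarrow> Pb) \<and> (Pb \<longleftrightarrow> Pc)))"
proof -
  define ps where "ps = zip [0..<s] a"
  define p where "p = pnum a"
  have len: "length ps = s" using assms(1) by (simp add: ps_def)
  have ps_nth: "ps ! i = (i, a ! i)" if "i < s" for i using that assms(1) by (simp add: ps_def)
  have I_forms: "map (\<lambda>i. map (\<lambda>i. linform (v (3*i)) (v (3*i+1)) (v (3*i+2))) [0..<s] ! i ^ (a ! i)) [0..<s]
      = forms v ps" for v :: "nat \<Rightarrow> 'k"
    by (rule nth_equalityI) (simp_all add: len forms_nth ps_nth lf_def)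
  have ell: "linform (v (3*s)) (v (3*s+1)) (v (3*s+2)) = lf v s"
    and L: "linform (v (3*s+3)) (v (3*s+4)) (v (3*s+5)) = lf v (s + 1)" for v :: "nat \<Rightarrow> 'k"
    by (simp_all add: lf_def algebra_simps)
  let ?N = "s + 2"
  let ?Pb = "\<lambda>v::nat \<Rightarrow> 'k. \<forall>b. 3 \<le> b \<and> b \<le> p \<longrightarrow>
      max_rank_each_degree (forms v ps @ [lf v (s + 1) ^ b]) (lf v s ^ 3) 3"
  let ?Pc = "\<lambda>v::nat \<Rightarrow> 'k. \<forall>b. 3 \<le> b \<and> b \<le> p \<longrightarrow>
      max_rank (forms v ps @ [lf v (s + 1) ^ b]) (lf v s ^ 3) 3 (int (pnum (a @ [b])) + 2)"
  let ?Pa' = "\<lambda>v::nat \<Rightarrow> 'k. \<forall>d\<ge>1.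
      max_rank_each_degree (forms v ps @ [lf v s ^ 3]) (lf v (s + 1) ^ d) d"
  have "general (3 * ?N) (\<lambda>v::nat \<Rightarrow> 'k. artinian (forms v ps) \<longrightarrow>
      (SLP (forms v ps @ [lf v s ^ 3]) \<longleftrightarrow> ?Pb v) \<and> (?Pb v \<longleftrightarrow> ?Pc v))"
  proof (cases "2 \<le> s")
    case False
    \<comment> \<open>With at most one generator the quotient is never artinian, so the implication
      is vacuous.\<close>
    have "\<not> artinian (forms v ps)" for v :: "nat \<Rightarrow> 'k"
      by (rule not_artinian) (use False len assms(2) in \<open>auto simp: ps_nth\<close>)
    then show ?thesis by (intro general_True) blast
  next
    case True
    have equiv: "general (3 * ?N) (\<lambda>v. (?Pa' v \<longleftrightarrow> ?Pb v) \<and> (?Pb v \<longleftrightarrow> ?Pc v))"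
      unfolding ps_def p_def by (rule general_lefschetz_conditions) (use True assms in auto)
    \<comment> \<open>\<open>?Pa'\<close> ranges over all exponents \<open>d\<close> and is decided
      indirectly: (c) is a finite conjunction of single maximal rank conditions and is generically
      equivalent to it.\<close>
    have "decided (3 * ?N) (\<lambda>v::nat \<Rightarrow> 'k. \<forall>b\<in>{3..p}.
        max_rank (forms v (ps @ [(s + 1, b)])) (lf v s ^ 3) 3 (int (pnum (a @ [b]) + 2)))"
      by (intro decided_ball decided_max_rank) (auto simp: ps_def dest: set_zip_leftD)
    moreover have "general (3 * ?N) (\<lambda>v::nat \<Rightarrow> 'k. (\<forall>b\<in>{3..p}.
        max_rank (forms v (ps @ [(s + 1, b)])) (lf v s ^ 3) 3 (int (pnum (a @ [b]) + 2))) \<longleftrightarrow> ?Pa' v)"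
    proof (rule general_mono[OF equiv])
      fix v :: "nat \<Rightarrow> 'k"
      assume E: "(?Pa' v \<longleftrightarrow> ?Pb v) \<and> (?Pb v \<longleftrightarrow> ?Pc v)"
      have "(\<forall>b\<in>{3..p}. max_rank (forms v (ps @ [(s + 1, b)])) (lf v s ^ 3) 3 (int (pnum (a @ [b]) + 2)))
          \<longleftrightarrow> ?Pc v"
        by (simp only: forms_snoc of_nat_add of_nat_numeral Ball_def atLeastAtMost_iff)
      with E show "(\<forall>b\<in>{3..p}. max_rank (forms v (ps @ [(s + 1, b)])) (lf v s ^ 3) 3
          (int (pnum (a @ [b]) + 2))) \<longleftrightarrow> ?Pa' v" by blast
    qed
    ultimately have "decided (3 * ?N) ?Pa'" by (rule decided_cong[rotated])
    then have "general (3 * ?N) (\<lambda>v::nat \<Rightarrow> 'k. SLP (forms v ps @ [lf v s ^ 3]) \<longleftrightarrow> ?Pa' v)"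
    proof -
      assume dec: "decided (3 * ?N) ?Pa'"
      \<comment> \<open>The moving form is \<open>L\<close>, of index \<open>s + 1\<close>; the
        ideal of \<open>A/l^3A\<close> only involves the coordinates below
        \<open>3 * (s + 1)\<close>.\<close>
      have N: "3 * ?N = 3 * (s + 1 + 1)" by simp
      have loc: "forms v ps @ [lf v s ^ 3] = forms v' ps @ [lf v' s ^ 3]"
        if e: "\<forall>i<3 * (s + 1). v i = v' i" for v v' :: "nat \<Rightarrow> 'k"
      proof -
        have lf: "lf v i = lf v' i" if "i \<le> s" for i using e that by (simp add: lf_def)
        have "forms v ps = forms v' ps"
          by (rule nth_equalityI) (simp_all add: len forms_nth ps_nth lf)
        then show ?thesis using lf by simp
      qed
      show ?thesis
        unfolding N by (rule general_SLP_iff[OF dec[unfolded N] loc])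
    qed
    from general_conj[OF this equiv] show ?thesis by (rule general_mono) blast
  qed
  then show ?thesis
    unfolding Let_def I_forms ell L p_def by (simp add: add.commute)
qed

end
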